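(* Let $g\ge 2$ and $n>2$ be integers. There exist a totally real hyperelliptic curve $C$ of genus $g$, a Weierstrass point $W$ of $C$, and a point $P\in C$ such that $P$ is a (primitive) $n$-torsion point modulo $W$, if and only if $n>2g$.
   Context: A totally real hyperelliptic curve of genus $g$ is the smooth projective complex curve $C_D$ with affine equation $y^2=D(x)$, where $D$ is a polynomial of degree $2g+2$ with simple roots, all of which are real. Points of $C$ are complex points. The Weierstrass points are the fixed points of the hyperelliptic involution. Given a hyperelliptic curve $C$ and a Weierstrass point $W$ of $C$, let $\varphi_W\colon C\to J_C$ be the Abel–Jacobi map into the Jacobian, sending $W$ to the origin, i.e. $\varphi_W(P)$ is the class of $P-W$. A point $P\in C$ is a (primitive) $n$-torsion point modulo $W$ if $n\varphi_W(P)=0$ and $n'\varphi_W(P)\neq0$ for all $0<n'<n$, i.e. $\varphi_W(P)$ has exact order $n$ in $J_C$. *)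

theory Defs
  imports
    Complex_Main
    "HOL-Computational_Algebra.Polynomial"
    "HOL-Computational_Algebra.Formal_Laurent_Series"
    "HOL-Algebra.Coset"
    "HOL-Algebra.Free_Abelian_Groups"
begin

definition totally_real_hyperelliptic :: "nat \<Rightarrow> complex poly \<Rightarrow> bool" where
  "totally_real_hyperelliptic g D \<longleftrightarrow>
     Polynomial.degree D = 2 * g + 2 \<and> rsquarefree D \<and> (\<forall>e. poly D e = 0 \<longrightarrow> e \<in> \<real>)"

text \<open>
  The smooth projective model of \<open>y\<^sup>2 = D(x)\<close> with \<open>deg D = 2g + 2\<close> is glued from the affine
  charts \<open>y\<^sup>2 = D(x)\<close> and \<open>v\<^sup>2 = u\<^bsup>2g+2\<^esup> D(1/u)\<close> along \<open>u = 1/x\<close>, \<open>v = y/x\<^bsup>g+1\<^esup>\<close>.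
  The only points of the second chart outside the first one have \<open>u = 0\<close>, so that \<open>v\<^sup>2\<close> is the
  leading coefficient of \<open>D\<close>; \<open>Infinite v\<close> stands for \<open>(u, v) = (0, v)\<close>.
\<close>

datatype point = Affine complex complex | Infinite complex

definition curve_points :: "complex poly \<Rightarrow> point set" where
  "curve_points D =
     {Affine x y | x y. y ^ 2 = poly D x} \<union> {Infinite v | v. v ^ 2 = lead_coeff D}"

fun hyperelliptic_involution :: "point \<Rightarrow> point" where
  "hyperelliptic_involution (Affine x y) = Affine x (- y)"
| "hyperelliptic_involution (Infinite v) = Infinite (- v)"

definition weierstrass_points :: "complex poly \<Rightarrow> point set" where
  "weierstrass_points D = {P \<in> curve_points D. hyperelliptic_involution P = P}"

text \<open>
  Orders of rational functions are computed in the completed local rings. A pair \<open>(U, V)\<close> of formal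
  power series in \<open>t\<close> satisfying the equation of a smooth plane curve, centred at a point of that
  curve and with nonzero tangent vector, identifies the completed local ring at the point with
  \<open>\<complex>[[t]]\<close>; the order of a function is then the \<open>t\<close>-adic valuation of its pullback.
\<close>

definition immersed_arc_at :: "complex \<Rightarrow> complex \<Rightarrow> complex fls \<Rightarrow> complex fls \<Rightarrow> bool" where
  "immersed_arc_at a b U V \<longleftrightarrow>
     fls_subdegree U \<ge> 0 \<and> fls_subdegree V \<ge> 0 \<and>
     fls_nth U 0 = a \<and> fls_nth V 0 = b \<and> (fls_nth U 1 \<noteq> 0 \<or> fls_nth V 1 \<noteq> 0)"

definition fls_eval_poly :: "complex poly \<Rightarrow> complex fls \<Rightarrow> complex fls" where
  "fls_eval_poly A X = poly (map_poly fls_const A) X"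

text \<open>
  \<open>X\<close> and \<open>Y\<close> are the pullbacks of the functions \<open>x\<close> and \<open>y\<close>; the exponent
  \<open>degree D div 2\<close> is \<open>g + 1\<close>.
\<close>

definition local_parametrization ::
    "complex poly \<Rightarrow> point \<Rightarrow> complex fls \<Rightarrow> complex fls \<Rightarrow> bool" where
  "local_parametrization D P X Y \<longleftrightarrow>
     Y ^ 2 = fls_eval_poly D X \<and>
     (case P of
        Affine a b \<Rightarrow> immersed_arc_at a b X Y
      | Infinite c \<Rightarrow> immersed_arc_at 0 c (inverse X) (Y / X ^ (Polynomial.degree D div 2)))"

text \<open>
  The function field \<open>\<complex>(x) \<oplus> \<complex>(x) y\<close> consists of the \<open>(A(x) + B(x) y) / H(x)\<close> with polynomials
  \<open>A\<close>, \<open>B\<close>, \<open>H\<close>. The triples \<open>(A, B, H)\<close> below represent its nonzero elements.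
\<close>

definition nonzero_functions :: "(complex poly \<times> complex poly \<times> complex poly) set" where
  "nonzero_functions = {(A, B, H). (A \<noteq> 0 \<or> B \<noteq> 0) \<and> H \<noteq> 0}"

definition function_pullback ::
    "complex poly \<times> complex poly \<times> complex poly \<Rightarrow> complex fls \<Rightarrow> complex fls \<Rightarrow> complex fls" where
  "function_pullback f X Y =
     (case f of (A, B, H) \<Rightarrow> (fls_eval_poly A X + fls_eval_poly B X * Y) / fls_eval_poly H X)"

text \<open>
  Two local parametrizations at a point of the curve differ by a change of variable
  \<open>t \<mapsto> c t + \<dots>\<close> with \<open>c \<noteq> 0\<close>, so the order does not depend on the one chosen.
\<close>

definition order_at ::
    "complex poly \<Rightarrow> point \<Rightarrow> complex poly \<times> complex poly \<times> complex poly \<Rightarrow> int" where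
  "order_at D P f =
     (let (X, Y) = (SOME (X, Y). local_parametrization D P X Y)
      in fls_subdegree (function_pullback f X Y))"

definition divisor_degree :: "(point \<Rightarrow>\<^sub>0 int) \<Rightarrow> int" where
  "divisor_degree c = (\<Sum>P \<in> Poly_Mapping.keys c. Poly_Mapping.lookup c P)"

definition degree_zero_divisors :: "complex poly \<Rightarrow> (point \<Rightarrow>\<^sub>0 int) monoid" where
  "degree_zero_divisors D =
     free_Abelian_group (curve_points D)
       \<lparr>carrier := {c \<in> carrier (free_Abelian_group (curve_points D)). divisor_degree c = 0}\<rparr>"

definition principal_divisors :: "complex poly \<Rightarrow> (point \<Rightarrow>\<^sub>0 int) set" where
  "principal_divisors D =
     {c \<in> carrier (free_Abelian_group (curve_points D)).
        \<exists>f \<in> nonzero_functions. \<forall>P \<in> curve_points D. Poly_Mapping.lookup c P = order_at D P f}"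

text \<open>The Jacobian is the group of divisor classes of degree zero, in multiplicative notation.\<close>

definition jacobian :: "complex poly \<Rightarrow> (point \<Rightarrow>\<^sub>0 int) set monoid" where
  "jacobian D = degree_zero_divisors D Mod principal_divisors D"

definition abel_jacobi :: "complex poly \<Rightarrow> point \<Rightarrow> point \<Rightarrow> (point \<Rightarrow>\<^sub>0 int) set" where
  "abel_jacobi D W P = principal_divisors D #>\<^bsub>degree_zero_divisors D\<^esub> (frag_of P - frag_of W)"

definition primitive_torsion_point :: "complex poly \<Rightarrow> point \<Rightarrow> nat \<Rightarrow> point \<Rightarrow> bool" where
  "primitive_torsion_point D W n P \<longleftrightarrow>
     abel_jacobi D W P [^]\<^bsub>jacobian D\<^esub> n = \<one>\<^bsub>jacobian D\<^esub> \<and>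
     (\<forall>n'. 0 < n' \<and> n' < n \<longrightarrow> abel_jacobi D W P [^]\<^bsub>jacobian D\<^esub> n' \<noteq> \<one>\<^bsub>jacobian D\<^esub>)"

end

theory Submission
  imports
    Defs
    "HOL-Analysis.Analysis"
    "HOL-Computational_Algebra.Fundamental_Theorem_Algebra"
begin

text \<open>
  Let \<open>W = (e, 0)\<close>, and let \<open>\<iota>\<close> be the hyperelliptic involution. Torsion of order dividing \<open>n\<close> means
  that some function \<open>h = (A + B y) / H\<close> has divisor \<open>n (P - W)\<close>.

  \<^bold>\<open>Orders up to \<open>2 g\<close> do not occur.\<close> The function \<open>h - h \<circ> \<iota> = 2 B y / H\<close> has no pole outside \<open>W\<close>. If
  \<open>B \<noteq> 0\<close>, then \<open>B / H\<close> is regular away from \<open>e\<close> and vanishes to order at least \<open>g + 1\<close> at infinity, so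
  it has a pole of order at least \<open>g + 1\<close> at \<open>e\<close>. As \<open>x - e\<close> has order 2 and \<open>y\<close> order 1 at \<open>W\<close>, the pole
  of \<open>h\<close> has order at least \<open>2 g + 1\<close> (\<open>pole_bound\<close>). So \<open>n \<le> 2 g\<close> forces \<open>B = 0\<close>; then
  \<open>h\<close> takes the same order at \<open>P\<close> and \<open>\<iota> P\<close>, hence \<open>P\<close> is a Weierstrass point and the order of its
  class divides 2.

  \<^bold>\<open>Existence.\<close> Write \<open>n = 2 m + \<epsilon>\<close> with \<open>\<epsilon> \<le> 1\<close>. A solution of \<open>A\<^sup>2 - D B\<^sup>2 = x\<^sup>\<epsilon>\<close> with
  \<open>deg A = m + \<epsilon>\<close> and \<open>D(0) = 0\<close> makes \<open>(A - B y) / x\<^bsup>m+\<epsilon>\<^esup>\<close> a function with divisor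
  \<open>n (P - W)\<close>, where \<open>W = (0, 0)\<close> and \<open>P\<close> is one of the points at infinity (\<open>pell_torsion\<close>). With
  \<open>A = x\<^sup>\<epsilon> T\<close> one needs \<open>x\<^sup>\<epsilon> T\<^sup>2 - 1\<close> to have only real roots, all but \<open>2 g + 2 - \<epsilon>\<close> of them
  double. For this, \<open>g\<close> of the roots of \<open>T\<close> are placed far to the right of \<open>[0, 1]\<close>, and the other
  factor \<open>R\<close> of \<open>T\<close> is the extremal polynomial on \<open>[0, 1]\<close> for the resulting weight
  (\<open>weighted_chebyshev\<close>): the \<open>m - g + 1\<close> points where \<open>\<surd>x\<^sup>\<epsilon> T\<close> alternates between \<open>1\<close> and \<open>-1\<close> yield
  the double roots, and the band around each remote root yields two simple ones. A count of roots
  against the degree shows that this is everything, with simple roots at \<open>1\<close> and, for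
  \<open>\<epsilon> = 0\<close>, at \<open>0\<close> (\<open>totally_real_pell\<close>).

  \<^bold>\<open>Exactness of the order.\<close> On a band \<open>[a, b]\<close> around a remote root, \<open>y\<close> is imaginary, and
  \<open>(A - B y) / (A + B y) = exp (-2 i \<theta>)\<close>, where \<open>\<theta>\<close> runs from \<open>0\<close> to \<open>\<pi>\<close> because \<open>B\<close> has no root there. If
  also \<open>h\<close> has divisor \<open>k (P - W)\<close> with \<open>0 < k < n\<close>, then the \<open>n\<close>-th power of \<open>h / (h \<circ> \<iota>)\<close> equals
  the \<open>k\<close>-th power of that function. So \<open>h / (h \<circ> \<iota>)\<close> turns by the angle \<open>-2 \<pi> k / n\<close> along the
  band, while it equals \<open>1\<close> at both ends, which is absurd (\<open>no_smaller_torsion\<close>).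
\<close>

section \<open>Polynomials in Laurent series\<close>

lemma fls_eval_poly_0 [simp]: "fls_eval_poly 0 X = 0"
  by (simp add: fls_eval_poly_def)

lemma fls_eval_poly_pCons [simp]:
  "fls_eval_poly (pCons a p) X = fls_const a + X * fls_eval_poly p X"
  by (simp add: fls_eval_poly_def map_poly_pCons)

lemma fls_eval_poly_1 [simp]: "fls_eval_poly 1 X = 1"
  by (simp add: fls_eval_poly_def)

lemma fls_eval_poly_add [simp]: "fls_eval_poly (p + q) X = fls_eval_poly p X + fls_eval_poly q X"
  by (induction p q rule: poly_induct2) (simp_all add: fls_plus_const [symmetric] algebra_simps)

lemma fls_eval_poly_smult [simp]: "fls_eval_poly (Polynomial.smult c p) X = fls_const c * fls_eval_poly p X"
  by (induction p) (simp_all add: fls_const_mult_const [symmetric] algebra_simps del: fls_const_mult_const)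

lemma fls_eval_poly_minus [simp]: "fls_eval_poly (- p) X = - fls_eval_poly p X"
  by (induction p) (simp_all add: algebra_simps)

lemma fls_eval_poly_diff [simp]: "fls_eval_poly (p - q) X = fls_eval_poly p X - fls_eval_poly q X"
  using fls_eval_poly_add [of p "- q" X] by simp

lemma fls_eval_poly_mult [simp]: "fls_eval_poly (p * q) X = fls_eval_poly p X * fls_eval_poly q X"
  by (induction p) (simp_all add: algebra_simps)

lemma fls_eval_poly_power [simp]: "fls_eval_poly (p ^ k) X = fls_eval_poly p X ^ k"
  by (induction k) simp_all

lemma fls_eval_poly_const [simp]: "fls_eval_poly p (fls_const x) = fls_const (poly p x)"
  by (induction p) (simp_all add: fls_plus_const)

text \<open>
  The pullback of a function that is regular at the point and takes the value \<open>a\<close> there.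
\<close>

definition specializes :: "complex fls \<Rightarrow> complex \<Rightarrow> bool" where
  "specializes F a \<longleftrightarrow> (\<exists>f. F = fps_to_fls f \<and> fps_nth f 0 = a)"

lemma specializes_iff: "specializes F a \<longleftrightarrow> fls_subdegree F \<ge> 0 \<and> fls_nth F 0 = a"
proof
  assume "fls_subdegree F \<ge> 0 \<and> fls_nth F 0 = a"
  moreover from this have "F = fps_to_fls (fls_regpart F)"
    by (intro fls_eqI) auto
  ultimately show "specializes F a"
    unfolding specializes_def by (metis fls_regpart_nth of_nat_0)
qed (auto simp: specializes_def fls_subdegree_fls_to_fps_gt0)

lemma specializes_unique: "specializes F a \<Longrightarrow> specializes F b \<Longrightarrow> a = b"
  by (simp add: specializes_iff)

lemma specializes_const [intro]: "specializes (fls_const a) a"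
  by (simp add: specializes_iff)

lemma specializes_add [intro]:
  "specializes F a \<Longrightarrow> specializes G b \<Longrightarrow> specializes (F + G) (a + b)"
  unfolding specializes_def by (metis fps_to_fls_plus fps_add_nth)

lemma specializes_diff [intro]:
  "specializes F a \<Longrightarrow> specializes G b \<Longrightarrow> specializes (F - G) (a - b)"
  unfolding specializes_def by (metis fps_to_fls_minus fps_sub_nth)

lemma specializes_mult [intro]:
  "specializes F a \<Longrightarrow> specializes G b \<Longrightarrow> specializes (F * G) (a * b)"
  unfolding specializes_def by (metis fls_times_fps_to_fls fps_mult_nth_0)

lemma specializes_power [intro]: "specializes F a \<Longrightarrow> specializes (F ^ k) (a ^ k)"
  unfolding specializes_def by (metis fps_to_fls_power fps_power_zeroth)

lemma specializes_eval_poly [intro]: "specializes X a \<Longrightarrow> specializes (fls_eval_poly p X) (poly p a)"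
proof (induction p)
  case 0
  then show ?case using specializes_const [of 0] by simp
qed (auto intro!: specializes_add specializes_mult)

lemma specializes_nonzero:
  assumes "specializes F a" "a \<noteq> 0"
  shows "F \<noteq> 0" "fls_subdegree F = 0"
proof -
  from assms show "F \<noteq> 0" by (auto simp: specializes_iff)
  from assms show "fls_subdegree F = 0"
    by (metis fls_subdegree_leI order_antisym specializes_iff)
qed

lemma specializes_0_subdegree:
  assumes "specializes F 0" "F \<noteq> 0"
  shows "fls_subdegree F \<ge> 1"
proof -
  from assms have "fls_subdegree F \<noteq> 0"
    by (metis nth_fls_subdegree_nonzero specializes_iff)
  with assms show ?thesis by (simp add: specializes_iff)
qed

lemma subdegree_eval_poly:
  assumes X: "specializes X a" and nz: "X - fls_const a \<noteq> 0" and A: "A \<noteq> 0"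
  shows "fls_eval_poly A X \<noteq> 0"
    and "fls_subdegree (fls_eval_poly A X) = int (Polynomial.order a A) * fls_subdegree (X - fls_const a)"
proof -
  obtain q where q: "A = [:-a, 1:] ^ Polynomial.order a A * q" "\<not> [:-a, 1:] dvd q"
    using order_decomp [OF A] by blast
  have "poly q a \<noteq> 0" using q(2) by (simp add: poly_eq_0_iff_dvd)
  note Q = specializes_nonzero [OF specializes_eval_poly [OF X] this]
  have e: "fls_eval_poly A X = (X - fls_const a) ^ Polynomial.order a A * fls_eval_poly q X"
    by (subst q(1)) (simp add: algebra_simps)
  show "fls_eval_poly A X \<noteq> 0" unfolding e using nz Q by simp
  show "fls_subdegree (fls_eval_poly A X) = int (Polynomial.order a A) * fls_subdegree (X - fls_const a)"
    unfolding e using nz Q by (simp add: fls_subdegree_pow)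
qed

lemma immersed_arc_specializes:
  assumes "immersed_arc_at a b U V"
  shows "specializes U a" "specializes V b"
  using assms by (auto simp: immersed_arc_at_def specializes_iff)

text \<open>
  Where \<open>b \<noteq> 0\<close>, the equation \<open>(V - b) (V + b) = E(U) - E(a)\<close> has the unit \<open>V + b\<close> on its left
  and the factor \<open>U - a\<close> on its right. If \<open>U - a\<close> had order at least 2, so would \<open>V - b\<close>, and the arc
  would not be immersed.
\<close>

lemma unramified_arc:
  assumes arc: "immersed_arc_at a b U V" and eq: "V ^ 2 = fls_eval_poly E U" and b: "b \<noteq> 0"
  shows "U - fls_const a \<noteq> 0" "fls_subdegree (U - fls_const a) = 1"
proof -
  note sp = immersed_arc_specializes [OF arc]
  have Ea: "b ^ 2 = poly E a"
    using specializes_unique specializes_power [OF sp(2), of 2] specializes_eval_poly [OF sp(1)] eq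
    by metis
  define Q where "Q = synthetic_div E a"
  have E: "E = [:-a, 1:] * Q + [:poly E a:]"
    unfolding Q_def by (rule synthetic_div_correct' [symmetric])
  have "fls_eval_poly E U = (U - fls_const a) * fls_eval_poly Q U + fls_const (b ^ 2)"
    by (subst E) (simp add: Ea algebra_simps)
  then have fac: "(V - fls_const b) * (V + fls_const b) = (U - fls_const a) * fls_eval_poly Q U"
    using eq by (simp add: fls_const_power power2_eq_square algebra_simps)
  have "specializes (V + fls_const b) (b + b)" by (intro specializes_add sp specializes_const)
  moreover have "b + b \<noteq> 0" using b by simp
  ultimately have Vb: "V + fls_const b \<noteq> 0" "fls_subdegree (V + fls_const b) = 0"
    using specializes_nonzero by blast+
  have U1: "fls_nth U 1 \<noteq> 0"
  proof
    assume U1: "fls_nth U 1 = 0"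
    have V1: "fls_nth V 1 \<noteq> 0" using arc U1 by (simp add: immersed_arc_at_def)
    have sdV: "fls_subdegree (V - fls_const b) = 1"
      by (rule fls_subdegree_eqI) (use V1 sp(2) in \<open>auto simp: specializes_iff\<close>)
    then have nz: "(V - fls_const b) * (V + fls_const b) \<noteq> 0" using Vb by auto
    then have nz': "U - fls_const a \<noteq> 0" "fls_eval_poly Q U \<noteq> 0" unfolding fac by auto
    have "fls_subdegree (U - fls_const a) \<ge> 2"
    proof (rule fls_subdegree_geI [OF nz'(1)])
      fix k :: int assume "k < 2"
      then consider "k < 0" | "k = 0" | "k = 1" by linarith
      then show "fls_nth (U - fls_const a) k = 0"
        by cases (use U1 sp(1) in \<open>auto simp: specializes_iff\<close>)
    qed
    moreover have "fls_subdegree (fls_eval_poly Q U) \<ge> 0"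
      using specializes_eval_poly [OF sp(1)] specializes_iff by blast
    moreover have "fls_subdegree (U - fls_const a) + fls_subdegree (fls_eval_poly Q U) = 1 + 0"
      using arg_cong [OF fac, of fls_subdegree] nz nz' sdV Vb by (simp add: fls_subdegree_mult)
    ultimately show False by linarith
  qed
  show sd: "fls_subdegree (U - fls_const a) = 1"
    by (rule fls_subdegree_eqI) (use U1 sp(1) in \<open>auto simp: specializes_iff\<close>)
  then show "U - fls_const a \<noteq> 0" by auto
qed

text \<open>
  Over a simple root of \<open>E\<close> the equation reads \<open>Y\<^sup>2 = (X - e) \<sqdot> unit\<close>, so the order of \<open>X - e\<close> is twice
  that of \<open>Y\<close>, and the immersion condition makes the latter 1.
\<close>

lemma ramified_arc:
  assumes arc: "immersed_arc_at e 0 X Y" and eq: "Y ^ 2 = fls_eval_poly E X"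
    and E: "E = [:-e, 1:] * E1" "poly E1 e \<noteq> 0"
  shows "X - fls_const e \<noteq> 0" "fls_subdegree (X - fls_const e) = 2"
    and "Y \<noteq> 0" "fls_subdegree Y = 1"
proof -
  note sp = immersed_arc_specializes [OF arc]
  note Q = specializes_nonzero [OF specializes_eval_poly [OF sp(1)] E(2)]
  have fac: "Y ^ 2 = (X - fls_const e) * fls_eval_poly E1 X"
    unfolding eq by (subst E(1)) (simp add: algebra_simps)
  have nz: "Y \<noteq> 0"
  proof
    assume "Y = 0"
    with fac Q have "X = fls_const e" by simp
    with \<open>Y = 0\<close> arc show False by (simp add: immersed_arc_at_def)
  qed
  show nzX: "X - fls_const e \<noteq> 0"
  proof
    assume "X - fls_const e = 0"
    with fac nz show False by auto
  qed
  have sd: "2 * fls_subdegree Y = fls_subdegree (X - fls_const e)"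
    using arg_cong [OF fac, of fls_subdegree] nzX Q by (simp add: fls_subdegree_pow)
  have ge: "fls_subdegree Y \<ge> 1" using specializes_0_subdegree sp nz by blast
  have "fls_subdegree Y \<le> 1"
  proof (rule ccontr)
    assume "\<not> fls_subdegree Y \<le> 1"
    then have "fls_nth Y 1 = 0" "fls_nth (X - fls_const e) 1 = 0"
      using sd by (intro fls_eq0_below_subdegree; linarith)+
    with arc show False by (simp add: immersed_arc_at_def)
  qed
  with ge show "fls_subdegree Y = 1" by linarith
  with sd show "fls_subdegree (X - fls_const e) = 2" by linarith
  show "Y \<noteq> 0" by (fact nz)
qed

text \<open>
  The behaviour of a polynomial at a point at infinity. The exponent \<open>d\<close> may exceed the degree, so that
  the terms of a sum \<open>A(X) + B(X) Y\<close> can be brought to a common power of \<open>X\<close>.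
\<close>

lemma eval_poly_leading:
  assumes "specializes (inverse X) 0" "X \<noteq> 0" "Polynomial.degree A \<le> d"
  obtains F where "fls_eval_poly A X = X ^ d * F" "specializes F (coeff A d)"
proof -
  have "\<exists>F. fls_eval_poly A X = X ^ d * F \<and> specializes F (coeff A d)"
    using assms(3)
  proof (induction A arbitrary: d)
    case 0
    then show ?case using specializes_const [of 0] by (intro exI [of _ 0]) auto
  next
    case (pCons a p)
    show ?case
    proof (cases d)
      case 0
      then have "p = 0" using pCons.prems by (cases "p = 0") auto
      then show ?thesis using 0 by (intro exI [of _ "fls_const a"]) auto
    next
      case (Suc d')
      then have "Polynomial.degree p \<le> d'" using pCons.prems by (cases "p = 0") auto
      then obtain F where F: "fls_eval_poly p X = X ^ d' * F" "specializes F (coeff p d')"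
        using pCons.IH by blast
      have "specializes (fls_const a * inverse X ^ d + F) (a * 0 ^ d + coeff p d')"
        using assms(1) F(2) by blast
      moreover have "X ^ d * inverse X ^ d = 1" using assms(2) by (simp add: power_mult_distrib [symmetric])
      then have "fls_eval_poly (pCons a p) X = X ^ d * (fls_const a * inverse X ^ d + F)"
        using F(1) Suc by (simp add: algebra_simps)
      ultimately show ?thesis using Suc by (intro exI) auto
    qed
  qed
  then show thesis using that by blast
qed

section \<open>Local parametrizations and orders\<close>

lemma specializes_fps_to_fls: "fps_nth u 0 = a \<Longrightarrow> specializes (fps_to_fls u) a"
  by (auto simp: specializes_def)

lemma eval_reflect_poly:
  assumes X: "X \<noteq> 0"
  shows "fls_eval_poly p X = X ^ Polynomial.degree p * fls_eval_poly (reflect_poly p) (inverse X)"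
proof (induction p)
  case (pCons a p)
  have ev: "fls_eval_poly (Polynomial.monom a k) Z = fls_const a * Z ^ k" for k Z
    by (induction k) (simp_all add: monom_Suc monom_0 mult_ac)
  have 1: "X ^ k * inverse X ^ k = 1" for k
    using X by (simp add: power_mult_distrib [symmetric])
  show ?case
  proof (cases "p = 0")
    case False
    let ?n = "Polynomial.degree p"
    have "X ^ Suc ?n * (fls_const a * inverse X ^ Suc ?n) = fls_const a"
      using 1 [of "Suc ?n"] by (metis mult.left_commute mult.right_neutral)
    moreover have "reflect_poly (pCons a p) = reflect_poly p + Polynomial.monom a (Suc ?n)"
      using False by (simp add: reflect_poly_pCons')
    ultimately show ?thesis
      using False pCons.IH by (simp add: ev distrib_left mult.assoc del: power_Suc) (simp add: algebra_simps)
  qed simp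
qed simp

locale hyperelliptic =
  fixes g :: nat and D :: "complex poly"
  assumes degree_D: "Polynomial.degree D = 2 * g + 2" and rsquarefree_D: "rsquarefree D"
begin

lemma D_nonzero: "D \<noteq> 0"
  using degree_D by auto

lemma lead_coeff_D: "lead_coeff D \<noteq> 0"
  using D_nonzero by simp

lemma order_D_root: "poly D e = 0 \<Longrightarrow> Polynomial.order e D = 1"
  using rsquarefree_D D_nonzero by (auto simp: rsquarefree_def order_root) (metis less_numeral_extra(3))

lemma D_root_factor:
  assumes "poly D e = 0"
  obtains D1 where "D = [:-e, 1:] * D1" "poly D1 e \<noteq> 0"
proof -
  obtain q where "D = [:-e, 1:] ^ 1 * q" "\<not> [:-e, 1:] dvd q"
    using order_decomp [OF D_nonzero, of e] order_D_root [OF assms] by metis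
  then show thesis using that [of q] by (simp add: poly_eq_0_iff_dvd)
qed

text \<open>
  At a root of \<open>D\<close> the order of \<open>A\<^sup>2\<close> is even and that of \<open>D B\<^sup>2\<close> is odd.
\<close>

lemma norm_nonzero:
  assumes "A \<noteq> 0 \<or> B \<noteq> 0"
  shows "A ^ 2 - D * B ^ 2 \<noteq> 0"
proof
  assume eq: "A ^ 2 - D * B ^ 2 = 0"
  then have e: "A ^ 2 = D * B ^ 2" by simp
  have nz: "A \<noteq> 0" "B \<noteq> 0" using e assms D_nonzero by auto
  obtain r where r: "poly D r = 0"
    using fundamental_theorem_of_algebra [of D] degree_D by (auto simp: constant_degree)
  have "Polynomial.order r (A ^ 2) = Polynomial.order r A + Polynomial.order r A"
    using nz by (simp add: power2_eq_square order_mult)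
  moreover have "Polynomial.order r (D * B ^ 2) = 1 + (Polynomial.order r B + Polynomial.order r B)"
    using nz D_nonzero order_D_root [OF r] by (simp add: power2_eq_square order_mult)
  ultimately show False using arg_cong [OF e, of "Polynomial.order r"] by presburger
qed

text \<open>
  The statements about orders below hold for every parametrization of a point. The one picked by
  \<^const>\<open>order_at\<close> is thus never compared with another one, and no change of the local
  parameter enters the argument.
\<close>

lemma at_affine:
  assumes "local_parametrization D (Affine a b) X Y"
  shows "Y ^ 2 = fls_eval_poly D X" "specializes X a" "specializes Y b"
  using assms immersed_arc_specializes by (auto simp: local_parametrization_def)

lemma at_ordinary:
  assumes "local_parametrization D (Affine a b) X Y" "b \<noteq> 0"
  shows "X - fls_const a \<noteq> 0" "fls_subdegree (X - fls_const a) = 1"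
  using assms unramified_arc [of a b X Y D] by (simp_all add: local_parametrization_def)

lemma at_weierstrass:
  assumes "local_parametrization D (Affine e 0) X Y" "poly D e = 0"
  shows "X - fls_const e \<noteq> 0" "fls_subdegree (X - fls_const e) = 2" "Y \<noteq> 0" "fls_subdegree Y = 1"
proof -
  obtain D1 where "D = [:-e, 1:] * D1" "poly D1 e \<noteq> 0" using D_root_factor [OF assms(2)] by blast
  moreover have "immersed_arc_at e 0 X Y" "Y ^ 2 = fls_eval_poly D X"
    using assms(1) by (auto simp: local_parametrization_def)
  ultimately
  show "X - fls_const e \<noteq> 0" "fls_subdegree (X - fls_const e) = 2" "Y \<noteq> 0" "fls_subdegree Y = 1"
    using ramified_arc by blast+
qed

lemma affine_nonconstant:
  assumes "local_parametrization D (Affine a b) X Y" "b ^ 2 = poly D a"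
  shows "X - fls_const a \<noteq> 0"
  using at_ordinary(1) at_weierstrass(1) assms by (cases "b = 0") auto

text \<open>
  In the coordinates \<open>u = 1/x\<close>, \<open>v = y/x\<^bsup>g+1\<^esup>\<close> a point at infinity is an ordinary point of
  \<open>v\<^sup>2 = D\<^sup>*(u)\<close>, where \<open>D\<^sup>*\<close> is the reversed polynomial.
\<close>

lemma at_infinity:
  assumes par: "local_parametrization D (Infinite c) X Y" and c: "c ^ 2 = lead_coeff D"
  shows "Y ^ 2 = fls_eval_poly D X" "X \<noteq> 0" "fls_subdegree X = -1"
    and "specializes (inverse X) 0" "specializes (Y / X ^ (g + 1)) c" "c \<noteq> 0"
proof -
  let ?U = "inverse X" and ?V = "Y / X ^ (g + 1)"
  have h: "Polynomial.degree D div 2 = g + 1" using degree_D by simp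
  have arc: "immersed_arc_at 0 c ?U ?V" and eq: "Y ^ 2 = fls_eval_poly D X"
    using par by (auto simp: local_parametrization_def h)
  show "Y ^ 2 = fls_eval_poly D X" by (rule eq)
  show c0: "c \<noteq> 0" using c lead_coeff_D by auto
  show U: "specializes ?U 0" and V: "specializes ?V c"
    using immersed_arc_specializes [OF arc] by auto
  show X: "X \<noteq> 0"
  proof
    assume "X = 0"
    then have "?V = 0" by simp
    then have "specializes 0 c" using V by (simp only:)
    then show False using c0 by (simp add: specializes_iff)
  qed
  have "fls_eval_poly D X = X ^ (2 * (g + 1)) * fls_eval_poly (reflect_poly D) ?U"
    using eval_reflect_poly [OF X, of D] by (simp add: degree_D)
  then have "Y ^ 2 = (X ^ (g + 1)) ^ 2 * fls_eval_poly (reflect_poly D) ?U"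
    unfolding eq by (simp only: power_mult [symmetric] mult.commute)
  then have "?V ^ 2 = fls_eval_poly (reflect_poly D) ?U"
    using X by (simp add: power_divide)
  from unramified_arc(2) [OF arc this c0] have "fls_subdegree ?U = 1" by simp
  then show "fls_subdegree X = -1" by simp
qed

lemma leading_at_infinity:
  assumes par: "local_parametrization D (Infinite c) X Y" and c: "c ^ 2 = lead_coeff D"
    and dA: "Polynomial.degree A \<le> d + g + 1" and dB: "Polynomial.degree B \<le> d"
  obtains F where "fls_eval_poly A X + fls_eval_poly B X * Y = X ^ (d + g + 1) * F"
    "specializes F (coeff A (d + g + 1) + coeff B d * c)"
proof -
  note inf = at_infinity [OF par c]
  obtain F1 where F1: "fls_eval_poly A X = X ^ (d + g + 1) * F1" "specializes F1 (coeff A (d + g + 1))"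
    using eval_poly_leading [OF inf(4,2) dA] by blast
  obtain F2 where F2: "fls_eval_poly B X = X ^ d * F2" "specializes F2 (coeff B d)"
    using eval_poly_leading [OF inf(4,2) dB] by blast
  obtain V where V: "Y = X ^ (g + 1) * V" "specializes V c"
    using inf(2,5) by (metis nonzero_mult_div_cancel_left power_not_zero times_divide_eq_right)
  have "fls_eval_poly A X + fls_eval_poly B X * Y = X ^ (d + g + 1) * (F1 + F2 * V)"
    unfolding F1(1) F2(1) V(1) by (simp add: power_add algebra_simps)
  moreover have "specializes (F1 + F2 * V) (coeff A (d + g + 1) + coeff B d * c)"
    by (intro specializes_add specializes_mult F1(2) F2(2) V(2))
  ultimately show thesis using that by blast
qed

lemma subdegree_poly_at_infinity:
  assumes par: "local_parametrization D (Infinite c) X Y" and c: "c ^ 2 = lead_coeff D" and A: "A \<noteq> 0"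
  shows "fls_eval_poly A X \<noteq> 0" "fls_subdegree (fls_eval_poly A X) = - int (Polynomial.degree A)"
proof -
  note inf = at_infinity [OF par c]
  obtain F where F: "fls_eval_poly A X = X ^ Polynomial.degree A * F" "specializes F (lead_coeff A)"
    using eval_poly_leading [OF inf(4,2) order_refl] by blast
  have "F \<noteq> 0" "fls_subdegree F = 0" using specializes_nonzero [OF F(2)] A by auto
  with inf F(1)
  show "fls_eval_poly A X \<noteq> 0" "fls_subdegree (fls_eval_poly A X) = - int (Polynomial.degree A)"
    by (auto simp: fls_subdegree_pow)
qed

lemma eval_poly_nonzero:
  assumes "local_parametrization D P X Y" "P \<in> curve_points D" "A \<noteq> 0"
  shows "fls_eval_poly A X \<noteq> 0"
proof (cases P)
  case (Affine a b)
  with assms have "X - fls_const a \<noteq> 0" "specializes X a"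
    using affine_nonconstant at_affine by (auto simp: curve_points_def)
  then show ?thesis using subdegree_eval_poly assms(3) by blast
next
  case (Infinite c)
  then show ?thesis using subdegree_poly_at_infinity assms by (auto simp: curve_points_def)
qed

lemma param_equation: "local_parametrization D P X Y \<Longrightarrow> Y ^ 2 = fls_eval_poly D X"
  by (simp add: local_parametrization_def)

lemma eval_conjugate_product:
  assumes "Y ^ 2 = fls_eval_poly D X"
  shows "(fls_eval_poly A X + fls_eval_poly B X * Y) * (fls_eval_poly A X - fls_eval_poly B X * Y)
    = fls_eval_poly (A ^ 2 - D * B ^ 2) X"
  using assms [symmetric] by (simp add: power2_eq_square algebra_simps)

lemma eval_function_nonzero:
  assumes "local_parametrization D P X Y" "P \<in> curve_points D" "A \<noteq> 0 \<or> B \<noteq> 0"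
  shows "fls_eval_poly A X + fls_eval_poly B X * Y \<noteq> 0"
  using eval_conjugate_product [OF param_equation [OF assms(1)], of A B]
    eval_poly_nonzero [OF assms(1,2) norm_nonzero [OF assms(3)]] by auto

end

text \<open>
  The first argument of \<^const>\<open>fps_radical\<close> is the root function for constant terms; a constant function
  in its place selects the branch with the prescribed value.
\<close>

lemma fps_sqrt_exists:
  fixes F :: "complex fps"
  assumes "fps_nth F 0 = b ^ 2" "b \<noteq> 0"
  obtains G where "G ^ 2 = F" "fps_nth G 0 = b"
proof -
  define r where "r = (\<lambda>(k::nat) (x::complex). b)"
  let ?G = "fps_radical r 2 F"
  have "r (Suc 1) (fps_nth F 0) ^ Suc 1 = fps_nth F 0" using assms by (simp add: r_def power2_eq_square)
  then have "?G ^ Suc 1 = F" using power_radical [of F r 1] assms by (simp add: numeral_2_eq_2)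
  moreover have "fps_nth ?G 0 = b" by (simp add: r_def numeral_2_eq_2)
  ultimately show thesis using that [of ?G] by (simp add: numeral_2_eq_2)
qed

lemma immersed_arcI:
  "immersed_arc_at a b (fps_to_fls u) (fps_to_fls v)"
  if "fps_nth u 0 = a" "fps_nth v 0 = b" "fps_nth u 1 \<noteq> 0 \<or> fps_nth v 1 \<noteq> 0"
  using that by (auto simp: immersed_arc_at_def fls_subdegree_fls_to_fps_gt0)

lemma specializes_fps:
  assumes "specializes F a" obtains f where "F = fps_to_fls f" "fps_nth f 0 = a"
  using assms by (auto simp: specializes_def)

lemma fps_fls_power_eq: "f ^ k = F \<Longrightarrow> fps_to_fls f ^ k = fps_to_fls F"
  by (auto simp: fps_to_fls_power)

context hyperelliptic begin

text \<open>
  Explicit parametrizations: \<open>x = a + t\<close> at ordinary points, \<open>x = e + t\<^sup>2\<close> at Weierstrass points,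
  and \<open>x = 1/t\<close> at infinity. In each case the other coordinate is a square root of a power series with
  nonzero constant term, up to a power of \<open>t\<close>.
\<close>

lemma param_exists:
  assumes "P \<in> curve_points D"
  shows "\<exists>X Y. local_parametrization D P X Y"
proof (cases P)
  case (Affine a b)
  then have ab: "b ^ 2 = poly D a" using assms by (auto simp: curve_points_def)
  show ?thesis
  proof (cases "b = 0")
    case False
    define u where "u = fps_const a + fps_X"
    have "specializes (fps_to_fls u) a" by (rule specializes_fps_to_fls) (simp add: u_def)
    from specializes_eval_poly [OF this, of D]
    obtain F where F: "fls_eval_poly D (fps_to_fls u) = fps_to_fls F" "fps_nth F 0 = b ^ 2"
      using ab by (metis specializes_def)
    obtain v where v: "v ^ 2 = F" "fps_nth v 0 = b" using fps_sqrt_exists [OF F(2) False] by blast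
    have "local_parametrization D P (fps_to_fls u) (fps_to_fls v)"
      unfolding local_parametrization_def Affine using F(1) v immersed_arcI [of u a v b]
      by (simp add: fps_fls_power_eq u_def)
    then show ?thesis by blast
  next
    case True
    then have a: "poly D a = 0" using ab by simp
    then obtain D1 where D1: "D = [:-a, 1:] * D1" "poly D1 a \<noteq> 0" using D_root_factor by blast
    define u where "u = fps_const a + fps_X ^ 2"
    have "specializes (fps_to_fls u) a" by (rule specializes_fps_to_fls) (simp add: u_def)
    from specializes_eval_poly [OF this, of D1]
    obtain F where F: "fls_eval_poly D1 (fps_to_fls u) = fps_to_fls F" "fps_nth F 0 = (csqrt (poly D1 a)) ^ 2"
      by (metis specializes_def power2_csqrt)
    obtain w where w: "w ^ 2 = F" "fps_nth w 0 = csqrt (poly D1 a)"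
      using fps_sqrt_exists [OF F(2)] D1(2) by auto
    define v where "v = fps_X * w"
    have "fps_to_fls v ^ 2 = fps_to_fls (fps_X ^ 2) * fps_to_fls F"
      unfolding v_def using fps_fls_power_eq [OF w(1)]
      by (simp add: fls_times_fps_to_fls power_mult_distrib fps_to_fls_power)
    also have "fps_to_fls (fps_X ^ 2) = fps_to_fls u - fls_const a"
      by (simp add: u_def fls_plus_const [symmetric])
    also have "\<dots> * fps_to_fls F = fls_eval_poly D (fps_to_fls u)"
      by (subst D1(1)) (simp add: F(1) algebra_simps)
    finally have "fps_to_fls v ^ 2 = fls_eval_poly D (fps_to_fls u)" .
    moreover have "immersed_arc_at a b (fps_to_fls u) (fps_to_fls v)"
      by (rule immersed_arcI) (use True w(2) D1(2) in \<open>auto simp: u_def v_def\<close>)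
    ultimately have "local_parametrization D P (fps_to_fls u) (fps_to_fls v)"
      unfolding local_parametrization_def Affine by simp
    then show ?thesis by blast
  qed
next
  case (Infinite c)
  then have c: "c ^ 2 = lead_coeff D" using assms by (auto simp: curve_points_def)
  then have c0: "c \<noteq> 0" using lead_coeff_D by auto
  let ?X = "inverse (fls_X :: complex fls)"
  have X0: "?X \<noteq> 0" by simp
  have "specializes (inverse ?X) 0" by (simp add: specializes_iff)
  from eval_poly_leading [OF this X0 order_refl, of D]
  obtain F where F: "fls_eval_poly D ?X = ?X ^ Polynomial.degree D * F" "specializes F (lead_coeff D)"
    by blast
  obtain f where f: "F = fps_to_fls f" "fps_nth f 0 = c ^ 2" using specializes_fps [OF F(2)] c by metis
  obtain v where v: "v ^ 2 = f" "fps_nth v 0 = c" using fps_sqrt_exists [OF f(2) c0] by blast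
  define Y where "Y = ?X ^ (g + 1) * fps_to_fls v"
  have "(?X ^ (g + 1)) ^ 2 = ?X ^ (2 * g + 2)"
    unfolding power2_eq_square power_add [symmetric] by (rule arg_cong [where f = "(^) ?X"]) simp
  then have "Y ^ 2 = fls_eval_poly D ?X"
    unfolding F(1) f(1) Y_def degree_D power_mult_distrib using fps_fls_power_eq [OF v(1)] by simp
  moreover have "Y / ?X ^ (g + 1) = fps_to_fls v" unfolding Y_def by simp
  then have "immersed_arc_at 0 c (inverse ?X) (Y / ?X ^ (Polynomial.degree D div 2))"
    using immersed_arcI [of fps_X 0 v c] v(2) degree_D by simp
  ultimately have "local_parametrization D P ?X Y"
    unfolding local_parametrization_def Infinite by simp
  then show ?thesis by blast
qed

lemma order_at_param:
  assumes "P \<in> curve_points D"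
  obtains X Y where "local_parametrization D P X Y"
    "\<And>f. order_at D P f = fls_subdegree (function_pullback f X Y)"
proof -
  let ?p = "SOME (X, Y). local_parametrization D P X Y"
  have "\<exists>p. case p of (X, Y) \<Rightarrow> local_parametrization D P X Y" using param_exists [OF assms] by auto
  from someI_ex [OF this] have "case ?p of (X, Y) \<Rightarrow> local_parametrization D P X Y" .
  then show thesis using that [of "fst ?p" "snd ?p"]
    by (auto simp: order_at_def Let_def case_prod_unfold)
qed

end

section \<open>The function field\<close>

context hyperelliptic begin

definition fun_mult :: "complex poly \<times> complex poly \<times> complex poly \<Rightarrow>
    complex poly \<times> complex poly \<times> complex poly \<Rightarrow> complex poly \<times> complex poly \<times> complex poly" where
  "fun_mult f h = (case (f, h) of ((A, B, H), (A', B', H')) \<Rightarrow>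
     (A * A' + D * B * B', A * B' + A' * B, H * H'))"

definition fun_inverse :: "complex poly \<times> complex poly \<times> complex poly \<Rightarrow>
    complex poly \<times> complex poly \<times> complex poly" where
  "fun_inverse f = (case f of (A, B, H) \<Rightarrow> (H * A, - (H * B), A ^ 2 - D * B ^ 2))"

primrec fun_power :: "complex poly \<times> complex poly \<times> complex poly \<Rightarrow> nat \<Rightarrow>
    complex poly \<times> complex poly \<times> complex poly" where
  "fun_power f 0 = (1, 0, 1)"
| "fun_power f (Suc k) = fun_mult f (fun_power f k)"

lemma fun_mult_nonzero:
  assumes "f \<in> nonzero_functions" "h \<in> nonzero_functions"
  shows "fun_mult f h \<in> nonzero_functions"
proof -
  obtain A B H A' B' H' where f: "f = (A, B, H)" and h: "h = (A', B', H')" by (metis prod_cases3)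
  have "(A * A' + D * B * B') ^ 2 - D * (A * B' + A' * B) ^ 2
      = (A ^ 2 - D * B ^ 2) * (A' ^ 2 - D * B' ^ 2)"
    by (simp add: power2_eq_square algebra_simps)
  also have "\<dots> \<noteq> 0" using assms norm_nonzero unfolding f h nonzero_functions_def by simp
  finally show ?thesis using assms unfolding f h nonzero_functions_def fun_mult_def by auto
qed

lemma fun_inverse_nonzero:
  assumes "f \<in> nonzero_functions"
  shows "fun_inverse f \<in> nonzero_functions"
  using assms norm_nonzero by (auto simp: nonzero_functions_def fun_inverse_def split: prod.splits)

lemma fun_power_nonzero: "f \<in> nonzero_functions \<Longrightarrow> fun_power f k \<in> nonzero_functions"
  by (induction k) (auto intro: fun_mult_nonzero, simp add: nonzero_functions_def)

lemma pullback_mult: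
  assumes "Y ^ 2 = fls_eval_poly D X"
  shows "function_pullback (fun_mult f h) X Y = function_pullback f X Y * function_pullback h X Y"
proof -
  obtain A B H A' B' H' where f: "f = (A, B, H)" and h: "h = (A', B', H')" by (metis prod_cases3)
  have "fls_eval_poly (A * A' + D * B * B') X + fls_eval_poly (A * B' + A' * B) X * Y
      = (fls_eval_poly A X + fls_eval_poly B X * Y) * (fls_eval_poly A' X + fls_eval_poly B' X * Y)"
    by (simp add: assms [symmetric] power2_eq_square algebra_simps)
  then show ?thesis
    unfolding f h fun_mult_def function_pullback_def by simp
qed

lemma pullback_inverse:
  assumes eq: "Y ^ 2 = fls_eval_poly D X" and nz: "fls_eval_poly (A ^ 2 - D * B ^ 2) X \<noteq> 0"
  shows "function_pullback (fun_inverse (A, B, H)) X Y = inverse (function_pullback (A, B, H) X Y)"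
proof -
  let ?p = "fls_eval_poly A X + fls_eval_poly B X * Y" and ?m = "fls_eval_poly A X - fls_eval_poly B X * Y"
  note N = eval_conjugate_product [OF eq, of A B]
  have "?m \<noteq> 0" using nz N by (metis mult_zero_right)
  then have "(fls_eval_poly H X * ?m) / (?p * ?m) = inverse (?p / fls_eval_poly H X)" by simp
  moreover have "fls_eval_poly (H * A) X + fls_eval_poly (- (H * B)) X * Y = fls_eval_poly H X * ?m"
    by (simp add: algebra_simps)
  ultimately show ?thesis
    unfolding fun_inverse_def function_pullback_def N by simp
qed

lemma pullback_power:
  assumes "Y ^ 2 = fls_eval_poly D X"
  shows "function_pullback (fun_power f k) X Y = function_pullback f X Y ^ k"
proof (induction k)
  case 0
  show ?case by (simp add: function_pullback_def)
qed (simp add: pullback_mult [OF assms])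

lemma pullback_nonzero:
  assumes "local_parametrization D P X Y" "P \<in> curve_points D" "f \<in> nonzero_functions"
  shows "function_pullback f X Y \<noteq> 0"
proof -
  obtain A B H where f: "f = (A, B, H)" by (metis prod_cases3)
  then show ?thesis
    using assms(3) eval_function_nonzero [OF assms(1,2), of A B] eval_poly_nonzero [OF assms(1,2), of H]
    by (auto simp: function_pullback_def nonzero_functions_def)
qed

lemma order_mult_functions:
  assumes P: "P \<in> curve_points D" and "f \<in> nonzero_functions" "h \<in> nonzero_functions"
  shows "order_at D P (fun_mult f h) = order_at D P f + order_at D P h"
proof -
  obtain X Y where par: "local_parametrization D P X Y"
    and ord: "\<And>f. order_at D P f = fls_subdegree (function_pullback f X Y)"
    using order_at_param [OF P] by blast
  show ?thesis unfolding ord pullback_mult [OF param_equation [OF par]]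
    using pullback_nonzero [OF par P] assms by simp
qed

lemma order_inverse_function:
  assumes P: "P \<in> curve_points D" and f: "f \<in> nonzero_functions"
  shows "order_at D P (fun_inverse f) = - order_at D P f"
proof -
  obtain X Y where par: "local_parametrization D P X Y"
    and ord: "\<And>f. order_at D P f = fls_subdegree (function_pullback f X Y)"
    using order_at_param [OF P] by blast
  obtain A B H where f': "f = (A, B, H)" by (metis prod_cases3)
  have "fls_eval_poly (A ^ 2 - D * B ^ 2) X \<noteq> 0"
    using eval_poly_nonzero [OF par P norm_nonzero] f f' by (auto simp: nonzero_functions_def)
  then show ?thesis unfolding ord f' by (simp add: pullback_inverse [OF param_equation [OF par]])
qed

lemma order_power_function:
  assumes P: "P \<in> curve_points D" and f: "f \<in> nonzero_functions"
  shows "order_at D P (fun_power f k) = int k * order_at D P f"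
proof -
  obtain X Y where par: "local_parametrization D P X Y"
    and ord: "\<And>f. order_at D P f = fls_subdegree (function_pullback f X Y)"
    using order_at_param [OF P] by blast
  show ?thesis unfolding ord pullback_power [OF param_equation [OF par]] by (rule fls_subdegree_pow)
qed

lemma pullback_eq_quotient:
  assumes par: "local_parametrization D P X Y" and P: "P \<in> curve_points D" and f: "(A, B, H) \<in> nonzero_functions"
  shows "fls_subdegree (function_pullback (A, B, H) X Y)
    = fls_subdegree (fls_eval_poly A X + fls_eval_poly B X * Y) - fls_subdegree (fls_eval_poly H X)"
  using f eval_function_nonzero [OF par P, of A B] eval_poly_nonzero [OF par P, of H]
  by (auto simp: nonzero_functions_def function_pullback_def fls_divide_subdegree)

text \<open>
  A common treatment of both points over \<open>a\<close>: the numerator must vanish at \<open>(a, b)\<close> and at \<open>(a, -b)\<close>,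
  so \<open>A(a) \<plusminus> B(a) b = 0\<close>. If \<open>b = 0\<close>, this only gives \<open>A(a) = 0\<close>; but then \<open>H\<close> and \<open>A\<close> have order at
  least 2, whereas \<open>B y\<close> would have order 1 if \<open>B(a) \<noteq> 0\<close>.
\<close>

lemma regular_at_root:
  assumes f: "(A, B, H) \<in> nonzero_functions" and H: "poly H a = 0"
    and reg: "\<And>b. b ^ 2 = poly D a \<Longrightarrow> order_at D (Affine a b) (A, B, H) \<ge> 0"
  shows "poly A a = 0" "poly B a = 0"
proof -
  have H0: "H \<noteq> 0" using f by (simp add: nonzero_functions_def)
  have oH: "Polynomial.order a H \<ge> 1" using H H0 by (metis One_nat_def Suc_leI gr0I order_root)
  have num: "\<exists>X Y. local_parametrization D (Affine a b) X Y \<and>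
      fls_subdegree (fls_eval_poly A X + fls_eval_poly B X * Y) \<ge> fls_subdegree (X - fls_const a)
      \<and> fls_eval_poly A X + fls_eval_poly B X * Y \<noteq> 0" if b: "b ^ 2 = poly D a" for b
  proof -
    have P: "Affine a b \<in> curve_points D" using b by (auto simp: curve_points_def)
    obtain X Y where par: "local_parametrization D (Affine a b) X Y"
      and ord: "\<And>f. order_at D (Affine a b) f = fls_subdegree (function_pullback f X Y)"
      using order_at_param [OF P] by blast
    have nz: "X - fls_const a \<noteq> 0" using affine_nonconstant [OF par b] .
    have "fls_subdegree (X - fls_const a) \<ge> 1"
      by (rule specializes_0_subdegree [OF _ nz])
        (use specializes_diff [OF at_affine(2) [OF par] specializes_const [of a]] in simp)
    then have "fls_subdegree (fls_eval_poly H X) \<ge> fls_subdegree (X - fls_const a)"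
      using subdegree_eval_poly(2) [OF at_affine(2) [OF par] nz H0] oH by simp
    then show ?thesis
      using reg [OF b] par eval_function_nonzero [OF par P, of A B] f
      unfolding ord pullback_eq_quotient [OF par P f] nonzero_functions_def by fastforce
  qed
  have val: "poly A a + poly B a * b = 0" if b: "b ^ 2 = poly D a" for b
  proof (rule ccontr)
    assume nz: "poly A a + poly B a * b \<noteq> 0"
    obtain X Y where XY: "local_parametrization D (Affine a b) X Y"
      "fls_subdegree (fls_eval_poly A X + fls_eval_poly B X * Y) \<ge> fls_subdegree (X - fls_const a)"
      using num [OF b] by blast
    have "specializes (fls_eval_poly A X + fls_eval_poly B X * Y) (poly A a + poly B a * b)"
      using at_affine [OF XY(1)] by blast
    from specializes_nonzero(2) [OF this nz] XY(2) have "fls_subdegree (X - fls_const a) \<le> 0" by simp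
    moreover have "fls_subdegree (X - fls_const a) \<ge> 1"
      by (rule specializes_0_subdegree [OF _ affine_nonconstant [OF XY(1) b]])
        (use specializes_diff [OF at_affine(2) [OF XY(1)] specializes_const [of a]] in simp)
    ultimately show False by simp
  qed
  define b where "b = csqrt (poly D a)"
  have b: "b ^ 2 = poly D a" "(- b) ^ 2 = poly D a" by (simp_all add: b_def)
  have pm: "poly A a + poly B a * b = 0" "poly A a - poly B a * b = 0"
    using val [OF b(1)] val [OF b(2)] by simp_all
  then have A: "2 * poly A a = 0" and Bb: "2 * (poly B a * b) = 0"
    by (simp_all add: algebra_simps)
  show "poly A a = 0" using A by simp
  show "poly B a = 0"
  proof (cases "b = 0")
    case False
    then show ?thesis using Bb by simp
  next
    case True
    then have Da: "poly D a = 0" using b(1) by simp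
    obtain X Y where XY: "local_parametrization D (Affine a 0) X Y"
      and ge: "fls_subdegree (fls_eval_poly A X + fls_eval_poly B X * Y) \<ge> fls_subdegree (X - fls_const a)"
      and nz: "fls_eval_poly A X + fls_eval_poly B X * Y \<noteq> 0"
      using num [of 0] Da by auto
    note w = at_weierstrass [OF XY Da]
    show ?thesis
    proof (rule ccontr)
      assume "poly B a \<noteq> 0"
      note Bn = specializes_nonzero [OF specializes_eval_poly [OF at_affine(2) [OF XY]] this]
      have sdB: "fls_subdegree (fls_eval_poly B X * Y) = 1" using Bn w by simp
      show False
      proof (cases "A = 0")
        case True
        then show False using ge sdB w by simp
      next
        case False
        have "Polynomial.order a A \<ge> 1" using A False by (metis One_nat_def Suc_leI gr0I order_root mult_eq_0_iff zero_neq_numeral)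
        then have "fls_subdegree (fls_eval_poly A X) \<ge> 2"
          using subdegree_eval_poly(2) [OF at_affine(2) [OF XY] w(1) False] w(2) by simp
        then have "fls_subdegree (fls_eval_poly A X + fls_eval_poly B X * Y) = 1"
          using fls_subdegree_add_eq2 [of "fls_eval_poly B X * Y" "fls_eval_poly A X"] Bn w sdB by simp
        then show False using ge w by simp
      qed
    qed
  qed
qed

lemma pullback_cancel:
  assumes "fls_eval_poly Q X \<noteq> 0"
  shows "function_pullback (Q * A, Q * B, Q * H) X Y = function_pullback (A, B, H) X Y"
proof -
  have "fls_eval_poly (Q * A) X + fls_eval_poly (Q * B) X * Y
     = fls_eval_poly Q X * (fls_eval_poly A X + fls_eval_poly B X * Y)" by (simp add: algebra_simps)
  then show ?thesis using assms by (simp add: function_pullback_def)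
qed

lemma order_cancel:
  assumes "P \<in> curve_points D" "Q \<noteq> 0"
  shows "order_at D P (Q * A, Q * B, Q * H) = order_at D P (A, B, H)"
proof -
  obtain X Y where par: "local_parametrization D P X Y"
    and ord: "\<And>f. order_at D P f = fls_subdegree (function_pullback f X Y)"
    using order_at_param [OF assms(1)] by blast
  show ?thesis unfolding ord pullback_cancel [OF eval_poly_nonzero [OF par assms]] ..
qed

text \<open>
  Every root \<open>a \<noteq> e\<close> of the denominator can be cancelled by the previous lemma.
\<close>

lemma regular_normal_form:
  assumes "(A, B, H) \<in> nonzero_functions"
    and "\<And>a b. b ^ 2 = poly D a \<Longrightarrow> a \<noteq> e \<Longrightarrow> order_at D (Affine a b) (A, B, H) \<ge> 0"
  shows "\<exists>Q A1 B1 N. Q \<noteq> 0 \<and> A = Q * A1 \<and> B = Q * B1 \<and> H = Q * [:-e, 1:] ^ N"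
  using assms
proof (induction "Polynomial.degree H" arbitrary: A B H rule: less_induct)
  case less
  have H0: "H \<noteq> 0" using less.prems by (simp add: nonzero_functions_def)
  show ?case
  proof (cases "\<exists>a. a \<noteq> e \<and> poly H a = 0")
    case True
    then obtain a where a: "a \<noteq> e" "poly H a = 0" by blast
    have "poly A a = 0" "poly B a = 0"
      using regular_at_root [OF less.prems(1) a(2)] less.prems(2) a(1) by blast+
    then obtain A1 B1 H1 where 1: "A = [:-a, 1:] * A1" "B = [:-a, 1:] * B1" "H = [:-a, 1:] * H1"
      using a(2) by (metis dvdE poly_eq_0_iff_dvd)
    have nz: "(A1, B1, H1) \<in> nonzero_functions" using less.prems(1) 1 by (auto simp: nonzero_functions_def)
    have "H1 \<noteq> 0" using 1 H0 by auto
    then have "Polynomial.degree H1 < Polynomial.degree H" unfolding 1(3) by (subst degree_mult_eq) auto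
    moreover have "order_at D (Affine a' b) (A1, B1, H1) \<ge> 0" if "b ^ 2 = poly D a'" "a' \<noteq> e" for a' b
      using order_cancel [of "Affine a' b" "[:-a, 1:]" A1 B1 H1] less.prems(2) [OF that] that
      unfolding 1 by (auto simp: curve_points_def)
    ultimately obtain Q A2 B2 N where "Q \<noteq> 0 \<and> A1 = Q * A2 \<and> B1 = Q * B2 \<and> H1 = Q * [:-e, 1:] ^ N"
      using less.hyps nz by blast
    then have "[:-a, 1:] * Q \<noteq> 0 \<and> A = [:-a, 1:] * Q * A2 \<and> B = [:-a, 1:] * Q * B2
        \<and> H = [:-a, 1:] * Q * [:-e, 1:] ^ N"
      using 1 by (metis mult.assoc mult_eq_0_iff pCons_eq_0_iff zero_neq_one)
    then show ?thesis by blast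
  next
    case False
    obtain q where q: "H = [:-e, 1:] ^ Polynomial.order e H * q" "\<not> [:-e, 1:] dvd q"
      using order_decomp [OF H0] by blast
    have "poly q x \<noteq> 0" for x
    proof (cases "x = e")
      case True
      then show ?thesis using q(2) by (simp add: poly_eq_0_iff_dvd)
    next
      case x: False
      show ?thesis using False x q(1) by (metis mult_zero_right poly_mult)
    qed
    then have "Polynomial.degree q = 0"
      using fundamental_theorem_of_algebra [of q] by (auto simp: constant_degree)
    then obtain c where c: "q = [:c:]" by (metis degree_eq_zeroE)
    have c0: "c \<noteq> 0" using q(2) c by auto
    have "[:c:] \<noteq> 0 \<and> A = [:c:] * Polynomial.smult (1 / c) A \<and> B = [:c:] * Polynomial.smult (1 / c) B
        \<and> H = [:c:] * [:-e, 1:] ^ Polynomial.order e H"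
      using c0 q(1) c by (simp add: mult.commute)
    then show ?thesis by blast
  qed
qed

text \<open>
  The leading terms of \<open>A\<close> and of \<open>B y\<close> may cancel at one of the two points at infinity, but not at both.
\<close>

lemma regular_at_infinity:
  assumes f: "(A, B, H) \<in> nonzero_functions"
    and reg: "\<And>c. c ^ 2 = lead_coeff D \<Longrightarrow> order_at D (Infinite c) (A, B, H) \<ge> 0"
  shows "Polynomial.degree A \<le> Polynomial.degree H" "B \<noteq> 0 \<Longrightarrow> Polynomial.degree B + g + 1 \<le> Polynomial.degree H"
proof -
  have H0: "H \<noteq> 0" using f by (simp add: nonzero_functions_def)
  have num: "\<exists>X Y. local_parametrization D (Infinite c) X Y \<and>
      fls_subdegree (fls_eval_poly A X + fls_eval_poly B X * Y) \<ge> - int (Polynomial.degree H)"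
    if c: "c ^ 2 = lead_coeff D" for c
  proof -
    have P: "Infinite c \<in> curve_points D" using c by (auto simp: curve_points_def)
    obtain X Y where par: "local_parametrization D (Infinite c) X Y"
      and ord: "\<And>f. order_at D (Infinite c) f = fls_subdegree (function_pullback f X Y)"
      using order_at_param [OF P] by blast
    show ?thesis
      using reg [OF c] par subdegree_poly_at_infinity(2) [OF par c H0]
      unfolding ord pullback_eq_quotient [OF par P f] by force
  qed
  define c where "c = csqrt (lead_coeff D)"
  have c: "c ^ 2 = lead_coeff D" "(- c) ^ 2 = lead_coeff D" by (simp_all add: c_def)
  have c0: "c \<noteq> 0" using c lead_coeff_D by auto
  have "Polynomial.degree A \<le> Polynomial.degree H \<and> (B \<noteq> 0 \<longrightarrow> Polynomial.degree B + g + 1 \<le> Polynomial.degree H)"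
  proof (cases "B = 0")
    case True
    then have "A \<noteq> 0" using f by (simp add: nonzero_functions_def)
    obtain X Y where "local_parametrization D (Infinite c) X Y"
      "fls_subdegree (fls_eval_poly A X + fls_eval_poly B X * Y) \<ge> - int (Polynomial.degree H)"
      using num [OF c(1)] by blast
    then show ?thesis using True subdegree_poly_at_infinity(2) [OF _ c(1) \<open>A \<noteq> 0\<close>] by auto
  next
    case False
    \<comment> \<open>With truncated subtraction \<open>d + g + 1\<close> is the larger of the degrees of \<open>A\<close> and of \<open>B y\<close>.\<close>
    define d where "d = max (Polynomial.degree A - (g + 1)) (Polynomial.degree B)"
    have dA: "Polynomial.degree A \<le> d + g + 1" and dB: "Polynomial.degree B \<le> d" by (auto simp: d_def)
    have top: "coeff A (d + g + 1) \<noteq> 0 \<or> coeff B d \<noteq> 0"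
    proof (cases "d = Polynomial.degree B")
      case True
      then show ?thesis using False by simp
    next
      case neq: False
      then have "Polynomial.degree A = d + g + 1" "A \<noteq> 0" by (auto simp: d_def max_def split: if_splits)
      then show ?thesis by (metis leading_coeff_0_iff)
    qed
    have "\<exists>c'. c' ^ 2 = lead_coeff D \<and> coeff A (d + g + 1) + coeff B d * c' \<noteq> 0"
    proof (cases "coeff A (d + g + 1) + coeff B d * c = 0")
      case True
      then have "coeff A (d + g + 1) + coeff B d * (- c) \<noteq> 0"
        using top c0 by (auto simp: add_eq_0_iff2)
      then show ?thesis using c(2) by blast
    qed (use c(1) in blast)
    then obtain c' where c': "c' ^ 2 = lead_coeff D" "coeff A (d + g + 1) + coeff B d * c' \<noteq> 0" by blast
    obtain X Y where par: "local_parametrization D (Infinite c') X Y"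
      and ge: "fls_subdegree (fls_eval_poly A X + fls_eval_poly B X * Y) \<ge> - int (Polynomial.degree H)"
      using num [OF c'(1)] by blast
    obtain F where F: "fls_eval_poly A X + fls_eval_poly B X * Y = X ^ (d + g + 1) * F"
      "specializes F (coeff A (d + g + 1) + coeff B d * c')"
      using leading_at_infinity [OF par c'(1) dA dB] by blast
    have "fls_subdegree (X ^ (d + g + 1) * F) = - int (d + g + 1)"
      using specializes_nonzero [OF F(2) c'(2)] at_infinity(2,3) [OF par c'(1)]
      by (subst fls_subdegree_mult) (auto simp: fls_subdegree_pow simp del: power_Suc)
    then have "d + g + 1 \<le> Polynomial.degree H" using ge F(1) by simp
    then show ?thesis using dA dB by simp
  qed
  then show "Polynomial.degree A \<le> Polynomial.degree H"
    "B \<noteq> 0 \<Longrightarrow> Polynomial.degree B + g + 1 \<le> Polynomial.degree H" by auto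
qed

text \<open>
  At a Weierstrass point the orders of \<open>A(x)\<close> are even and those of \<open>B(x) y\<close> are odd, so that no
  cancellation occurs in a sum.
\<close>

lemma weierstrass_subdegree:
  assumes par: "local_parametrization D (Affine e 0) X Y" and e: "poly D e = 0"
  shows "A \<noteq> 0 \<Longrightarrow> fls_subdegree (fls_eval_poly A X) = 2 * int (Polynomial.order e A)"
    and "B \<noteq> 0 \<Longrightarrow> fls_subdegree (fls_eval_poly A X + fls_eval_poly B X * Y) \<le> 2 * int (Polynomial.order e B) + 1"
    and "A \<noteq> 0 \<Longrightarrow> fls_subdegree (fls_eval_poly A X + fls_eval_poly B X * Y)
          = fls_subdegree (fls_eval_poly A X - fls_eval_poly B X * Y)"
proof -
  note w = at_weierstrass [OF par e] and X = at_affine(2) [OF par]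
  have sd: "fls_subdegree (fls_eval_poly p X) = 2 * int (Polynomial.order e p)" "fls_eval_poly p X \<noteq> 0"
    if "p \<noteq> 0" for p
    using subdegree_eval_poly [OF X w(1) that] w(2) by auto
  show "A \<noteq> 0 \<Longrightarrow> fls_subdegree (fls_eval_poly A X) = 2 * int (Polynomial.order e A)" using sd by blast
  have sdB: "fls_subdegree (fls_eval_poly B X * Y) = 2 * int (Polynomial.order e B) + 1"
    "fls_eval_poly B X * Y \<noteq> 0" if "B \<noteq> 0"
    using sd [OF that] w by auto
  have min: "fls_subdegree (fls_eval_poly A X + fls_eval_poly B X * Y)
      = min (2 * int (Polynomial.order e A)) (2 * int (Polynomial.order e B) + 1)
    \<and> fls_subdegree (fls_eval_poly A X - fls_eval_poly B X * Y)
      = min (2 * int (Polynomial.order e A)) (2 * int (Polynomial.order e B) + 1)"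
    if "A \<noteq> 0" "B \<noteq> 0"
  proof -
    have "2 * int (Polynomial.order e A) \<noteq> 2 * int (Polynomial.order e B) + 1" by presburger
    then consider "2 * int (Polynomial.order e A) < 2 * int (Polynomial.order e B) + 1"
      | "2 * int (Polynomial.order e B) + 1 < 2 * int (Polynomial.order e A)" by linarith
    then show ?thesis
      using sd [OF that(1)] sdB [OF that(2)]
      by cases (simp_all add: fls_subdegree_add_eq1 fls_subdegree_add_eq2 fls_subdegree_diff_eq1 fls_subdegree_diff_eq2)
  qed
  show "B \<noteq> 0 \<Longrightarrow> fls_subdegree (fls_eval_poly A X + fls_eval_poly B X * Y) \<le> 2 * int (Polynomial.order e B) + 1"
    using min sdB by (cases "A = 0") auto
  show "A \<noteq> 0 \<Longrightarrow> fls_subdegree (fls_eval_poly A X + fls_eval_poly B X * Y)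
          = fls_subdegree (fls_eval_poly A X - fls_eval_poly B X * Y)"
    using min by (cases "B = 0") auto
qed

text \<open>
  In the normal form the denominator is \<open>(x - e)\<^sup>N\<close>. Regularity at infinity gives
  \<open>deg B + g + 1 \<le> N\<close>, so \<open>B\<close> cannot cancel more than \<open>N - g - 1\<close> factors \<open>x - e\<close>, and the term \<open>B y\<close> of
  odd order bounds the order of the sum.
\<close>

lemma pole_bound:
  assumes e: "poly D e = 0" and f: "(A, B, H) \<in> nonzero_functions"
    and reg: "\<And>P. P \<in> curve_points D \<Longrightarrow> P \<noteq> Affine e 0 \<Longrightarrow> order_at D P (A, B, H) \<ge> 0"
    and B: "B \<noteq> 0"
  shows "order_at D (Affine e 0) (A, B, H) \<le> - (2 * int g + 1)"
proof -
  have "order_at D (Affine a b) (A, B, H) \<ge> 0" if "b ^ 2 = poly D a" "a \<noteq> e" for a b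
    using reg [of "Affine a b"] that by (auto simp: curve_points_def)
  from regular_normal_form [OF f this]
  obtain Q A1 B1 N where Q: "Q \<noteq> 0" "A = Q * A1" "B = Q * B1" "H = Q * [:-e, 1:] ^ N" by blast
  have f1: "(A1, B1, [:-e, 1:] ^ N) \<in> nonzero_functions" using f Q by (auto simp: nonzero_functions_def)
  have B1: "B1 \<noteq> 0" using B Q by auto
  have "order_at D (Infinite c) (A1, B1, [:-e, 1:] ^ N) \<ge> 0" if "c ^ 2 = lead_coeff D" for c
    using reg [of "Infinite c"] that order_cancel [of "Infinite c" Q A1 B1] Q by (auto simp: curve_points_def)
  from regular_at_infinity(2) [OF f1 this B1]
  have deg: "Polynomial.degree B1 + g + 1 \<le> N" by (simp add: degree_linear_power)
  have W: "Affine e 0 \<in> curve_points D" using e by (auto simp: curve_points_def)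
  obtain X Y where par: "local_parametrization D (Affine e 0) X Y"
    and ord: "\<And>f. order_at D (Affine e 0) f = fls_subdegree (function_pullback f X Y)"
    using order_at_param [OF W] by blast
  have "order_at D (Affine e 0) (A, B, H) = order_at D (Affine e 0) (A1, B1, [:-e, 1:] ^ N)"
    using order_cancel [OF W Q(1)] Q by simp
  also have "\<dots> = fls_subdegree (fls_eval_poly A1 X + fls_eval_poly B1 X * Y)
      - fls_subdegree (fls_eval_poly ([:-e, 1:] ^ N) X)"
    unfolding ord by (rule pullback_eq_quotient [OF par W f1])
  also have "fls_subdegree (fls_eval_poly ([:-e, 1:] ^ N) X) = 2 * int N"
    using weierstrass_subdegree(1) [OF par e, of "[:-e, 1:] ^ N"] by (simp add: order_power_n_n)
  also have "fls_subdegree (fls_eval_poly A1 X + fls_eval_poly B1 X * Y) \<le> 2 * int (Polynomial.order e B1) + 1"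
    by (rule weierstrass_subdegree(2) [OF par e B1])
  also have "2 * int (Polynomial.order e B1) \<le> 2 * int (Polynomial.degree B1)"
    using order_degree [OF B1] by simp
  finally show ?thesis using deg by linarith
qed

text \<open>
  The only functions without poles are the constants: \<open>pole_bound\<close> removes \<open>B\<close>, and what remains is a
  rational function of \<open>x\<close> without poles.
\<close>

lemma trivial_divisor:
  assumes f: "(A, B, H) \<in> nonzero_functions"
    and reg: "\<And>P. P \<in> curve_points D \<Longrightarrow> order_at D P (A, B, H) \<ge> 0"
  obtains c where "c \<noteq> 0" "A = Polynomial.smult c H" "B = 0"
proof -
  obtain e where e: "poly D e = 0"
    using fundamental_theorem_of_algebra [of D] degree_D by (auto simp: constant_degree)
  have W: "Affine e 0 \<in> curve_points D" using e by (auto simp: curve_points_def)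
  have B: "B = 0" using pole_bound [OF e f] reg W by fastforce
  have "order_at D (Affine a b) (A, B, H) \<ge> 0" if "b ^ 2 = poly D a" "a \<noteq> e" for a b
    using reg [of "Affine a b"] that by (auto simp: curve_points_def)
  from regular_normal_form [OF f this]
  obtain Q A1 B1 N where Q: "Q \<noteq> 0" "A = Q * A1" "B = Q * B1" "H = Q * [:-e, 1:] ^ N" by blast
  have B1: "B1 = 0" using B Q by auto
  have f1: "(A1, B1, [:-e, 1:] ^ N) \<in> nonzero_functions" using f Q by (auto simp: nonzero_functions_def)
  have A1: "A1 \<noteq> 0" using f1 B1 by (simp add: nonzero_functions_def)
  have "order_at D (Infinite c) (A1, B1, [:-e, 1:] ^ N) \<ge> 0" if "c ^ 2 = lead_coeff D" for c
    using reg [of "Infinite c"] that order_cancel [of "Infinite c" Q A1 B1] Q by (auto simp: curve_points_def)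
  from regular_at_infinity(1) [OF f1 this]
  have deg: "Polynomial.degree A1 \<le> N" by (simp add: degree_linear_power)
  obtain X Y where par: "local_parametrization D (Affine e 0) X Y"
    and ord: "\<And>f. order_at D (Affine e 0) f = fls_subdegree (function_pullback f X Y)"
    using order_at_param [OF W] by blast
  have "0 \<le> order_at D (Affine e 0) (A1, B1, [:-e, 1:] ^ N)"
    using order_cancel [OF W Q(1)] reg [OF W] Q by simp
  also have "\<dots> = fls_subdegree (fls_eval_poly A1 X + fls_eval_poly B1 X * Y)
      - fls_subdegree (fls_eval_poly ([:-e, 1:] ^ N) X)"
    unfolding ord by (rule pullback_eq_quotient [OF par W f1])
  also have "fls_subdegree (fls_eval_poly ([:-e, 1:] ^ N) X) = 2 * int N"
    using weierstrass_subdegree(1) [OF par e, of "[:-e, 1:] ^ N"] by (simp add: order_power_n_n)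
  finally have "N \<le> Polynomial.order e A1"
    using weierstrass_subdegree(1) [OF par e A1] B1 by simp
  then have "[:-e, 1:] ^ N dvd A1" by (simp add: order_divides)
  then obtain q where q: "A1 = [:-e, 1:] ^ N * q" by blast
  have "q \<noteq> 0" using q A1 by auto
  then have "Polynomial.degree q = 0"
    using deg unfolding q by (simp add: degree_mult_eq degree_linear_power)
  then obtain c where c: "q = [:c:]" by (metis degree_eq_zeroE)
  show thesis
    by (rule that [of c]) (use c \<open>q \<noteq> 0\<close> B Q q in auto)
qed

end

section \<open>Torsion in the Jacobian\<close>

context hyperelliptic begin

lemma principal_divisors_iff:
  "c \<in> principal_divisors D \<longleftrightarrow> (\<forall>Q. Q \<notin> curve_points D \<longrightarrow> Poly_Mapping.lookup c Q = 0) \<and>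
     (\<exists>f \<in> nonzero_functions. \<forall>Q \<in> curve_points D. Poly_Mapping.lookup c Q = order_at D Q f)"
proof -
  have "Poly_Mapping.keys c \<subseteq> curve_points D \<longleftrightarrow> (\<forall>Q. Q \<notin> curve_points D \<longrightarrow> Poly_Mapping.lookup c Q = 0)"
    by (auto simp: in_keys_iff)
  then show ?thesis by (simp add: principal_divisors_def)
qed

lemma principal_divisors_zero: "0 \<in> principal_divisors D"
proof -
  have "(1, 0, 1) \<in> nonzero_functions" by (simp add: nonzero_functions_def)
  moreover have "order_at D Q (1, 0, 1) = 0" if "Q \<in> curve_points D" for Q
    using order_power_function [OF that, of "(1, 0, 1)" 0] calculation by simp
  ultimately show ?thesis unfolding principal_divisors_iff by force
qed

lemma principal_divisors_add:
  assumes "a \<in> principal_divisors D" "b \<in> principal_divisors D"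
  shows "a + b \<in> principal_divisors D"
proof -
  obtain f h where "f \<in> nonzero_functions" "\<forall>Q \<in> curve_points D. Poly_Mapping.lookup a Q = order_at D Q f"
    "h \<in> nonzero_functions" "\<forall>Q \<in> curve_points D. Poly_Mapping.lookup b Q = order_at D Q h"
    using assms unfolding principal_divisors_iff by blast
  then have "\<forall>Q \<in> curve_points D. Poly_Mapping.lookup (a + b) Q = order_at D Q (fun_mult f h)"
    "fun_mult f h \<in> nonzero_functions"
    by (auto simp: lookup_add order_mult_functions fun_mult_nonzero)
  then show ?thesis using assms unfolding principal_divisors_iff by (auto simp: lookup_add)
qed

lemma principal_divisors_uminus:
  assumes "a \<in> principal_divisors D"
  shows "- a \<in> principal_divisors D"
proof -
  obtain f where "f \<in> nonzero_functions" "\<forall>Q \<in> curve_points D. Poly_Mapping.lookup a Q = order_at D Q f"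
    using assms unfolding principal_divisors_iff by blast
  then have "\<forall>Q \<in> curve_points D. Poly_Mapping.lookup (- a) Q = order_at D Q (fun_inverse f)"
    "fun_inverse f \<in> nonzero_functions"
    by (auto simp: order_inverse_function fun_inverse_nonzero)
  then show ?thesis using assms unfolding principal_divisors_iff by auto
qed

text \<open>
  In a product of two cosets the sums \<open>h\<^sub>1 + h\<^sub>2\<close> of principal divisors range over all principal divisors,
  since \<open>0\<close> is one of them.
\<close>

lemma abel_jacobi_power:
  "abel_jacobi D W P [^]\<^bsub>Defs.jacobian D\<^esub> k
    = (\<lambda>h. h + frag_cmul (int k) (frag_of P - frag_of W)) ` principal_divisors D"
proof (induction k)
  case 0
  show ?case by (simp add: Defs.jacobian_def FactGroup_def)
next
  case (Suc k)
  let ?d = "frag_of P - frag_of W" and ?N = "principal_divisors D"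
  have m: "x \<otimes>\<^bsub>degree_zero_divisors D\<^esub> y = x + y" for x y
    by (simp add: degree_zero_divisors_def free_Abelian_group_def)
  have "abel_jacobi D W P [^]\<^bsub>Defs.jacobian D\<^esub> Suc k
    = {h1 + frag_cmul (int k) ?d + (h2 + ?d) | h1 h2. h1 \<in> ?N \<and> h2 \<in> ?N}"
    unfolding nat_pow_Suc Suc.IH
    by (auto simp: Defs.jacobian_def FactGroup_def set_mult_def abel_jacobi_def r_coset_def m)
  also have "\<dots> = {(h1 + h2) + frag_cmul (int (Suc k)) ?d | h1 h2. h1 \<in> ?N \<and> h2 \<in> ?N}"
    by (simp add: frag_cmul_distrib algebra_simps)
  also have "\<dots> = (\<lambda>h. h + frag_cmul (int (Suc k)) ?d) ` ?N"
    using principal_divisors_zero principal_divisors_add by force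
  finally show ?case .
qed

text \<open>
  The divisor \<open>k (P - W)\<close> is principal. For \<open>P = W\<close> both indicators cancel.
\<close>

definition torsion :: "point \<Rightarrow> point \<Rightarrow> nat \<Rightarrow> bool" where
  "torsion W P k \<longleftrightarrow> (\<exists>f \<in> nonzero_functions. \<forall>Q \<in> curve_points D.
     order_at D Q f = int k * ((if Q = P then 1 else 0) - (if Q = W then 1 else 0)))"

lemma torsion_iff:
  assumes "W \<in> curve_points D" "P \<in> curve_points D"
  shows "abel_jacobi D W P [^]\<^bsub>Defs.jacobian D\<^esub> k = \<one>\<^bsub>Defs.jacobian D\<^esub> \<longleftrightarrow> torsion W P k"
proof -
  let ?d = "frag_cmul (int k) (frag_of P - frag_of W)" and ?N = "principal_divisors D"
  have lk: "Poly_Mapping.lookup ?d Q = int k * ((if Q = P then 1 else 0) - (if Q = W then 1 else 0))" for Q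
    by (auto simp: lookup_minus lookup_single when_def)
  have "(\<lambda>h. h + ?d) ` ?N = ?N \<longleftrightarrow> ?d \<in> ?N"
  proof
    assume "(\<lambda>h. h + ?d) ` ?N = ?N"
    then show "?d \<in> ?N" using principal_divisors_zero by force
  next
    assume d: "?d \<in> ?N"
    have "h \<in> (\<lambda>h. h + ?d) ` ?N" if "h \<in> ?N" for h
    proof (rule image_eqI [of _ _ "h - ?d"])
      show "h = h - ?d + ?d" by (simp only: diff_add_cancel)
      show "h - ?d \<in> ?N"
        unfolding diff_conv_add_uminus [of h] by (rule principal_divisors_add [OF that principal_divisors_uminus [OF d]])
    qed
    then show "(\<lambda>h. h + ?d) ` ?N = ?N" using principal_divisors_add d by blast
  qed
  also have "?d \<in> ?N \<longleftrightarrow> (\<exists>f \<in> nonzero_functions. \<forall>Q \<in> curve_points D.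
      int k * ((if Q = P then 1 else 0) - (if Q = W then 1 else 0)) = order_at D Q f)"
    unfolding principal_divisors_iff lk using assms by auto
  also have "\<dots> \<longleftrightarrow> torsion W P k"
    unfolding torsion_def by (intro bex_cong ball_cong refl eq_commute)
  finally show ?thesis unfolding abel_jacobi_power by (simp add: Defs.jacobian_def FactGroup_def)
qed

lemma primitive_torsion_iff:
  assumes "W \<in> curve_points D" "P \<in> curve_points D"
  shows "primitive_torsion_point D W n P \<longleftrightarrow> torsion W P n \<and> (\<forall>k. 0 < k \<and> k < n \<longrightarrow> \<not> torsion W P k)"
  unfolding primitive_torsion_point_def torsion_iff [OF assms] by blast

lemma weierstrass_point_root:
  assumes "W \<in> weierstrass_points D"
  obtains e where "W = Affine e 0" "poly D e = 0"
proof (cases W)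
  case (Affine x y)
  then have "y = 0" "y ^ 2 = poly D x"
    using assms by (auto simp: weierstrass_points_def curve_points_def)
  then show thesis using that Affine by auto
next
  case (Infinite v)
  then have "v = 0" "v ^ 2 = lead_coeff D"
    using assms by (auto simp: weierstrass_points_def curve_points_def)
  then show thesis using lead_coeff_D by auto
qed

lemma order_rational_affine:
  assumes P: "b ^ 2 = poly D a" and f: "(A, 0, H) \<in> nonzero_functions"
  shows "order_at D (Affine a b) (A, 0, H)
    = (if b = 0 then 2 else 1) * (int (Polynomial.order a A) - int (Polynomial.order a H))"
proof -
  have P': "Affine a b \<in> curve_points D" using P by (auto simp: curve_points_def)
  obtain X Y where par: "local_parametrization D (Affine a b) X Y"
    and ord: "\<And>f. order_at D (Affine a b) f = fls_subdegree (function_pullback f X Y)"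
    using order_at_param [OF P'] by blast
  have nz: "A \<noteq> 0" "H \<noteq> 0" using f by (auto simp: nonzero_functions_def)
  note sd = subdegree_eval_poly(2) [OF at_affine(2) [OF par] affine_nonconstant [OF par P]]
  have "fls_subdegree (X - fls_const a) = (if b = 0 then 2 else 1)"
    using at_ordinary(2) [OF par] at_weierstrass(2) par P by auto
  then show ?thesis
    unfolding ord pullback_eq_quotient [OF par P' f] using sd [OF nz(1)] sd [OF nz(2)]
    by (simp add: algebra_simps)
qed

lemma order_rational_infinite:
  assumes P: "c ^ 2 = lead_coeff D" and f: "(A, 0, H) \<in> nonzero_functions"
  shows "order_at D (Infinite c) (A, 0, H) = int (Polynomial.degree H) - int (Polynomial.degree A)"
proof -
  have P': "Infinite c \<in> curve_points D" using P by (auto simp: curve_points_def)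
  obtain X Y where par: "local_parametrization D (Infinite c) X Y"
    and ord: "\<And>f. order_at D (Infinite c) f = fls_subdegree (function_pullback f X Y)"
    using order_at_param [OF P'] by blast
  have nz: "A \<noteq> 0" "H \<noteq> 0" using f by (auto simp: nonzero_functions_def)
  show ?thesis
    unfolding ord pullback_eq_quotient [OF par P' f]
    using subdegree_poly_at_infinity(2) [OF par P nz(1)] subdegree_poly_at_infinity(2) [OF par P nz(2)]
    by simp
qed

lemma order_rational_involution:
  assumes P: "P \<in> curve_points D" and f: "(A, 0, H) \<in> nonzero_functions"
  shows "hyperelliptic_involution P \<in> curve_points D"
    and "order_at D (hyperelliptic_involution P) (A, 0, H) = order_at D P (A, 0, H)"
proof -
  have "hyperelliptic_involution P \<in> curve_points D \<and>
    order_at D (hyperelliptic_involution P) (A, 0, H) = order_at D P (A, 0, H)"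
  proof (cases P)
    case (Affine a b)
    then have b: "b ^ 2 = poly D a" "(- b) ^ 2 = poly D a" using P by (auto simp: curve_points_def)
    then show ?thesis
      using order_rational_affine [OF b(1) f] order_rational_affine [OF b(2) f] Affine
      by (auto simp: curve_points_def)
  next
    case (Infinite c)
    then have c: "c ^ 2 = lead_coeff D" "(- c) ^ 2 = lead_coeff D" using P by (auto simp: curve_points_def)
    then show ?thesis
      using order_rational_infinite [OF c(1) f] order_rational_infinite [OF c(2) f] Infinite
      by (auto simp: curve_points_def)
  qed
  then show "hyperelliptic_involution P \<in> curve_points D"
    "order_at D (hyperelliptic_involution P) (A, 0, H) = order_at D P (A, 0, H)" by auto
qed

text \<open>
  The divisor of \<open>(x - e') / (x - e)\<close>.
\<close>

lemma weierstrass_two_torsion: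
  assumes e: "poly D e = 0" and e': "poly D e' = 0" and ne: "e \<noteq> e'"
  shows "torsion (Affine e 0) (Affine e' 0) 2"
proof -
  let ?f = "([:-e', 1:], 0, [:-e, 1:])"
  have f: "?f \<in> nonzero_functions" by (simp add: nonzero_functions_def)
  have ord: "Polynomial.order a [:-x, 1:] = (if a = x then 1 else 0)" for a x :: complex
    using order_power_n_n [of x 1] by (auto simp: order_0I)
  have "order_at D Q ?f = int 2 * ((if Q = Affine e' 0 then 1 else 0) - (if Q = Affine e 0 then 1 else 0))"
    if Q: "Q \<in> curve_points D" for Q
  proof (cases Q)
    case (Affine a b)
    then have b: "b ^ 2 = poly D a" using Q by (auto simp: curve_points_def)
    show ?thesis unfolding Affine order_rational_affine [OF b f] ord using b e e' ne by auto
  next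
    case (Infinite c)
    then have c: "c ^ 2 = lead_coeff D" using Q by (auto simp: curve_points_def)
    show ?thesis unfolding Infinite order_rational_infinite [OF c f] by simp
  qed
  with f show ?thesis unfolding torsion_def by blast
qed

theorem primitive_torsion_lower_bound:
  assumes W: "W \<in> weierstrass_points D" and P: "P \<in> curve_points D"
    and prim: "primitive_torsion_point D W n P" and n: "n > 2"
  shows "n > 2 * g"
proof (rule ccontr)
  assume small: "\<not> n > 2 * g"
  obtain e where e: "W = Affine e 0" "poly D e = 0" using weierstrass_point_root [OF W] .
  have Wc: "W \<in> curve_points D" using W by (simp add: weierstrass_points_def)
  have tn: "torsion W P n" and least: "\<And>k. 0 < k \<Longrightarrow> k < n \<Longrightarrow> \<not> torsion W P k"
    using prim primitive_torsion_iff [OF Wc P] by auto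
  have PW: "P \<noteq> W"
  proof
    assume "P = W"
    then have "torsion W P 1" using tn by (simp add: torsion_def)
    then show False using least [of 1] n by simp
  qed
  obtain f where f: "f \<in> nonzero_functions" "\<And>Q. Q \<in> curve_points D \<Longrightarrow>
     order_at D Q f = int n * ((if Q = P then 1 else 0) - (if Q = W then 1 else 0))"
    using tn unfolding torsion_def by blast
  obtain A B H where ABH: "f = (A, B, H)" by (metis prod_cases3)
  have B: "B = 0"
  proof (rule ccontr)
    assume "B \<noteq> 0"
    have "order_at D Q (A, B, H) \<ge> 0" if "Q \<in> curve_points D" "Q \<noteq> Affine e 0" for Q
      using f(2) [OF that(1)] that(2) e ABH by simp
    from pole_bound [OF e(2) f(1) [unfolded ABH] this \<open>B \<noteq> 0\<close>] f(2) [OF Wc]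
    show False using PW small ABH e by simp
  qed
  let ?P' = "hyperelliptic_involution P"
  have f0: "(A, 0, H) \<in> nonzero_functions" using f(1) ABH B by simp
  have "order_at D ?P' f = int n"
    using order_rational_involution(2) [OF P f0] f(2) [OF P] PW ABH B by simp
  moreover have "order_at D ?P' f = int n * ((if ?P' = P then 1 else 0) - (if ?P' = W then 1 else 0))"
    using f(2) order_rational_involution(1) [OF P f0] by blast
  ultimately have "?P' = P" using n by (auto split: if_splits)
  then have "P \<in> weierstrass_points D" using P by (simp add: weierstrass_points_def)
  then obtain e' where e': "P = Affine e' 0" "poly D e' = 0" using weierstrass_point_root by blast
  then have "torsion W P 2" using weierstrass_two_torsion [OF e(2) e'(2)] e PW by auto
  then show False using least [of 2] n by simp
qed

text \<open>
  The conjugates \<open>A \<plusminus> B y\<close> have product \<open>x\<^sup>\<epsilon>\<close>. At affine points other than \<open>W = (0, 0)\<close> both are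
  units; at \<open>W\<close> they have equal orders, hence order \<open>\<epsilon>\<close>. At infinity \<open>c\<close> is chosen so that the leading
  terms of \<open>A - B y\<close> cancel at \<open>Infinite c\<close>; there \<open>A + B y\<close> has order \<open>-(m + \<epsilon>)\<close> and \<open>A - B y\<close>
  therefore order \<open>m\<close>. At \<open>Infinite (-c)\<close> nothing cancels, and \<open>A - B y\<close> has order \<open>-(m + \<epsilon>)\<close>.
\<close>

lemma pell_torsion:
  assumes pell: "A ^ 2 - D * B ^ 2 = [:0, 1:] ^ \<epsilon>" and \<epsilon>: "\<epsilon> \<le> 1"
    and A: "Polynomial.degree A = m + \<epsilon>" and pos: "m + \<epsilon> > 0" and D0: "poly D 0 = 0"
  obtains c where "c ^ 2 = lead_coeff D" "(A, - B, [:0, 1:] ^ (m + \<epsilon>)) \<in> nonzero_functions"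
    "\<And>Q. Q \<in> curve_points D \<Longrightarrow> order_at D Q (A, - B, [:0, 1:] ^ (m + \<epsilon>))
      = int (2 * m + \<epsilon>) * ((if Q = Infinite c then 1 else 0) - (if Q = Affine 0 0 then 1 else 0))"
proof -
  let ?d = "m + \<epsilon>" and ?x = "[:0, 1:] :: complex poly"
  have xp: "Polynomial.degree (?x ^ k) = k" for k using degree_linear_power [of 0 k] by simp
  have A0: "A \<noteq> 0" using A pos by auto
  have DB: "D * B ^ 2 = A ^ 2 - ?x ^ \<epsilon>" using pell by (simp add: algebra_simps)
  have dA2: "Polynomial.degree (A ^ 2) = 2 * ?d" using A A0 by (simp add: degree_power_eq)
  have small: "Polynomial.degree (?x ^ \<epsilon>) < Polynomial.degree (A ^ 2)"
    unfolding xp dA2 using pos by auto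
  have dDB: "Polynomial.degree (D * B ^ 2) = 2 * ?d"
    unfolding DB using degree_add_eq_left [of "- (?x ^ \<epsilon>)" "A ^ 2"] small dA2 by simp
  then have B0: "B \<noteq> 0" using pos by auto
  have dB: "Polynomial.degree B + g + 1 = ?d"
    using dDB B0 D_nonzero degree_D by (simp add: degree_mult_eq degree_power_eq)
  have "coeff (D * B ^ 2) (2 * ?d) = coeff (A ^ 2) (2 * ?d)"
    unfolding DB using small dA2 by (simp add: coeff_eq_0)
  then have "lead_coeff (D * B ^ 2) = lead_coeff (A ^ 2)" using dDB dA2 by simp
  then have lc: "lead_coeff D * lead_coeff B ^ 2 = lead_coeff A ^ 2"
    by (simp add: lead_coeff_mult lead_coeff_power)
  define c where "c = lead_coeff A / lead_coeff B"
  have lB: "lead_coeff B \<noteq> 0" and lA: "lead_coeff A \<noteq> 0" using A0 B0 by auto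
  have c: "c ^ 2 = lead_coeff D" unfolding c_def power_divide using lc lB by (simp add: field_simps)
  have lAB: "lead_coeff A = lead_coeff B * c" unfolding c_def using lB by simp
  let ?f = "(A, - B, ?x ^ ?d)" and ?W = "Affine 0 0"
  have f: "?f \<in> nonzero_functions" using A0 by (simp add: nonzero_functions_def)
  have ord: "order_at D Q ?f = int (2 * m + \<epsilon>) * ((if Q = Infinite c then 1 else 0) - (if Q = ?W then 1 else 0))"
    if Q: "Q \<in> curve_points D" for Q
  proof -
    obtain X Y where par: "local_parametrization D Q X Y"
      and ord: "\<And>f. order_at D Q f = fls_subdegree (function_pullback f X Y)"
      using order_at_param [OF Q] by blast
    let ?p = "fls_eval_poly A X + fls_eval_poly B X * Y" and ?q = "fls_eval_poly A X - fls_eval_poly B X * Y"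
    have nz: "?p \<noteq> 0" "?q \<noteq> 0"
      using eval_function_nonzero [OF par Q, of A B] eval_function_nonzero [OF par Q, of A "- B"] A0 by auto
    have "?p * ?q = fls_eval_poly (?x ^ \<epsilon>) X"
      using eval_conjugate_product [OF param_equation [OF par]] pell by metis
    then have "fls_subdegree (?p * ?q) = fls_subdegree (fls_eval_poly (?x ^ \<epsilon>) X)"
      by (rule arg_cong)
    then have sum: "fls_subdegree ?p + fls_subdegree ?q = fls_subdegree (fls_eval_poly (?x ^ \<epsilon>) X)"
      using nz by simp
    have quot: "order_at D Q ?f = fls_subdegree ?q - fls_subdegree (fls_eval_poly (?x ^ ?d) X)"
      unfolding ord pullback_eq_quotient [OF par Q f] by simp
    show ?thesis
    proof (cases Q)
      case (Affine a b)
      then have b: "b ^ 2 = poly D a" using Q by (auto simp: curve_points_def)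
      note af = at_affine [OF par [unfolded Affine]]
      show ?thesis
      proof (cases "a = 0")
        case True
        then have W: "Q = ?W" using b D0 Affine by simp
        note w = weierstrass_subdegree [OF par [unfolded W] D0]
        have ox: "fls_subdegree (fls_eval_poly (?x ^ k) X) = 2 * int k" for k
          using w(1) [of "?x ^ k"] order_power_n_n [of "0 :: complex" k] by simp
        have "fls_subdegree ?p = fls_subdegree ?q" by (rule w(3) [OF A0])
        then show ?thesis using sum quot ox W by simp
      next
        case False
        have xs: "specializes (fls_eval_poly (?x ^ k) X) (a ^ k)" for k
          using specializes_eval_poly [OF af(2), of "?x ^ k"] by simp
        have x0: "fls_subdegree (fls_eval_poly (?x ^ k) X) = 0" for k
          using specializes_nonzero(2) [OF xs] False by simp
        have "fls_subdegree ?p \<ge> 0" "fls_subdegree ?q \<ge> 0"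
          using specializes_add [OF specializes_eval_poly [OF af(2)] specializes_mult [OF specializes_eval_poly [OF af(2)] af(3)]]
            specializes_diff [OF specializes_eval_poly [OF af(2)] specializes_mult [OF specializes_eval_poly [OF af(2)] af(3)]]
          by (meson specializes_iff)+
        then show ?thesis using sum quot x0 Affine False by simp
      qed
    next
      case (Infinite c')
      then have c': "c' ^ 2 = lead_coeff D" using Q by (auto simp: curve_points_def)
      note par' = par [unfolded Infinite]
      have x0: "fls_subdegree (fls_eval_poly (?x ^ k) X) = - int k" for k
        using subdegree_poly_at_infinity(2) [OF par' c', of "?x ^ k"] xp by simp
      have top: "fls_subdegree (fls_eval_poly A X + fls_eval_poly p X * Y) = - int ?d"
        if "Polynomial.degree p = Polynomial.degree B" "lead_coeff A + lead_coeff p * c' \<noteq> 0" for p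
      proof -
        have "Polynomial.degree A \<le> Polynomial.degree B + g + 1" using A dB by simp
        from leading_at_infinity [OF par' c' this, of p] that(1)
        obtain F where F: "fls_eval_poly A X + fls_eval_poly p X * Y = X ^ (Polynomial.degree B + g + 1) * F"
          "specializes F (coeff A (Polynomial.degree B + g + 1) + coeff p (Polynomial.degree B) * c')" by auto
        then have "specializes F (lead_coeff A + lead_coeff p * c')" using that(1) A dB by simp
        from specializes_nonzero [OF this that(2)] at_infinity(2,3) [OF par' c']
        show ?thesis unfolding F(1) dB by (subst fls_subdegree_mult) (auto simp: fls_subdegree_pow)
      qed
      have "c' ^ 2 = c ^ 2" using c c' by simp
      then consider "c' = c" | "c' = - c" by (auto simp: power2_eq_iff)
      then show ?thesis
      proof cases
        case 1
        have "fls_subdegree ?p = - int ?d"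
          by (rule top) (use lAB lA 1 in auto)
        then show ?thesis using sum quot x0 Infinite 1 by simp
      next
        case 2
        have "fls_subdegree (fls_eval_poly A X + fls_eval_poly (- B) X * Y) = - int ?d"
          by (rule top) (use lAB lA 2 in auto)
        moreover have "c \<noteq> 0" using c lead_coeff_D by auto
        ultimately show ?thesis using quot x0 Infinite 2 by simp
      qed
    qed
  qed
  show thesis by (rule that [OF c f ord])
qed

end

section \<open>Weighted Chebyshev polynomials\<close>

lemma lagrange_interpolation:
  fixes x :: "nat \<Rightarrow> real" and v :: "nat \<Rightarrow> real"
  assumes inj: "inj_on x {..r}"
  defines "w \<equiv> \<lambda>j. \<Prod>k\<in>{..r} - {j}. x j - x k"
  obtains p where "Polynomial.degree p \<le> r" "\<And>j. j \<le> r \<Longrightarrow> poly p (x j) = v j"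
    "coeff p r = (\<Sum>j\<le>r. v j / w j)"
    "\<And>z. poly p z = (\<Sum>j\<le>r. v j / w j * (\<Prod>k\<in>{..r} - {j}. z - x k))"
proof -
  define b where "b = (\<lambda>j. \<Prod>k\<in>{..r} - {j}. [:- x k, 1:])"
  define p where "p = (\<Sum>j\<le>r. Polynomial.smult (v j / w j) (b j))"
  have db: "Polynomial.degree (b j) = r" and lb: "coeff (b j) r = 1" if "j \<le> r" for j
  proof -
    show d: "Polynomial.degree (b j) = r"
      unfolding b_def using that by (subst degree_prod_eq_sum_degree) auto
    have "lead_coeff (b j) = 1" unfolding b_def by (simp add: lead_coeff_prod)
    then show "coeff (b j) r = 1" using d by simp
  qed
  have pb: "poly (b j) z = (\<Prod>k\<in>{..r} - {j}. z - x k)" for j z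
    unfolding b_def poly_prod by simp
  have pz: "poly p z = (\<Sum>j\<le>r. v j / w j * (\<Prod>k\<in>{..r} - {j}. z - x k))" for z
    unfolding p_def by (simp add: poly_sum pb)
  have w0: "w j \<noteq> 0" if "j \<le> r" for j
    unfolding w_def using inj that by (auto simp: inj_on_def)
  have "poly p (x i) = v i" if i: "i \<le> r" for i
  proof -
    have "(\<Prod>k\<in>{..r} - {j}. x i - x k) = (if j = i then w i else 0)" if "j \<le> r" for j
      using i that by (auto simp: w_def)
    then have "poly p (x i) = (\<Sum>j\<le>r. v j / w j * (if j = i then w i else 0))"
      unfolding pz by (intro sum.cong) auto
    also have "\<dots> = (\<Sum>j\<le>r. if j = i then v i else 0)"
      by (intro sum.cong) (use w0 i in auto)
    finally show ?thesis using i by simp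
  qed
  moreover have "Polynomial.degree p \<le> r"
    unfolding p_def by (intro degree_sum_le) (auto simp: db intro: order_trans [OF degree_smult_le])
  moreover have "coeff p r = (\<Sum>j\<le>r. v j / w j)"
    unfolding p_def coeff_sum by (intro sum.cong) (auto simp: lb)
  ultimately show thesis using that pz by blast
qed

text \<open>
  The first formula is the divided difference. For monic \<open>q\<close> of degree \<open>r\<close> it is a linear relation with
  right-hand side 1 between the values at any \<open>r + 1\<close> nodes; the extremal problem below rests on it.
\<close>

lemma lagrange_formulas:
  fixes x :: "nat \<Rightarrow> real"
  assumes inj: "inj_on x {..r}" and q: "Polynomial.degree q \<le> r"
  shows "coeff q r = (\<Sum>j\<le>r. poly q (x j) / (\<Prod>k\<in>{..r} - {j}. x j - x k))"
    and "poly q z = (\<Sum>j\<le>r. poly q (x j) / (\<Prod>k\<in>{..r} - {j}. x j - x k) * (\<Prod>k\<in>{..r} - {j}. z - x k))"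
proof -
  obtain p where p: "Polynomial.degree p \<le> r" "\<And>j. j \<le> r \<Longrightarrow> poly p (x j) = poly q (x j)"
    "coeff p r = (\<Sum>j\<le>r. poly q (x j) / (\<Prod>k\<in>{..r} - {j}. x j - x k))"
    "\<And>z. poly p z = (\<Sum>j\<le>r. poly q (x j) / (\<Prod>k\<in>{..r} - {j}. x j - x k) * (\<Prod>k\<in>{..r} - {j}. z - x k))"
    by (rule lagrange_interpolation [OF inj, of "\<lambda>j. poly q (x j)"]) blast
  have "card (x ` {..r}) = Suc r" using inj by (simp add: card_image)
  then have "p = q"
    using p(2) by (intro poly_eqI_degree [of "x ` {..r}"]) (use p(1) q in auto)
  then show "coeff q r = (\<Sum>j\<le>r. poly q (x j) / (\<Prod>k\<in>{..r} - {j}. x j - x k))"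
    "poly q z = (\<Sum>j\<le>r. poly q (x j) / (\<Prod>k\<in>{..r} - {j}. x j - x k) * (\<Prod>k\<in>{..r} - {j}. z - x k))"
    using p(3) p(4) [of z] by (simp_all only: \<open>p = q\<close>)
qed

lemma node_product_sign:
  fixes x :: "nat \<Rightarrow> real"
  assumes "strict_mono_on {..r} x" "j \<le> r"
  shows "(\<Prod>k\<in>{..r} - {j}. x j - x k) = (-1) ^ (r - j) * (\<Prod>k\<in>{..r} - {j}. \<bar>x j - x k\<bar>)"
proof -
  have s: "{..r} - {j} = {..<j} \<union> {j<..r}" using assms(2) by auto
  have "(\<Prod>k\<in>{..<j}. x j - x k) = (\<Prod>k\<in>{..<j}. \<bar>x j - x k\<bar>)"
  proof (rule prod.cong [OF refl])
    fix k assume "k \<in> {..<j}"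
    then have "x k < x j" using assms by (intro strict_mono_onD [OF assms(1)]) auto
    then show "x j - x k = \<bar>x j - x k\<bar>" by simp
  qed
  moreover have "(\<Prod>k\<in>{j<..r}. x j - x k) = (\<Prod>k\<in>{j<..r}. (-1) * \<bar>x j - x k\<bar>)"
  proof (rule prod.cong [OF refl])
    fix k assume "k \<in> {j<..r}"
    then have "x j < x k" using assms by (intro strict_mono_onD [OF assms(1)]) auto
    then show "x j - x k = (-1) * \<bar>x j - x k\<bar>" by simp
  qed
  moreover have "(\<Prod>k\<in>{j<..r}. (-1) * \<bar>x j - x k\<bar>) = (-1) ^ (r - j) * (\<Prod>k\<in>{j<..r}. \<bar>x j - x k\<bar>)"
    by (subst prod.distrib) simp
  moreover have d: "(\<Prod>k\<in>{..r} - {j}. f k) = (\<Prod>k\<in>{..<j}. f k) * (\<Prod>k\<in>{j<..r}. f k)" for f :: "nat \<Rightarrow> real"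
    unfolding s by (intro prod.union_disjoint) auto
  ultimately show ?thesis by (simp add: d)
qed

text \<open>
  If a monic polynomial \<open>R\<close> of degree \<open>r\<close> satisfies \<open>\<omega> R = \<plusminus>L\<close> with alternating signs at the nodes
  \<open>x\<^sub>0 < \<dots> < x\<^sub>r\<close>, then \<open>1 / L\<close> is the value of this functional. So its minimum over all nodes belongs to
  the largest levelled value \<open>L\<close>, as in the dual form of the Chebyshev problem.
\<close>

definition node_functional :: "(real \<Rightarrow> real) \<Rightarrow> nat \<Rightarrow> (nat \<Rightarrow> real) \<Rightarrow> real" where
  "node_functional \<omega> r x = (\<Sum>j\<le>r. 1 / (\<omega> (x j) * (\<Prod>k\<in>{..r} - {j}. \<bar>x j - x k\<bar>)))"

definition nodes :: "(real \<Rightarrow> real) \<Rightarrow> nat \<Rightarrow> (nat \<Rightarrow> real) set" where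
  "nodes \<omega> r = {x. strict_mono_on {..r} x \<and> (\<forall>j\<le>r. 0 \<le> x j \<and> x j \<le> 1 \<and> \<omega> (x j) > 0)}"

lemma nodes_product:
  assumes "x \<in> nodes \<omega> r" "j \<le> r"
  shows "(\<Prod>k\<in>{..r} - {j}. \<bar>x j - x k\<bar>) > 0" "(\<Prod>k\<in>{..r} - {j}. \<bar>x j - x k\<bar>) \<le> 1"
    "\<And>i. i \<le> r \<Longrightarrow> i \<noteq> j \<Longrightarrow> (\<Prod>k\<in>{..r} - {j}. \<bar>x j - x k\<bar>) \<le> \<bar>x j - x i\<bar>"
proof -
  have sm: "strict_mono_on {..r} x" and b: "\<And>j. j \<le> r \<Longrightarrow> 0 \<le> x j \<and> x j \<le> 1"
    using assms by (auto simp: nodes_def)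
  have inj: "inj_on x {..r}" using sm strict_mono_on_imp_inj_on by blast
  show "(\<Prod>k\<in>{..r} - {j}. \<bar>x j - x k\<bar>) > 0"
    by (intro prod_pos) (use inj assms(2) in \<open>auto simp: inj_on_def\<close>)
  have le: "\<bar>x j - x k\<bar> \<le> 1" if "k \<le> r" for k
    using b [OF that] b [OF assms(2)] by linarith
  show "(\<Prod>k\<in>{..r} - {j}. \<bar>x j - x k\<bar>) \<le> 1" by (intro prod_le_1) (use le in auto)
  fix i assume i: "i \<le> r" "i \<noteq> j"
  have "(\<Prod>k\<in>{..r} - {j}. \<bar>x j - x k\<bar>) = \<bar>x j - x i\<bar> * (\<Prod>k\<in>{..r} - {j} - {i}. \<bar>x j - x k\<bar>)"
    using i by (intro prod.remove) auto
  also have "\<dots> \<le> \<bar>x j - x i\<bar> * 1" by (intro mult_left_mono prod_le_1) (use le in auto)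
  finally show "(\<Prod>k\<in>{..r} - {j}. \<bar>x j - x k\<bar>) \<le> \<bar>x j - x i\<bar>" by simp
qed

lemma node_functional_term_le:
  assumes "x \<in> nodes \<omega> r" "j \<le> r"
  shows "1 / (\<omega> (x j) * (\<Prod>k\<in>{..r} - {j}. \<bar>x j - x k\<bar>)) \<le> node_functional \<omega> r x"
  unfolding node_functional_def
proof (rule member_le_sum [of j "{..r}" "\<lambda>j. 1 / (\<omega> (x j) * (\<Prod>k\<in>{..r} - {j}. \<bar>x j - x k\<bar>))"])
  fix i assume "i \<in> {..r} - {j}"
  then have "\<omega> (x i) > 0" "(\<Prod>k\<in>{..r} - {i}. \<bar>x i - x k\<bar>) > 0"
    using nodes_product(1) [OF assms(1), of i] assms(1) by (simp_all add: nodes_def)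
  then show "0 \<le> 1 / (\<omega> (x i) * (\<Prod>k\<in>{..r} - {i}. \<bar>x i - x k\<bar>))" by simp
qed (use assms(2) in auto)

text \<open>
  The functional tends to infinity when two nodes collide or the weight tends to \<open>0\<close> at a node, so
  the infimum may be taken over a compact set of nodes with gaps and weights bounded below by some
  \<open>\<delta>\<close>. Nodes are functions on \<open>nat\<close>, extended by \<open>0\<close>, so that the product topology applies.
\<close>

lemma node_functional_minimiser:
  assumes cont: "continuous_on {0..1} \<omega>" and pos: "\<And>x. 0 < x \<Longrightarrow> x \<le> 1 \<Longrightarrow> \<omega> x > 0"
  obtains x where "x \<in> nodes \<omega> r" "\<And>y. y \<in> nodes \<omega> r \<Longrightarrow> node_functional \<omega> r x \<le> node_functional \<omega> r y"
proof -
  let ?F = "node_functional \<omega> r"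
  \<comment> \<open>Any admissible nodes give a bound \<open>F0\<close> for the minimum.\<close>
  define x0 :: "nat \<Rightarrow> real" where "x0 = (\<lambda>j. real (Suc j) / real (Suc r))"
  have x0: "x0 \<in> nodes \<omega> r"
    unfolding nodes_def x0_def
    by (auto simp: strict_mono_on_def divide_strict_right_mono intro!: pos)
  define F0 where "F0 = ?F x0"
  have F0: "F0 > 0"
  proof -
    have "0 < 1 / (\<omega> (x0 0) * (\<Prod>k\<in>{..r} - {0}. \<bar>x0 0 - x0 k\<bar>))"
      using nodes_product(1) [OF x0, of 0] x0 by (auto simp: nodes_def)
    also have "\<dots> \<le> F0" unfolding F0_def by (rule node_functional_term_le [OF x0]) simp
    finally show ?thesis .
  qed
  obtain M where M': "\<And>y. y \<in> \<omega> ` {0..1} \<Longrightarrow> norm y \<le> M"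
    using compact_imp_bounded [OF compact_continuous_image [OF cont compact_Icc]]
    unfolding bounded_iff by blast
  have M: "\<omega> x \<le> M" if "x \<in> {0..1}" for x
    using M' [of "\<omega> x"] that by (simp add: abs_le_iff)
  have M0: "M > 0" using M [of 1] pos [of 1] by simp
  define \<delta> where "\<delta> = min (1 / F0) (1 / (M * F0))"
  have \<delta>: "\<delta> > 0" using F0 M0 by (simp add: \<delta>_def)
  define C where "C = {x. (\<forall>j. j > r \<longrightarrow> x j = 0) \<and> (\<forall>j\<le>r. x j \<in> {0..1} \<and> \<omega> (x j) \<ge> \<delta>)
     \<and> (\<forall>j\<le>r. \<forall>k\<le>r. j < k \<longrightarrow> x k - x j \<ge> \<delta>)}"
  have C_nodes: "C \<subseteq> nodes \<omega> r"
  proof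
    fix x assume x: "x \<in> C"
    have "x j < x k" if "j \<le> r" "k \<le> r" "j < k" for j k
    proof -
      have "\<delta> \<le> x k - x j" using x that unfolding C_def by blast
      then show ?thesis using \<delta> by linarith
    qed
    moreover have "\<omega> (x j) > 0" if "j \<le> r" for j
    proof -
      have "\<delta> \<le> \<omega> (x j)" using x that unfolding C_def by blast
      then show ?thesis using \<delta> by linarith
    qed
    ultimately show "x \<in> nodes \<omega> r" using x by (auto simp: C_def nodes_def strict_mono_on_def)
  qed
  have F_cong: "?F x = ?F y" if "\<And>j. j \<le> r \<Longrightarrow> x j = y j" for x y
    unfolding node_functional_def using that by (intro sum.cong) auto
  have in_C: "(\<lambda>j. if j \<le> r then x j else 0) \<in> C" if x: "x \<in> nodes \<omega> r" and F: "?F x \<le> F0" for x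
  proof -
    have b: "\<omega> (x j) * (\<Prod>k\<in>{..r} - {j}. \<bar>x j - x k\<bar>) \<ge> 1 / F0" if "j \<le> r" for j
    proof -
      let ?t = "\<omega> (x j) * (\<Prod>k\<in>{..r} - {j}. \<bar>x j - x k\<bar>)"
      have "?t > 0" using nodes_product(1) [OF x that] x that by (simp add: nodes_def)
      moreover have "1 / ?t \<le> F0" using node_functional_term_le [OF x that] F by simp
      ultimately show ?thesis using F0 by (simp add: field_simps)
    qed
    have bd: "0 \<le> x j" "x j \<le> 1" "\<omega> (x j) > 0" if "j \<le> r" for j using x that by (auto simp: nodes_def)
    have d1: "\<omega> (x j) \<ge> \<delta>" if "j \<le> r" for j
    proof -
      have "\<omega> (x j) * (\<Prod>k\<in>{..r} - {j}. \<bar>x j - x k\<bar>) \<le> \<omega> (x j) * 1"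
        using nodes_product(2) [OF x that] bd(3) [OF that] by (intro mult_left_mono) auto
      then show ?thesis using b [OF that] by (simp add: \<delta>_def)
    qed
    have d2: "x k - x j \<ge> \<delta>" if jk: "j \<le> r" "k \<le> r" "j < k" for j k
    proof -
      have "\<omega> (x j) * (\<Prod>k\<in>{..r} - {j}. \<bar>x j - x k\<bar>) \<le> M * \<bar>x j - x k\<bar>"
        using nodes_product(1,3) [OF x jk(1)] jk bd [OF jk(1)] M [of "x j"] M0
        by (intro mult_mono) (simp_all add: less_imp_le)
      then have "1 / F0 \<le> M * \<bar>x j - x k\<bar>" using b [OF jk(1)] by linarith
      then have "1 / (M * F0) \<le> \<bar>x j - x k\<bar>" using M0 F0 by (simp add: field_simps)
      moreover have "x j < x k" using x jk strict_mono_onD [of "{..r}" x j k] by (simp add: nodes_def)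
      ultimately show ?thesis by (simp add: \<delta>_def)
    qed
    show ?thesis
      unfolding C_def mem_Collect_eq using bd d1 d2 by (intro conjI allI impI) (simp_all del: diff_ge_0_iff_ge)
  qed
  let ?x0 = "\<lambda>j. if j \<le> r then x0 j else 0"
  have "C \<noteq> {}" using in_C [OF x0] by (auto simp: F0_def)
  have coord: "continuous_on S (\<lambda>x. x j)" for S :: "(nat \<Rightarrow> real) set" and j :: nat
    by (rule continuous_on_subset [OF continuous_on_product_coordinates]) simp
  have compC: "compact C"
  proof -
    define B where "B = (\<Pi>\<^sub>E j\<in>(UNIV :: nat set). if j \<le> r then {0..1} else {0 :: real})"
    have "compactin (product_topology (\<lambda>i. euclidean) UNIV) B"
      unfolding B_def by (subst compactin_PiE) auto
    then have B: "compact B" by (simp add: euclidean_product_topology)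
    \<comment> \<open>Clamping extends the weight continuously, so that the conditions on single nodes are closed.\<close>
    define \<omega>' where "\<omega>' = (\<lambda>x. \<omega> (max 0 (min 1 x)))"
    have cont': "continuous_on UNIV \<omega>'"
      unfolding \<omega>'_def by (rule continuous_on_compose2 [OF cont]) (auto intro!: continuous_intros)
    have "closed {x. \<omega>' (x j) \<ge> \<delta>}" for j :: nat
      by (intro closed_Collect_le continuous_on_const continuous_on_compose2 [OF cont' coord]) auto
    then have c1: "closed (\<Inter>j\<in>{..r}. {x. \<omega>' (x j) \<ge> \<delta>})"
      by (intro closed_INT ballI)
    have "closed {x :: nat \<Rightarrow> real. x k - x j \<ge> \<delta>}" for j k :: nat
      by (intro closed_Collect_le continuous_on_const continuous_on_diff coord)
    then have c2: "closed (\<Inter>j\<in>{..r}. \<Inter>k\<in>{j<..r}. {x :: nat \<Rightarrow> real. x k - x j \<ge> \<delta>})"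
      by (intro closed_INT ballI)
    have memB: "x \<in> B \<longleftrightarrow> (\<forall>j. x j \<in> (if j \<le> r then {0..1} else {0}))" for x
      unfolding B_def PiE_UNIV_domain Pi_iff by simp
    have \<omega>\<omega>': "\<omega>' (x j) = \<omega> (x j)" if "x j \<in> {0..1}" for x :: "nat \<Rightarrow> real" and j
      using that by (simp add: \<omega>'_def)
    have "C = B \<inter> ((\<Inter>j\<in>{..r}. {x. \<omega>' (x j) \<ge> \<delta>}) \<inter> (\<Inter>j\<in>{..r}. \<Inter>k\<in>{j<..r}. {x. x k - x j \<ge> \<delta>}))"
      (is "_ = B \<inter> (?R1 \<inter> ?R2)")
    proof (intro equalityI subsetI)
      fix x assume x: "x \<in> C"
      then have u: "\<And>j. j \<le> r \<Longrightarrow> x j \<in> {0..1}" "\<And>j. j \<le> r \<Longrightarrow> \<omega> (x j) \<ge> \<delta>"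
        "\<And>j. j > r \<Longrightarrow> x j = 0" "\<And>j k. j \<le> r \<Longrightarrow> k \<le> r \<Longrightarrow> j < k \<Longrightarrow> x k - x j \<ge> \<delta>"
        unfolding C_def by blast+
      have "x \<in> B" unfolding memB using u(1,3) by simp
      moreover have "x \<in> ?R1" using u(1,2) \<omega>\<omega>' by simp
      moreover have "x \<in> ?R2" using u(4) by simp
      ultimately show "x \<in> B \<inter> (?R1 \<inter> ?R2)" by blast
    next
      fix x assume x: "x \<in> B \<inter> (?R1 \<inter> ?R2)"
      then have xb: "x j \<in> (if j \<le> r then {0..1} else {0})" for j using memB by blast
      have 1: "x j = 0" if "j > r" for j using xb [of j] that by simp
      have 2: "x j \<in> {0..1}" if "j \<le> r" for j using xb [of j] that by simp
      have 3: "\<omega> (x j) \<ge> \<delta>" if "j \<le> r" for j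
      proof -
        have "x \<in> ?R1" using x by blast
        then have "x \<in> {x. \<omega>' (x j) \<ge> \<delta>}" using that by blast
        then show ?thesis using \<omega>\<omega>' [of x j] 2 [OF that] by simp
      qed
      have 4: "x k - x j \<ge> \<delta>" if "j \<le> r" "k \<le> r" "j < k" for j k
      proof -
        have "\<forall>j\<in>{..r}. \<forall>k\<in>{j<..r}. x k - x j \<ge> \<delta>"
          using x unfolding Int_iff INT_iff mem_Collect_eq by (elim conjE)
        then have "\<forall>k\<in>{j<..r}. x k - x j \<ge> \<delta>" by (rule bspec) (use that in simp)
        then show ?thesis by (rule bspec) (use that in simp)
      qed
      show "x \<in> C" unfolding C_def by (intro CollectI conjI allI impI 1 2 3 4)
    qed
    moreover have "compact \<dots>" by (intro compact_Int_closed B closed_Int c1 c2)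
    ultimately show ?thesis by simp
  qed
  have nz: "\<omega> (x j) * (\<Prod>k\<in>{..r} - {j}. \<bar>x j - x k\<bar>) \<noteq> 0" if "x \<in> C" "j \<le> r" for x j
  proof -
    have "x \<in> nodes \<omega> r" using that(1) C_nodes by blast
    then have "(\<Prod>k\<in>{..r} - {j}. \<bar>x j - x k\<bar>) > 0" "\<omega> (x j) > 0"
      using nodes_product(1) that(2) by (auto simp: nodes_def)
    then have "\<omega> (x j) * (\<Prod>k\<in>{..r} - {j}. \<bar>x j - x k\<bar>) > 0" by (rule mult_pos_pos [rotated])
    then show ?thesis by linarith
  qed
  have "continuous_on C ?F"
    unfolding node_functional_def
    by (intro continuous_on_sum continuous_on_divide continuous_on_mult continuous_on_prod continuous_on_const
        continuous_on_rabs continuous_on_diff coord continuous_on_compose2 [OF cont coord] ballI)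
      (use nz in \<open>auto simp: C_def\<close>)
  from continuous_attains_inf [OF compC \<open>C \<noteq> {}\<close> this]
  obtain x where x: "x \<in> C" "\<And>y. y \<in> C \<Longrightarrow> ?F x \<le> ?F y" by blast
  have "?F x \<le> ?F y" if y: "y \<in> nodes \<omega> r" for y
  proof (cases "?F y \<le> F0")
    case True
    then show ?thesis using x(2) [OF in_C [OF y True]] F_cong [of "\<lambda>j. if j \<le> r then y j else 0" y] by simp
  next
    case False
    have "?F x \<le> F0"
      using x(2) [OF in_C [OF x0]] F_cong [of ?x0 x0] by (simp add: F0_def)
    then show ?thesis using False by simp
  qed
  then show thesis using x(1) C_nodes that by blast
qed

text \<open>
  Alternation comes from optimality by an exchange argument. Let \<open>R\<close> be the monic polynomial levelled
  at the optimal nodes. If \<open>\<plusminus>\<omega>(y) R(y) > L\<close> for some \<open>y\<close> between the neighbours of \<open>x\<^sub>j\<close>, replace \<open>x\<^sub>j\<close> by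
  \<open>y\<close>: the divided difference of \<open>R\<close> at the new nodes is still 1, but all its terms are at least \<open>L\<close>
  times those of the functional, one of them strictly, so the functional has become smaller. The lower
  bound to the right of \<open>1\<close> holds because all terms of the Lagrange formula are positive there.
\<close>

theorem weighted_chebyshev:
  assumes cont: "continuous_on {0..1} \<omega>" and pos: "\<And>x. 0 < x \<Longrightarrow> x \<le> 1 \<Longrightarrow> \<omega> x > 0"
    and nonneg: "\<And>x. 0 \<le> x \<Longrightarrow> x \<le> 1 \<Longrightarrow> \<omega> x \<ge> 0" and bound: "\<And>x. 0 \<le> x \<Longrightarrow> x \<le> 1 \<Longrightarrow> \<omega> x \<le> M"
  obtains x :: "nat \<Rightarrow> real" and R L where "strict_mono_on {..r} x" "\<And>j. j \<le> r \<Longrightarrow> x j \<in> {0..1}"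
    "Polynomial.degree R = r" "lead_coeff R = 1" "0 < L" "L \<le> M"
    "\<And>j. j \<le> r \<Longrightarrow> \<omega> (x j) * poly R (x j) = (-1) ^ (r - j) * L"
    "\<And>j y. j \<le> r \<Longrightarrow> y \<in> {0..1} \<Longrightarrow> (\<And>k. k < j \<Longrightarrow> x k < y) \<Longrightarrow> (\<And>k. j < k \<Longrightarrow> k \<le> r \<Longrightarrow> y < x k)
       \<Longrightarrow> (-1) ^ (r - j) * (\<omega> y * poly R y) \<le> L"
    "\<And>z. z \<ge> 1 \<Longrightarrow> (z - 1) ^ r \<le> poly R z"
proof -
  let ?F = "node_functional \<omega> r"
  obtain x where x: "x \<in> nodes \<omega> r" and opt: "\<And>y. y \<in> nodes \<omega> r \<Longrightarrow> ?F x \<le> ?F y"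
    using node_functional_minimiser [OF cont pos] by blast
  have sm: "strict_mono_on {..r} x" and xb: "\<And>j. j \<le> r \<Longrightarrow> x j \<in> {0..1}"
    and wp: "\<And>j. j \<le> r \<Longrightarrow> \<omega> (x j) > 0" using x by (auto simp: nodes_def)
  have inj: "inj_on y {..r}" if "y \<in> nodes \<omega> r" for y
    using that strict_mono_on_imp_inj_on by (auto simp: nodes_def)
  define \<pi> where "\<pi> = (\<lambda>y j. \<Prod>k\<in>{..r} - {j}. \<bar>y j - y k :: real\<bar>)"
  have \<pi>: "\<pi> y j > 0" if "y \<in> nodes \<omega> r" "j \<le> r" for y j
    unfolding \<pi>_def by (rule nodes_product(1) [OF that])
  have F\<pi>: "?F y = (\<Sum>j\<le>r. 1 / (\<omega> (y j) * \<pi> y j))" for y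
    by (simp add: node_functional_def \<pi>_def)
  have sgn: "(\<Prod>k\<in>{..r} - {j}. y j - y k) = (-1) ^ (r - j) * \<pi> y j" if "y \<in> nodes \<omega> r" "j \<le> r" for y j
    unfolding \<pi>_def by (rule node_product_sign) (use that in \<open>auto simp: nodes_def\<close>)
  have sq: "(-1) ^ i * ((-1) ^ i * a) = (a :: real)" for i a
    by (simp add: mult.assoc [symmetric] power_mult_distrib [symmetric])
  have flip: "a / ((-1) ^ i * b) = (-1) ^ i * a / (b :: real)" for i a b
    by (cases "even i") auto
  have t0: "1 / (\<omega> (x 0) * \<pi> x 0) \<le> ?F x" using node_functional_term_le [OF x, of 0] by (simp add: \<pi>_def)
  have Fpos: "?F x > 0"
    using t0 wp [of 0] \<pi> [OF x, of 0] by (smt (verit) divide_pos_pos mult_pos_pos zero_le)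
  define L where "L = 1 / ?F x"
  have L: "L > 0" using Fpos by (simp add: L_def)
  have LM: "L \<le> M"
  proof -
    have "\<omega> (x 0) * \<pi> x 0 \<le> M * 1"
      using nodes_product(1,2) [OF x, of 0] xb [of 0] bound [of "x 0"] wp [of 0]
      unfolding \<pi>_def by (intro mult_mono) auto
    moreover have "\<omega> (x 0) * \<pi> x 0 > 0" using wp [of 0] \<pi> [OF x, of 0] by simp
    ultimately have "1 / M \<le> ?F x"
      using t0 by (smt (verit) frac_le mult.right_neutral)
    moreover have "M > 0" using \<open>\<omega> (x 0) * \<pi> x 0 \<le> M * 1\<close> \<open>\<omega> (x 0) * \<pi> x 0 > 0\<close> by simp
    ultimately show ?thesis using Fpos by (simp add: L_def field_simps)
  qed
  obtain R where R: "Polynomial.degree R \<le> r"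
    "\<And>j. j \<le> r \<Longrightarrow> poly R (x j) = (-1) ^ (r - j) * L / \<omega> (x j)"
    by (rule lagrange_interpolation [OF inj [OF x], of "\<lambda>j. (-1) ^ (r - j) * L / \<omega> (x j)"]) blast
  have vR: "\<omega> (x j) * poly R (x j) = (-1) ^ (r - j) * L" if "j \<le> r" for j
    using R(2) [OF that] wp [OF that] by simp
  have lead: "coeff R r = (\<Sum>j\<le>r. (-1) ^ (r - j) * poly R (y j) / \<pi> y j)" if "y \<in> nodes \<omega> r" for y
    unfolding lagrange_formulas(1) [OF inj [OF that] R(1)]
    by (intro sum.cong) (auto simp: sgn [OF that] flip)
  have trm: "(-1) ^ (r - j) * poly R (x j) / \<pi> x j = L * (1 / (\<omega> (x j) * \<pi> x j))" if "j \<le> r" for j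
    unfolding R(2) [OF that] times_divide_eq_right sq by simp
  have c1: "coeff R r = 1"
  proof -
    have "coeff R r = (\<Sum>j\<le>r. L * (1 / (\<omega> (x j) * \<pi> x j)))"
      unfolding lead [OF x] by (intro sum.cong) (use trm in auto)
    also have "\<dots> = L * ?F x" unfolding F\<pi> sum_distrib_left ..
    finally show ?thesis using Fpos by (simp add: L_def)
  qed
  have dR: "Polynomial.degree R = r" using R(1) c1 by (metis le_antisym le_degree zero_neq_one)
  have ext: "(-1) ^ (r - j) * (\<omega> y * poly R y) \<le> L"
    if j: "j \<le> r" and y: "y \<in> {0..1}" and lo: "\<And>k. k < j \<Longrightarrow> x k < y"
      and hi: "\<And>k. j < k \<Longrightarrow> k \<le> r \<Longrightarrow> y < x k" for j y
  proof (rule ccontr)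
    assume "\<not> ?thesis"
    then have gt: "(-1) ^ (r - j) * (\<omega> y * poly R y) > L" by simp
    have wy: "\<omega> y > 0"
    proof (rule ccontr)
      assume "\<not> \<omega> y > 0"
      then have "\<omega> y = 0" using nonneg [of y] y by simp
      then show False using gt L by simp
    qed
    define x' where "x' = x(j := y)"
    have x': "x' \<in> nodes \<omega> r"
      unfolding nodes_def x'_def mem_Collect_eq
    proof (intro conjI strict_mono_onI allI impI)
      fix a b assume "a \<in> {..r}" "b \<in> {..r}" "a < b"
      then show "(x(j := y)) a < (x(j := y)) b" using lo hi strict_mono_onD [OF sm] by auto
    qed (use wy y xb wp in auto)
    have "L * ?F x' = (\<Sum>k\<le>r. L * (1 / (\<omega> (x' k) * \<pi> x' k)))" unfolding F\<pi> sum_distrib_left ..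
    also have "\<dots> < (\<Sum>k\<le>r. (-1) ^ (r - k) * poly R (x' k) / \<pi> x' k)"
    proof (rule sum_strict_mono_ex1)
      have eq: "(-1) ^ (r - k) * poly R (x' k) / \<pi> x' k
          = ((-1) ^ (r - k) * (\<omega> (x' k) * poly R (x' k))) * (1 / (\<omega> (x' k) * \<pi> x' k))" if "k \<le> r" for k
        using x' that by (auto simp: nodes_def)
      have p: "1 / (\<omega> (x' k) * \<pi> x' k) > 0" if "k \<le> r" for k
        using \<pi> [OF x' that] x' that by (auto simp: nodes_def)
      have ge: "L \<le> (-1) ^ (r - k) * (\<omega> (x' k) * poly R (x' k))" if "k \<le> r" for k
      proof (cases "k = j")
        case True
        then show ?thesis using gt by (simp add: x'_def)
      next
        case False
        then show ?thesis using vR [OF that] sq by (simp add: x'_def)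
      qed
      show "\<forall>k\<in>{..r}. L * (1 / (\<omega> (x' k) * \<pi> x' k)) \<le> (-1) ^ (r - k) * poly R (x' k) / \<pi> x' k"
      proof
        fix k assume "k \<in> {..r}"
        then have k: "k \<le> r" by simp
        show "L * (1 / (\<omega> (x' k) * \<pi> x' k)) \<le> (-1) ^ (r - k) * poly R (x' k) / \<pi> x' k"
          unfolding eq [OF k] by (rule mult_right_mono [OF ge [OF k] less_imp_le [OF p [OF k]]])
      qed
      have "L * (1 / (\<omega> (x' j) * \<pi> x' j)) < (-1) ^ (r - j) * poly R (x' j) / \<pi> x' j"
        unfolding eq [OF j] by (rule mult_strict_right_mono [OF _ p [OF j]]) (use gt in \<open>simp add: x'_def\<close>)
      then show "\<exists>k\<in>{..r}. L * (1 / (\<omega> (x' k) * \<pi> x' k)) < (-1) ^ (r - k) * poly R (x' k) / \<pi> x' k"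
        using j by blast
    qed simp
    also have "\<dots> = 1" using lead [OF x'] c1 by simp
    finally have "L * ?F x' < 1" .
    moreover have "L * ?F x \<le> L * ?F x'" using opt [OF x'] L by (intro mult_left_mono) auto
    moreover have "L * ?F x = 1" using Fpos by (simp add: L_def)
    ultimately show False by simp
  qed
  have growth: "(z - 1) ^ r \<le> poly R z" if z: "z \<ge> 1" for z
  proof -
    have "(z - 1) ^ r = (\<Sum>j\<le>r. L * (1 / (\<omega> (x j) * \<pi> x j)) * (z - 1) ^ r)"
      unfolding sum_distrib_right [symmetric] sum_distrib_left [symmetric] F\<pi> [symmetric]
      using Fpos by (simp add: L_def)
    also have "\<dots> \<le> (\<Sum>j\<le>r. L * (1 / (\<omega> (x j) * \<pi> x j)) * (\<Prod>k\<in>{..r} - {j}. z - x k))"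
    proof (rule sum_mono)
      fix j assume "j \<in> {..r}"
      then have j: "j \<le> r" by simp
      have "(\<Prod>k\<in>{..r} - {j}. z - 1) \<le> (\<Prod>k\<in>{..r} - {j}. z - x k)"
        by (rule prod_mono) (use z xb in auto)
      then have "(z - 1) ^ r \<le> (\<Prod>k\<in>{..r} - {j}. z - x k)" using j by simp
      then show "L * (1 / (\<omega> (x j) * \<pi> x j)) * (z - 1) ^ r
          \<le> L * (1 / (\<omega> (x j) * \<pi> x j)) * (\<Prod>k\<in>{..r} - {j}. z - x k)"
        using L wp [OF j] \<pi> [OF x j] by (intro mult_left_mono) auto
    qed
    also have "\<dots> = poly R z"
      unfolding lagrange_formulas(2) [OF inj [OF x] R(1), of z]
    proof (rule sum.cong [OF refl])
      fix j assume "j \<in> {..r}"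
      then have j: "j \<le> r" by simp
      show "L * (1 / (\<omega> (x j) * \<pi> x j)) * (\<Prod>k\<in>{..r} - {j}. z - x k)
        = poly R (x j) / (\<Prod>k\<in>{..r} - {j}. x j - x k) * (\<Prod>k\<in>{..r} - {j}. z - x k)"
        unfolding sgn [OF x j] flip trm [OF j] ..
    qed
    finally show ?thesis .
  qed
  show thesis
    by (rule that [OF sm xb dR _ L LM vR ext growth]) (use c1 dR in auto)
qed

section \<open>A totally real solution of the Pell equation\<close>

lemma order_linear: "Polynomial.order a [:-b, 1:] = (if a = b then 1 else 0)" for a b :: "'a::field"
  using order_power_n_n [of b 1] by (auto simp: order_0I)

lemma order_linear_power: "Polynomial.order a ([:-b, 1:] ^ k) = (if a = b then k else 0)" for a b :: "'a::field"
  by (cases "a = b") (auto simp: order_power_n_n intro!: order_0I)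

lemma prod_linear_powers_dvd:
  fixes p :: "'a::field poly"
  assumes "finite S" "p \<noteq> 0" "\<And>a. a \<in> S \<Longrightarrow> k a \<le> Polynomial.order a p"
  shows "(\<Prod>a\<in>S. [:-a, 1:] ^ k a) dvd p"
  using assms
proof (induction S arbitrary: p rule: finite_induct)
  case (insert b S)
  have "[:-b, 1:] ^ k b dvd p" using insert.prems by (simp add: order_divides)
  then obtain q where q: "p = [:-b, 1:] ^ k b * q" by blast
  have q0: "q \<noteq> 0" using q insert.prems by auto
  have "k a \<le> Polynomial.order a q" if "a \<in> S" for a
  proof -
    have "a \<noteq> b" using that insert.hyps by auto
    moreover have "Polynomial.order a p = Polynomial.order a ([:-b, 1:] ^ k b) + Polynomial.order a q"
      unfolding q by (rule order_mult) (use q0 in auto)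
    ultimately show ?thesis using insert.prems(2) [of a] that by (simp add: order_linear_power)
  qed
  then have "(\<Prod>a\<in>S. [:-a, 1:] ^ k a) dvd q" using insert.IH [OF q0] by blast
  then show ?case unfolding q using insert.hyps by (simp add: mult_dvd_mono)
qed simp

lemma double_rootI:
  fixes p :: "real poly"
  assumes "p \<noteq> 0" "poly p a = 0" "poly (pderiv p) a = 0"
  shows "Polynomial.order a p \<ge> 2"
proof -
  obtain q where q: "p = [:-a, 1:] * q" using assms(2) by (metis dvdE poly_eq_0_iff_dvd)
  have "poly (pderiv p) a = poly q a" unfolding q pderiv_mult by (simp add: pderiv_pCons)
  then obtain h where h: "q = [:-a, 1:] * h" using assms(3) by (metis dvdE poly_eq_0_iff_dvd)
  have "p = [:-a, 1:] ^ 2 * h" unfolding q h power2_eq_square by (simp only: mult.assoc)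
  then have "[:-a, 1:] ^ 2 dvd p" by (rule dvdI)
  then show ?thesis using assms(1) order_divides by blast
qed

text \<open>
  \<open>Q\<close> has the roots \<open>M, 2 M, \<dots>, g M\<close>, and \<open>T = Q R / L\<close> with \<open>R\<close> extremal for the weight \<open>\<surd>x\<^sup>\<epsilon> Q\<close> on
  \<open>[0, 1]\<close>. In \<open>\<phi> = x\<^sup>\<epsilon> T\<^sup>2 - 1\<close> an alternation point inside \<open>(0, 1)\<close> is a local maximum with value \<open>0\<close>, hence
  a double root. At \<open>i M\<close> the value of \<open>\<phi>\<close> is \<open>-1\<close>, while for large \<open>M\<close> it is positive half-way
  between these points, so \<open>2 g\<close> further roots \<open>l i < i M < u i\<close> arise. The degree \<open>2 m + \<epsilon>\<close> leaves room for
  so many double roots only if \<open>1\<close> and, for \<open>\<epsilon> = 0\<close>, also \<open>0\<close> are alternation points, and then there are no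
  other roots. The polynomial \<open>B\<close> collects the double roots.
\<close>

lemma totally_real_pell:
  fixes g m \<epsilon> :: nat
  assumes g: "g \<ge> 1" and n: "2 * m + \<epsilon> > 2 * g" and \<epsilon>: "\<epsilon> \<le> 1"
  obtains A B D :: "real poly" and E :: "real set" and c a b :: real
  where "c \<noteq> 0" "finite E" "card E = 2 * g + 2" "0 \<in> E" "D = Polynomial.smult c (\<Prod>e\<in>E. [:-e, 1:])"
    "A ^ 2 - D * B ^ 2 = [:0, 1:] ^ \<epsilon>" "Polynomial.degree A = m + \<epsilon>"
    "0 < a" "a < b" "poly D a = 0" "poly D b = 0" "\<And>x. a < x \<Longrightarrow> x < b \<Longrightarrow> poly D x < 0"
    "\<And>x. a \<le> x \<Longrightarrow> x \<le> b \<Longrightarrow> poly B x > 0" "poly A a > 0" "poly A b < 0"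
proof -
  define r where "r = m - g"
  have m: "m = g + r" using n \<epsilon> by (simp add: r_def)
  have r\<epsilon>: "2 * r + \<epsilon> \<ge> 1" using n m by linarith
  define G :: real where "G = 4 ^ g * fact g ^ 2"
  have G: "G \<ge> 1"
  proof -
    have "(1 :: real) \<le> 4 ^ g" "(1 :: real) \<le> fact g ^ 2" by (simp_all add: fact_ge_1 one_le_power)
    then have "1 * 1 \<le> (4 ^ g * fact g ^ 2 :: real)" by (intro mult_mono) auto
    then show ?thesis by (simp add: G_def)
  qed
  \<comment> \<open>Chosen so that \<open>L\<^sup>2 \<le> (M\<^sup>g g!)\<^sup>2 = (M/2)\<^bsup>2g\<^esup> G\<close> is less than \<open>(M/2)\<^bsup>2g\<^esup> (M/2 - 1)\<close>, which bounds
    \<open>(\<surd>x\<^sup>\<epsilon> Q R)\<^sup>2\<close> from below half-way between the roots of \<open>Q\<close>.\<close>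
  define M where "M = 2 * G + 4"
  have M: "M \<ge> 6" "M / 2 - 1 > G" using G by (simp_all add: M_def add_divide_distrib)
  define Q where "Q = (\<Prod>i\<in>{1..g}. [:M * real i, -1:])"
  have pQ: "poly Q z = (\<Prod>i\<in>{1..g}. M * real i - z)" for z by (simp add: Q_def poly_prod)
  define \<omega> where "\<omega> = (\<lambda>z. sqrt (z ^ \<epsilon>) * poly Q z)"
  have factor: "0 < M * real i - z \<and> M * real i - z \<le> M * real i" if "i \<ge> 1" "0 \<le> z" "z \<le> 1" for i z
  proof -
    have "M * 1 \<le> M * real i" using that M by (intro mult_left_mono) auto
    then show ?thesis using that M by linarith
  qed
  have Qpos: "poly Q z > 0" if "0 \<le> z" "z \<le> 1" for z
    unfolding pQ
  proof (rule prod_pos)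
    fix i assume "i \<in> {1..g}"
    then show "0 < M * real i - z" using factor [of i z] that by simp
  qed
  have Qle: "poly Q z \<le> M ^ g * fact g" if "0 \<le> z" "z \<le> 1" for z
  proof -
    have "poly Q z \<le> (\<Prod>i\<in>{1..g}. M * real i)"
      unfolding pQ
    proof (rule prod_mono)
      fix i assume "i \<in> {1..g}"
      then show "0 \<le> M * real i - z \<and> M * real i - z \<le> M * real i" using factor [of i z] that by simp
    qed
    also have "\<dots> = M ^ g * fact g" by (simp add: prod.distrib fact_prod)
    finally show ?thesis .
  qed
  have cont: "continuous_on {0..1} \<omega>" unfolding \<omega>_def by (intro continuous_intros)
  have sq1: "0 \<le> sqrt (z ^ \<epsilon>) \<and> sqrt (z ^ \<epsilon>) \<le> 1" if "0 \<le> z" "z \<le> 1" for z :: real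
    using that by (simp add: power_le_one)
  obtain x R L where x: "strict_mono_on {..r} x" "\<And>j. j \<le> r \<Longrightarrow> x j \<in> {0..1}"
    and R: "Polynomial.degree R = r" "lead_coeff R = 1" and L: "0 < L" "L \<le> M ^ g * fact g"
    and alt: "\<And>j. j \<le> r \<Longrightarrow> \<omega> (x j) * poly R (x j) = (-1) ^ (r - j) * L"
    and ext: "\<And>j y. j \<le> r \<Longrightarrow> y \<in> {0..1} \<Longrightarrow> (\<And>k. k < j \<Longrightarrow> x k < y) \<Longrightarrow>
       (\<And>k. j < k \<Longrightarrow> k \<le> r \<Longrightarrow> y < x k) \<Longrightarrow> (-1) ^ (r - j) * (\<omega> y * poly R y) \<le> L"
    and growth: "\<And>z. z \<ge> 1 \<Longrightarrow> (z - 1) ^ r \<le> poly R z"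
  proof (rule weighted_chebyshev [OF cont, of "M ^ g * fact g" r])
    show "\<omega> z > 0" if "0 < z" "z \<le> 1" for z using that Qpos [of z] by (simp add: \<omega>_def)
    show "\<omega> z \<ge> 0" if "0 \<le> z" "z \<le> 1" for z using that Qpos [of z] by (simp add: \<omega>_def)
    show "\<omega> z \<le> M ^ g * fact g" if "0 \<le> z" "z \<le> 1" for z
    proof -
      have "\<omega> z \<le> 1 * poly Q z" unfolding \<omega>_def
        by (rule mult_right_mono) (use sq1 [OF that] Qpos [OF that] in auto)
      then show ?thesis using Qle [OF that] by simp
    qed
  qed blast
  define T where "T = Polynomial.smult (1 / L) (Q * R)"
  define \<phi> where "\<phi> = [:0, 1:] ^ \<epsilon> * T ^ 2 - 1"
  define S where "S = (\<lambda>z. sqrt (z ^ \<epsilon>) * poly T z)"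
  have pT: "poly T z = poly Q z * poly R z / L" for z by (simp add: T_def)
  have \<phi>z: "poly \<phi> z = z ^ \<epsilon> * poly T z ^ 2 - 1" for z by (simp add: \<phi>_def)
  have \<phi>S: "poly \<phi> z = S z ^ 2 - 1" if "z \<ge> 0" for z
    using that by (simp add: \<phi>z S_def power_mult_distrib)
  have S\<omega>: "S z = \<omega> z * poly R z / L" for z by (simp add: S_def \<omega>_def pT)
  have Salt: "S (x j) = (-1) ^ (r - j)" if "j \<le> r" for j
    using alt [OF that] L(1) by (simp add: S\<omega>)
  have Sext: "(-1) ^ (r - j) * S y \<le> 1" if "j \<le> r" "y \<in> {0..1}" "\<And>k. k < j \<Longrightarrow> x k < y"
    "\<And>k. j < k \<Longrightarrow> k \<le> r \<Longrightarrow> y < x k" for j y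
    using ext [OF that] L(1) by (simp add: S\<omega>)
  have dQ: "Polynomial.degree Q = g" unfolding Q_def by (subst degree_prod_eq_sum_degree) auto
  have Q0: "Q \<noteq> 0" using Qpos [of 0] by auto
  have R0: "R \<noteq> 0" using R(2) by auto
  have T0: "T \<noteq> 0" using Q0 R0 L(1) by (simp add: T_def)
  have dT: "Polynomial.degree T = m" using Q0 R0 L(1) by (simp add: T_def degree_mult_eq dQ R(1) m)
  have dx: "Polynomial.degree ([:0, 1:] ^ k :: real poly) = k" for k using degree_linear_power [of 0 k] by simp
  have "Polynomial.degree ([:0, 1:] ^ \<epsilon> * T ^ 2) = 2 * m + \<epsilon>"
    using T0 by (simp add: degree_mult_eq degree_power_eq dx dT)
  then have d\<phi>: "Polynomial.degree \<phi> = 2 * m + \<epsilon>"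
    unfolding \<phi>_def using degree_add_eq_left [of "- 1" "[:0, 1:] ^ \<epsilon> * T ^ 2"] n by (simp, linarith)
  then have \<phi>0: "\<phi> \<noteq> 0" using n by auto
  have root_x: "poly \<phi> (x j) = 0" if "j \<le> r" for j
    using \<phi>S [of "x j"] x(2) [OF that] Salt [OF that] by (simp add: power_mult [symmetric])
  have double: "Polynomial.order (x j) \<phi> \<ge> 2" if j: "j \<le> r" and "x j \<noteq> 0" "x j \<noteq> 1" for j
  proof (rule double_rootI [OF \<phi>0 root_x [OF j]])
    have in01: "0 < x j" "x j < 1" using x(2) [OF j] that by auto
    \<comment> \<open>Extremality bounds \<open>h\<close> only from above; near the node \<open>h\<close> is positive, so \<open>h\<^sup>2 \<le> 1\<close> as well.\<close>
    define h where "h = (\<lambda>y. (-1) ^ (r - j) * S y)"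
    have "isCont h (x j)" unfolding h_def S_def by (intro continuous_intros)
    then have h: "(h \<longlongrightarrow> 1) (at (x j))"
      using Salt [OF j] by (simp add: isCont_def h_def power_mult_distrib [symmetric])
    have "eventually (\<lambda>y. \<forall>k\<in>{..<j}. x k < y) (at (x j))"
      using j strict_mono_onD [OF x(1)]
      by (intro eventually_ball_finite ballI order_tendstoD(1) [OF tendsto_ident_at]) auto
    moreover have "eventually (\<lambda>y. \<forall>k\<in>{j<..r}. y < x k) (at (x j))"
      using j strict_mono_onD [OF x(1)]
      by (intro eventually_ball_finite ballI order_tendstoD(2) [OF tendsto_ident_at]) auto
    moreover have "eventually (\<lambda>y. 0 < h y) (at (x j))" by (rule order_tendstoD(1) [OF h]) simp
    moreover have "eventually (\<lambda>y. 0 < y) (at (x j))"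
      by (rule order_tendstoD(1) [OF tendsto_ident_at in01(1)])
    moreover have "eventually (\<lambda>y. y < 1) (at (x j))"
      by (rule order_tendstoD(2) [OF tendsto_ident_at in01(2)])
    ultimately have "eventually (\<lambda>y. poly \<phi> y \<le> poly \<phi> (x j)) (at (x j))"
    proof eventually_elim
      case (elim y)
      have "h y \<le> 1" unfolding h_def by (rule Sext [OF j]) (use elim in auto)
      then have "h y ^ 2 \<le> 1" using elim by (simp add: power_le_one)
      then have "S y ^ 2 \<le> 1" by (simp add: h_def power_mult_distrib power_mult [symmetric])
      then show ?case using \<phi>S [of y] elim root_x [OF j] by simp
    qed
    then obtain d where d: "d > 0" "\<And>y. y \<noteq> x j \<Longrightarrow> dist y (x j) < d \<Longrightarrow> poly \<phi> y \<le> poly \<phi> (x j)"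
      unfolding eventually_at by auto
    show "poly (pderiv \<phi>) (x j) = 0"
    proof (rule DERIV_local_max [OF poly_DERIV d(1)], intro allI impI)
      fix y assume "\<bar>x j - y\<bar> < d"
      then show "poly \<phi> y \<le> poly \<phi> (x j)"
        using d(2) [of y] by (cases "y = x j") (auto simp: dist_real_def abs_minus_commute)
    qed
  qed
  have big: "poly \<phi> (M * (real d + 1 / 2)) > 0" for d :: nat
  proof -
    define z where "z = M * (real d + 1 / 2)"
    have zM: "z \<ge> M / 2" using M by (simp add: z_def algebra_simps)
    have z: "z - 1 \<ge> 1" using zM M by simp
    have "(M / 2) ^ g = (\<Prod>i\<in>{1..g}. M / 2)" by simp
    also have "\<dots> \<le> (\<Prod>i\<in>{1..g}. \<bar>M * real i - z\<bar>)"
    proof (rule prod_mono)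
      fix i assume "i \<in> {1..g}"
      have "1 \<le> \<bar>2 * (int i - int d) - 1\<bar>" by presburger
      then have "real_of_int 1 \<le> real_of_int \<bar>2 * (int i - int d) - 1\<bar>" by (simp only: of_int_le_iff)
      then have "\<bar>real_of_int (2 * (int i - int d) - 1)\<bar> \<ge> 1" by (simp only: of_int_abs of_int_1)
      then have "M / 2 * 1 \<le> M / 2 * \<bar>real_of_int (2 * (int i - int d) - 1)\<bar>"
        using M by (intro mult_left_mono) auto
      also have "\<dots> = \<bar>M / 2 * real_of_int (2 * (int i - int d) - 1)\<bar>" using M by (simp add: abs_mult)
      also have "M / 2 * real_of_int (2 * (int i - int d) - 1) = M * real i - z"
        by (simp add: z_def algebra_simps)
      finally show "0 \<le> M / 2 \<and> M / 2 \<le> \<bar>M * real i - z\<bar>" using M by simp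
    qed
    also have "\<dots> = \<bar>poly Q z\<bar>" unfolding pQ by (rule abs_prod [symmetric])
    finally have Qz: "((M / 2) ^ g) ^ 2 \<le> poly Q z ^ 2"
      using M power_mono [of "(M / 2) ^ g" "\<bar>poly Q z\<bar>" 2] by simp
    have "z - 1 = (z - 1) ^ 1" by simp
    also have "\<dots> \<le> (z - 1) ^ (2 * r + \<epsilon>)" using z r\<epsilon> by (intro power_increasing) auto
    also have "\<dots> = (z - 1) ^ \<epsilon> * ((z - 1) ^ r) ^ 2"
      by (simp add: power_add power_mult [symmetric] mult.commute)
    also have "\<dots> \<le> z ^ \<epsilon> * poly R z ^ 2"
      using growth [of z] z by (intro mult_mono power_mono) auto
    finally have Rz: "M / 2 - 1 \<le> z ^ \<epsilon> * poly R z ^ 2" using zM by linarith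
    have "L ^ 2 \<le> (M ^ g * fact g) ^ 2" using L by (intro power_mono) auto
    also have "\<dots> = ((M / 2) ^ g) ^ 2 * G"
    proof -
      have "M ^ g = (M / 2) ^ g * 2 ^ g" by (simp add: power_mult_distrib [symmetric])
      moreover have "((2 :: real) ^ g) ^ 2 = (2 ^ 2) ^ g" by (simp only: power_mult [symmetric] mult.commute)
      ultimately show ?thesis by (simp add: G_def power_mult_distrib)
    qed
    also have "\<dots> < ((M / 2) ^ g) ^ 2 * (M / 2 - 1)"
      using M by (intro mult_strict_left_mono) auto
    also have "\<dots> \<le> poly Q z ^ 2 * (z ^ \<epsilon> * poly R z ^ 2)"
      using Qz Rz M by (intro mult_mono) auto
    finally have "1 < poly Q z ^ 2 * (z ^ \<epsilon> * poly R z ^ 2) / L ^ 2" using L by simp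
    then show ?thesis unfolding z_def [symmetric] \<phi>z pT by (simp add: power_divide power_mult_distrib algebra_simps)
  qed
  have neg: "poly \<phi> (M * real i) = - 1" if "i \<in> {1..g}" for i
  proof -
    have "poly Q (M * real i) = 0" unfolding pQ by (rule prod_zero) (use that in \<open>auto intro!: bexI [of _ i]\<close>)
    then show ?thesis by (simp add: \<phi>z pT)
  qed
  have "\<exists>y. M * (real i - 1 / 2) < y \<and> y < M * real i \<and> poly \<phi> y = 0" if i: "i \<in> {1..g}" for i
  proof -
    have e: "M * (real (i - 1) + 1 / 2) = M * (real i - 1 / 2)" using i by (simp add: of_nat_diff)
    have "poly \<phi> (M * (real i - 1 / 2)) > 0" using big [of "i - 1"] by (simp only: e)
    then show ?thesis
      using poly_IVT_neg [of "M * (real i - 1 / 2)" "M * real i" \<phi>] neg [OF i] M by auto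
  qed
  then obtain l where l: "\<And>i. i \<in> {1..g} \<Longrightarrow> M * (real i - 1 / 2) < l i \<and> l i < M * real i \<and> poly \<phi> (l i) = 0"
    by metis
  have "\<exists>y. M * real i < y \<and> y < M * (real i + 1 / 2) \<and> poly \<phi> y = 0" if i: "i \<in> {1..g}" for i
    using poly_IVT_pos [of "M * real i" "M * (real i + 1 / 2)" \<phi>] neg [OF i] big [of i] M by auto
  then obtain u where u: "\<And>i. i \<in> {1..g} \<Longrightarrow> M * real i < u i \<and> u i < M * (real i + 1 / 2) \<and> poly \<phi> (u i) = 0"
    by metis
  have sep: "M * (real i + 1 / 2) \<le> M * (real k - 1 / 2)" if "i < k" for i k :: nat
    using that M by (intro mult_left_mono) auto
  define E0 where "E0 = l ` {1..g} \<union> u ` {1..g}"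
  have linj: "l i < l k" "u i < l k" "u i < u k" if "i < k" "i \<in> {1..g}" "k \<in> {1..g}" for i k
    using sep [OF that(1)] l [OF that(2)] l [OF that(3)] u [OF that(2)] u [OF that(3)] by linarith+
  have lu: "l i < u i" if "i \<in> {1..g}" for i using l [OF that] u [OF that] by linarith
  have "inj_on l {1..g}"
  proof (rule linorder_inj_onI)
    show "l i \<noteq> l k" if "i < k" "i \<in> {1..g}" "k \<in> {1..g}" for i k using linj(1) [OF that] by simp
  qed auto
  moreover have "inj_on u {1..g}"
  proof (rule linorder_inj_onI)
    show "u i \<noteq> u k" if "i < k" "i \<in> {1..g}" "k \<in> {1..g}" for i k using linj(3) [OF that] by simp
  qed auto
  moreover have "l ` {1..g} \<inter> u ` {1..g} = {}"
  proof -
    have "l i \<noteq> u k" if "i \<in> {1..g}" "k \<in> {1..g}" for i k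
    proof -
      consider "i < k" | "i = k" | "k < i" by linarith
      then show ?thesis
      proof cases
        case 1
        then show ?thesis using linj(1) [OF 1 that] lu [OF that(2)] by linarith
      next
        case 2
        then show ?thesis using lu [OF that(1)] by simp
      next
        case 3
        then show ?thesis using linj(2) [OF 3 that(2,1)] by simp
      qed
    qed
    then show ?thesis by blast
  qed
  ultimately have cE0: "card E0 = 2 * g" unfolding E0_def by (simp add: card_Un_disjoint card_image)
  have finE0: "finite E0" by (simp add: E0_def)
  have E0big: "e > M / 2" if e: "e \<in> E0" for e
  proof -
    obtain i where i: "i \<in> {1..g}" "e = l i \<or> e = u i" using e unfolding E0_def Un_iff image_iff by blast
    have "M * (1 / 2) \<le> M * (real i - 1 / 2)" using i(1) M by (intro mult_left_mono) auto
    then have "M / 2 < l i" using l [OF i(1)] by linarith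
    then show ?thesis using i(2) lu [OF i(1)] by linarith
  qed
  have E0root: "poly \<phi> e = 0" if "e \<in> E0" for e using that l u by (auto simp: E0_def)
  define E1 where "E1 = x ` {..r} \<inter> {0, 1}"
  define J where "J = x ` {..r} - {0, 1}"
  have fin: "finite E1" "finite J" by (simp_all add: E1_def J_def)
  have cJ: "card J + card E1 = r + 1"
  proof -
    have "card (x ` {..r}) = r + 1" using strict_mono_on_imp_inj_on [OF x(1)] by (simp add: card_image)
    moreover have "x ` {..r} = J \<union> E1" "J \<inter> E1 = {}" by (auto simp: E1_def J_def)
    ultimately show ?thesis using fin by (metis card_Un_disjoint)
  qed
  have le1: "e \<le> 1" if "e \<in> J \<union> E1" for e using that x(2) by (auto simp: J_def E1_def)
  have "e \<notin> E0" if "e \<in> J \<union> E1" for e using le1 [OF that] E0big [of e] M by linarith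
  then have disj: "J \<inter> E1 = {}" "J \<inter> E0 = {}" "E1 \<inter> E0 = {}" by (auto simp: J_def E1_def)
  define k where "k = (\<lambda>e. if e \<in> J then 2 else 1 :: nat)"
  define P where "P = J \<union> (E1 \<union> E0)"
  have finP: "finite P" using fin finE0 by (simp add: P_def)
  have Proot: "poly \<phi> e = 0" if "e \<in> P" for e
    using that root_x E0root by (auto simp: P_def J_def E1_def)
  have kle: "k e \<le> Polynomial.order e \<phi>" if "e \<in> P" for e
  proof (cases "e \<in> J")
    case True
    then show ?thesis using double by (auto simp: k_def J_def)
  next
    case False
    then show ?thesis using Proot [OF that] \<phi>0 by (simp add: k_def order_root Suc_le_eq)
  qed
  have "(\<Sum>e\<in>P. k e) = (\<Sum>e\<in>J. k e) + ((\<Sum>e\<in>E1. k e) + (\<Sum>e\<in>E0. k e))"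
    unfolding P_def using fin finE0 disj by (simp add: sum.union_disjoint Int_Un_distrib)
  also have "(\<Sum>e\<in>J. k e) = 2 * card J" by (simp add: k_def)
  also have "(\<Sum>e\<in>E1. k e) = (\<Sum>e\<in>E1. 1)" by (rule sum.cong) (use disj in \<open>auto simp: k_def\<close>)
  also have "(\<Sum>e\<in>E0. k e) = (\<Sum>e\<in>E0. 1)" by (rule sum.cong) (use disj in \<open>auto simp: k_def\<close>)
  finally have sumk: "(\<Sum>e\<in>P. k e) = 2 * card J + (card E1 + 2 * g)" using cE0 by simp
  have dvd: "(\<Prod>e\<in>P. [:-e, 1:] ^ k e) dvd \<phi>"
    by (rule prod_linear_powers_dvd [OF finP \<phi>0 kle])
  have dprod: "Polynomial.degree (\<Prod>e\<in>P. [:-e, 1:] ^ k e) = (\<Sum>e\<in>P. k e)"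
    by (subst degree_prod_eq_sum_degree) (auto simp: degree_linear_power)
  have "(\<Sum>e\<in>P. k e) \<le> 2 * m + \<epsilon>" using dvd_imp_degree_le [OF dvd \<phi>0] dprod d\<phi> by simp
  then have cE1: "card E1 + \<epsilon> \<ge> 2" using sumk cJ m by linarith
  have zero: "0 \<notin> E1" if "\<epsilon> = 1"
  proof
    assume "0 \<in> E1"
    then have "poly \<phi> 0 = 0" using Proot by (simp add: P_def)
    then show False using that by (simp add: \<phi>z)
  qed
  have E1: "E1 \<union> (if \<epsilon> = 1 then {0} else {}) = {0, 1}" "card E1 + \<epsilon> = 2"
  proof -
    have sub: "E1 \<subseteq> {0, 1}" by (simp add: E1_def)
    have "E1 \<union> (if \<epsilon> = 1 then {0} else {}) = {0, 1} \<and> card E1 + \<epsilon> = 2"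
    proof (cases "\<epsilon> = 1")
      case True
      then have "E1 \<subseteq> {1}" using zero sub by auto
      moreover have "E1 \<noteq> {}" using cE1 True by auto
      ultimately have "E1 = {1}" by auto
      then show ?thesis using True by auto
    next
      case False
      then have "\<epsilon> = 0" using \<epsilon> by simp
      then have "card {0, 1 :: real} \<le> card E1" using cE1 by simp
      then have "E1 = {0, 1}" using sub by (intro card_seteq) auto
      then show ?thesis using \<open>\<epsilon> = 0\<close> by simp
    qed
    then show "E1 \<union> (if \<epsilon> = 1 then {0} else {}) = {0, 1}" "card E1 + \<epsilon> = 2" by auto
  qed
  have "(\<Sum>e\<in>P. k e) = 2 * m + \<epsilon>" using sumk cJ E1(2) m by linarith
  then obtain c where c: "\<phi> = Polynomial.smult c (\<Prod>e\<in>P. [:-e, 1:] ^ k e)"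
  proof -
    obtain q where q: "\<phi> = (\<Prod>e\<in>P. [:-e, 1:] ^ k e) * q" using dvd by blast
    have "q \<noteq> 0" "(\<Prod>e\<in>P. [:-e, 1:] ^ k e) \<noteq> 0" using q \<phi>0 by auto
    then have "Polynomial.degree q = 0"
      using arg_cong [OF q, of Polynomial.degree] dprod d\<phi> \<open>(\<Sum>e\<in>P. k e) = 2 * m + \<epsilon>\<close>
      by (simp add: degree_mult_eq)
    then obtain c where "q = [:c:]" by (metis degree_eq_zeroE)
    then have "\<phi> = Polynomial.smult c (\<Prod>e\<in>P. [:-e, 1:] ^ k e)" unfolding q by (simp add: mult.commute)
    then show thesis by (rule that)
  qed
  have c0: "c \<noteq> 0" using c \<phi>0 by auto
  define E where "E = {0, 1} \<union> E0"
  define B where "B = (\<Prod>e\<in>J. [:-e, 1:])"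
  define D where "D = Polynomial.smult c (\<Prod>e\<in>E. [:-e, 1:])"
  define A where "A = [:0, 1:] ^ \<epsilon> * T"
  have finE: "finite E" using finE0 by (simp add: E_def)
  have E0ge: "0 \<notin> E0" "1 \<notin> E0" using E0big [of 0] E0big [of 1] M by auto
  have cE: "card E = 2 * g + 2" unfolding E_def using finE0 cE0 E0ge by (simp add: card_insert_if)
  have "(\<Prod>e\<in>P. [:-e, 1:] ^ k e) = (\<Prod>e\<in>J. [:-e, 1:] ^ k e) * (\<Prod>e\<in>E1 \<union> E0. [:-e, 1:] ^ k e)"
    unfolding P_def using fin finE0 disj by (intro prod.union_disjoint) auto
  also have "(\<Prod>e\<in>J. [:-e, 1:] ^ k e) = B ^ 2"
    unfolding B_def prod_power_distrib by (rule prod.cong) (auto simp: k_def)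
  also have "(\<Prod>e\<in>E1 \<union> E0. [:-e, 1:] ^ k e) = (\<Prod>e\<in>E1 \<union> E0. [:-e, 1:])"
    by (rule prod.cong) (use disj in \<open>auto simp: k_def\<close>)
  finally have fac: "\<phi> = Polynomial.smult c (B ^ 2 * (\<Prod>e\<in>E1 \<union> E0. [:-e, 1:]))" using c by simp
  have "(\<Prod>e\<in>E. [:-e, 1:]) = [:0, 1:] ^ \<epsilon> * (\<Prod>e\<in>E1 \<union> E0. [:-e, 1:])"
  proof (cases "\<epsilon> = 1")
    case True
    then have "E = insert 0 (E1 \<union> E0)" "0 \<notin> E1 \<union> E0" using E1(1) zero E0ge by (auto simp: E_def)
    then show ?thesis using True fin finE0 by simp
  next
    case False
    then have "E = E1 \<union> E0" "\<epsilon> = 0" using E1(1) \<epsilon> by (auto simp: E_def)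
    then show ?thesis by simp
  qed
  then have key: "D * B ^ 2 = [:0, 1:] ^ \<epsilon> * \<phi>" unfolding fac D_def by (simp add: mult_ac)
  have pell: "A ^ 2 - D * B ^ 2 = [:0, 1:] ^ \<epsilon>"
    unfolding key A_def \<phi>_def by (simp add: power2_eq_square algebra_simps)
  have dA: "Polynomial.degree A = m + \<epsilon>" using T0 by (simp add: A_def degree_mult_eq dx dT)
  have i1: "1 \<in> {1..g}" using g by simp
  have ab: "M / 2 < l 1" "l 1 < M" "M < u 1" "u 1 < 3 / 2 * M" using l [OF i1] u [OF i1] by (simp_all add: algebra_simps)
  have Bpos: "poly B z > 0" if "l 1 \<le> z" for z
    unfolding B_def poly_prod
  proof (rule prod_pos)
    fix e assume "e \<in> J"
    then have "e \<le> 1" using le1 by blast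
    then show "0 < poly [:-e, 1:] z" using ab M that by simp
  qed
  have noroot: "poly \<phi> z \<noteq> 0" if z: "l 1 < z" "z < u 1" for z
  proof
    assume "poly \<phi> z = 0"
    then have "(\<Prod>e\<in>P. (z - e) ^ k e) = 0" using c0 unfolding c by (simp add: poly_prod)
    then have "z \<in> P" using finP by (auto simp: k_def)
    then have "z \<in> E0" using le1 [of z] ab M z by (auto simp: P_def)
    then obtain i where i: "i \<in> {1..g}" "z = l i \<or> z = u i"
      unfolding E0_def Un_iff image_iff by blast
    then have "1 < i" using z by (cases "i = 1") auto
    then show False using linj(2) [OF _ i1 i(1)] lu [OF i(1)] i(2) z by auto
  qed
  have Dneg: "poly D z < 0" if z: "l 1 < z" "z < u 1" for z
  proof -
    have "poly \<phi> z < 0"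
    proof (rule ccontr)
      assume "\<not> poly \<phi> z < 0"
      then have pos: "poly \<phi> z > 0" using noroot [OF z] by linarith
      have negM: "poly \<phi> M < 0" using neg [OF i1] by simp
      then have "z \<noteq> M" using pos by auto
      then consider "z < M" | "M < z" by linarith
      then show False
      proof cases
        case 1
        then obtain y where "z < y" "y < M" "poly \<phi> y = 0" using poly_IVT_neg [OF 1 pos negM] by blast
        then show False using noroot [of y] z ab by linarith
      next
        case 2
        then obtain y where "M < y" "y < z" "poly \<phi> y = 0" using poly_IVT_pos [OF 2 negM pos] by blast
        then show False using noroot [of y] z ab by linarith
      qed
    qed
    moreover have "poly D z * poly B z ^ 2 = z ^ \<epsilon> * poly \<phi> z"
      using arg_cong [OF key, of "\<lambda>p. poly p z"] by simp
    moreover have "z ^ \<epsilon> > 0" using z ab M by simp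
    ultimately have "poly D z * poly B z ^ 2 < 0" by (simp add: mult_pos_neg)
    then show ?thesis by (simp add: mult_less_0_iff)
  qed
  have DE: "poly D e = 0" if "e \<in> E" for e
    unfolding D_def using that finE by (auto simp: poly_prod)
  have Tsgn: "sgn (poly A z) = sgn (poly Q z)" if "z \<ge> M / 2" for z
  proof -
    have "z - 1 > 0" using that M by simp
    then have "poly R z > 0" using growth [of z] by (smt (verit) zero_less_power)
    then show ?thesis using \<open>z - 1 > 0\<close> L(1) by (simp add: A_def pT sgn_mult sgn_divide)
  qed
  have mono: "M * 1 \<le> M * real i" if "i \<in> {1..g}" for i using that M by (intro mult_left_mono) auto
  have Qa: "poly Q (l 1) > 0"
    unfolding pQ
  proof (rule prod_pos)
    fix i assume "i \<in> {1..g}"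
    then show "0 < M * real i - l 1" using mono [of i] ab by linarith
  qed
  have Qb: "poly Q (u 1) < 0"
  proof -
    have "poly Q (u 1) = (M - u 1) * (\<Prod>i\<in>{1..g} - {1}. M * real i - u 1)"
      unfolding pQ using i1 by (subst prod.remove [of _ 1]) auto
    moreover have "(\<Prod>i\<in>{1..g} - {1}. M * real i - u 1) > 0"
    proof (rule prod_pos)
      fix i assume "i \<in> {1..g} - {1}"
      then have "M * 2 \<le> M * real i" using M by (intro mult_left_mono) auto
      then show "M * real i - u 1 > 0" using ab M by linarith
    qed
    ultimately show ?thesis using ab by (simp add: mult_neg_pos)
  qed
  show thesis
  proof (rule that [OF c0 finE cE _ D_def pell dA, of "l 1" "u 1"])
    show "0 \<in> E" by (simp add: E_def)
    show "0 < l 1" "l 1 < u 1" using ab M by linarith+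
    show "poly D (l 1) = 0" "poly D (u 1) = 0" by (rule DE, use i1 in \<open>auto simp: E_def E0_def\<close>)+
    show "poly A (l 1) > 0" using Tsgn [of "l 1"] Qa ab by (metis less_imp_le sgn_greater)
    show "poly A (u 1) < 0" using Tsgn [of "u 1"] Qb ab M by (smt (verit) sgn_less field_sum_of_halves)
  qed (use Dneg Bpos in auto)
qed

section \<open>Primitivity\<close>

context hyperelliptic begin

definition value_at :: "complex poly \<times> complex poly \<times> complex poly \<Rightarrow> complex \<Rightarrow> complex \<Rightarrow> complex" where
  "value_at f x y = (case f of (A, B, H) \<Rightarrow> (poly A x + poly B x * y) / poly H x)"

lemma pullback_const: "function_pullback f (fls_const x) (fls_const y) = fls_const (value_at f x y)"
  by (simp add: function_pullback_def value_at_def fls_plus_const fls_const_divide_const split: prod.splits)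

lemma value_power:
  assumes "y ^ 2 = poly D x"
  shows "value_at (fun_power f k) x y = value_at f x y ^ k"
proof -
  have "fls_const y ^ 2 = fls_eval_poly D (fls_const x)" using assms by (simp add: fls_const_power [symmetric])
  from pullback_power [OF this, of f k] show ?thesis
    unfolding pullback_const fls_const_power [symmetric] by (metis fls_const_nth)
qed

lemma value_nonzero_iff:
  "value_at (A, B, H) x y \<noteq> 0 \<longleftrightarrow> poly H x \<noteq> 0 \<and> poly A x + poly B x * y \<noteq> 0"
  by (auto simp: value_at_def)

text \<open>
  The quotient \<open>f\<^sup>k / h\<^sup>n\<close> has trivial divisor and is thus a constant. Evaluation at \<open>(x, y)\<close> is the pullback
  along the constant series, which makes it multiplicative; the conditions on \<open>h\<close> at \<open>(x, \<plusminus>y)\<close> keep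
  the denominator of \<open>1 / h\<^sup>n\<close>, which is the norm \<open>A\<^sup>2 - D B\<^sup>2\<close>, from vanishing.
\<close>

lemma proportional_orders:
  assumes f: "f \<in> nonzero_functions" and h: "h \<in> nonzero_functions"
    and ord: "\<And>P. P \<in> curve_points D \<Longrightarrow> int k * order_at D P f = int n * order_at D P h"
  obtains c where "c \<noteq> 0"
    "\<And>x y. y ^ 2 = poly D x \<Longrightarrow> value_at f x y \<noteq> 0 \<Longrightarrow> value_at h x y \<noteq> 0 \<Longrightarrow> value_at h x (- y) \<noteq> 0 \<Longrightarrow>
       value_at f x y ^ k = c * value_at h x y ^ n"
proof -
  define F where "F = fun_mult (fun_power f k) (fun_inverse (fun_power h n))"
  have F: "F \<in> nonzero_functions"
    unfolding F_def by (intro fun_mult_nonzero fun_inverse_nonzero fun_power_nonzero f h)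
  have "order_at D P F = 0" if P: "P \<in> curve_points D" for P
    unfolding F_def using ord [OF P] f h
    by (simp add: order_mult_functions [OF P] order_inverse_function [OF P] order_power_function [OF P]
        fun_inverse_nonzero fun_power_nonzero)
  moreover obtain A B H where ABH: "F = (A, B, H)" by (metis prod_cases3)
  ultimately obtain c where c: "c \<noteq> 0" "A = Polynomial.smult c H" "B = 0"
    using trivial_divisor [of A B H] F by (metis order_refl)
  obtain A1 B1 H1 where 1: "fun_power f k = (A1, B1, H1)" by (metis prod_cases3)
  obtain A2 B2 H2 where 2: "fun_power h n = (A2, B2, H2)" by (metis prod_cases3)
  have H: "H = H1 * (A2 ^ 2 - D * B2 ^ 2)"
    using ABH unfolding F_def 1 2 by (simp add: fun_mult_def fun_inverse_def)
  have "value_at f x y ^ k = c * value_at h x y ^ n"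
    if y: "y ^ 2 = poly D x" and nz: "value_at f x y \<noteq> 0" "value_at h x y \<noteq> 0" "value_at h x (- y) \<noteq> 0" for x y
  proof -
    let ?X = "fls_const x" and ?Y = "fls_const y"
    have eq: "?Y ^ 2 = fls_eval_poly D ?X" using y by (simp add: fls_const_power [symmetric])
    have y': "(- y) ^ 2 = poly D x" using y by simp
    have "poly H1 x \<noteq> 0" using value_power [OF y, of f k] nz(1) value_nonzero_iff [of A1 B1 H1 x y] by (simp add: 1)
    moreover have "poly A2 x + poly B2 x * y \<noteq> 0"
      using value_power [OF y, of h n] nz(2) value_nonzero_iff [of A2 B2 H2 x y] by (simp add: 2)
    moreover have "poly A2 x - poly B2 x * y \<noteq> 0"
      using value_power [OF y', of h n] nz(3) value_nonzero_iff [of A2 B2 H2 x "- y"] by (simp add: 2)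
    moreover have "poly (A2 ^ 2 - D * B2 ^ 2) x = (poly A2 x + poly B2 x * y) * (poly A2 x - poly B2 x * y)"
      using y by (simp add: power2_eq_square algebra_simps)
    ultimately have N: "poly (A2 ^ 2 - D * B2 ^ 2) x \<noteq> 0" and Hx: "poly H x \<noteq> 0" unfolding H by simp_all
    have "value_at F x y = c" unfolding ABH value_at_def using c Hx by simp
    have "fls_const (value_at F x y) = function_pullback F ?X ?Y" by (simp add: pullback_const)
    also have "\<dots> = function_pullback (fun_power f k) ?X ?Y * function_pullback (fun_inverse (fun_power h n)) ?X ?Y"
      unfolding F_def by (rule pullback_mult [OF eq])
    also have "function_pullback (fun_inverse (fun_power h n)) ?X ?Y = inverse (function_pullback (fun_power h n) ?X ?Y)"
      unfolding 2 by (rule pullback_inverse [OF eq]) (unfold fls_eval_poly_const, use N in simp)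
    finally have "fls_const c = fls_const (value_at f x y ^ k * inverse (value_at h x y ^ n))"
      unfolding \<open>value_at F x y = c\<close> pullback_const value_power [OF y]
      by (simp only: fls_inverse_const fls_const_mult_const)
    then have "c = value_at f x y ^ k * inverse (value_at h x y ^ n)" by (metis fls_const_nth)
    then show ?thesis using nz(2) by simp
  qed
  with c(1) show thesis by (rule that)
qed

lemma order_zero_value:
  assumes f: "(A, B, H) \<in> nonzero_functions" and y: "y ^ 2 = poly D x" and H: "poly H x \<noteq> 0"
    and ord: "order_at D (Affine x y) (A, B, H) = 0"
  shows "value_at (A, B, H) x y \<noteq> 0"
proof -
  have P: "Affine x y \<in> curve_points D" using y by (auto simp: curve_points_def)
  obtain X Y where par: "local_parametrization D (Affine x y) X Y"
    and ord': "\<And>f. order_at D (Affine x y) f = fls_subdegree (function_pullback f X Y)"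
    using order_at_param [OF P] by blast
  note af = at_affine [OF par]
  have "fls_subdegree (fls_eval_poly H X) = 0"
    using specializes_nonzero(2) [OF specializes_eval_poly [OF af(2)] H] .
  then have sd: "fls_subdegree (fls_eval_poly A X + fls_eval_poly B X * Y) = 0"
    using ord unfolding ord' pullback_eq_quotient [OF par P f] by simp
  have sp: "specializes (fls_eval_poly A X + fls_eval_poly B X * Y) (poly A x + poly B x * y)"
    by (intro specializes_add specializes_mult specializes_eval_poly af)
  have "poly A x + poly B x * y \<noteq> 0"
  proof
    assume "poly A x + poly B x * y = 0"
    moreover have "fls_eval_poly A X + fls_eval_poly B X * Y \<noteq> 0"
      using eval_function_nonzero [OF par P] f by (auto simp: nonzero_functions_def)
    ultimately show False using specializes_0_subdegree sp sd by fastforce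
  qed
  then show ?thesis using H by (simp add: value_at_def)
qed

end

definition complexify :: "real poly \<Rightarrow> complex poly" where
  "complexify p = map_poly of_real p"

lemma complexify_0 [simp]: "complexify 0 = 0"
  by (simp add: complexify_def)

lemma complexify_pCons [simp]: "complexify (pCons a p) = pCons (of_real a) (complexify p)"
  by (simp add: complexify_def map_poly_pCons)

lemma complexify_1 [simp]: "complexify 1 = 1"
  by (simp add: complexify_def)

lemma complexify_add [simp]: "complexify (p + q) = complexify p + complexify q"
  by (induction p q rule: poly_induct2) simp_all

lemma complexify_smult [simp]: "complexify (Polynomial.smult c p) = Polynomial.smult (of_real c) (complexify p)"
  by (induction p) simp_all

lemma complexify_minus [simp]: "complexify (- p) = - complexify p"
  by (induction p) simp_all

lemma complexify_diff [simp]: "complexify (p - q) = complexify p - complexify q"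
  using complexify_add [of p "- q"] by simp

lemma complexify_mult [simp]: "complexify (p * q) = complexify p * complexify q"
  by (induction p) (simp_all add: mult_pCons_left)

lemma complexify_power [simp]: "complexify (p ^ k) = complexify p ^ k"
  by (induction k) simp_all

lemma complexify_prod: "complexify (\<Prod>e\<in>E. f e) = (\<Prod>e\<in>E. complexify (f e))"
  by (induction E rule: infinite_finite_induct) simp_all

lemma poly_complexify [simp]: "poly (complexify p) (of_real x) = of_real (poly p x)"
  by (induction p) simp_all

lemma degree_complexify [simp]: "Polynomial.degree (complexify p) = Polynomial.degree p"
  by (simp add: complexify_def degree_map_poly)

lemma order_prod_linear:
  fixes a :: complex
  assumes "finite E"
  shows "Polynomial.order a (\<Prod>e\<in>E. [:-e, 1:]) = (if a \<in> E then 1 else 0)"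
  using assms
proof (induction E rule: finite_induct)
  case (insert b E)
  have nz: "(\<Prod>e\<in>E. [:-e, 1:]) \<noteq> 0" using insert.hyps by (simp add: prod_zero_iff)
  have "[:-b, 1:] * (\<Prod>e\<in>E. [:-e, 1:]) \<noteq> 0" using nz by (simp del: mult_pCons_left)
  from order_mult [OF this, of a] show ?case
    using insert by (auto simp: order_linear simp del: mult_pCons_left)
qed simp

lemma totally_real_complexify:
  fixes E :: "real set"
  assumes "c \<noteq> 0" "finite E" "card E = 2 * g + 2" "D = Polynomial.smult c (\<Prod>e\<in>E. [:-e, 1:])"
  shows "totally_real_hyperelliptic g (complexify D)"
proof -
  let ?p = "\<Prod>e\<in>of_real ` E. [:-e, 1:] :: complex poly"
  have "complexify D = Polynomial.smult (of_real c) (\<Prod>e\<in>E. [:- of_real e, 1:])"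
    by (simp add: assms(4) complexify_prod)
  also have "(\<Prod>e\<in>E. [:- of_real e, 1:]) = ?p" by (subst prod.reindex) (auto simp: inj_on_def)
  finally have D: "complexify D = Polynomial.smult (of_real c) ?p" .
  have fin: "finite (of_real ` E :: complex set)" using assms(2) by simp
  have p0: "?p \<noteq> 0" using fin by (simp add: prod_zero_iff)
  have ord: "Polynomial.order a (complexify D) = (if a \<in> of_real ` E then 1 else 0)" for a
    unfolding D using assms(1) by (simp add: order_smult order_prod_linear [OF fin])
  have nz: "complexify D \<noteq> 0" unfolding D using p0 assms(1) by simp
  have "Polynomial.degree D = card E"
    unfolding assms(4) using assms(1) by (simp add: degree_prod_eq_sum_degree)
  moreover have "e \<in> \<real>" if "poly (complexify D) e = 0" for e
  proof -
    have "Polynomial.order e (complexify D) \<noteq> 0" using that nz by (simp add: order_root)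
    then show ?thesis unfolding ord by (auto split: if_splits)
  qed
  ultimately show ?thesis
    unfolding totally_real_hyperelliptic_def rsquarefree_def using nz ord assms(3) by simp
qed

text \<open>
  On the band, \<open>A + B y = \<surd>x\<^sup>\<epsilon> exp (i \<theta>)\<close> with \<open>\<theta>\<close> continuous from \<open>0\<close> to \<open>\<pi>\<close>. For \<open>\<psi> = h / (h \<circ> \<iota>)\<close> the
  function \<open>\<xi> = \<psi> exp (2 i (k/n) \<theta>)\<close> takes values in the \<open>n\<close>-th roots of unity, hence is constant;
  but \<open>\<psi> = 1\<close> at the ends, where \<open>y = 0\<close>, so the two values of \<open>\<xi>\<close> differ by the factor
  \<open>exp (2 \<pi> i k/n)\<close>. As the coefficients of \<open>h\<close> are complex, it is the relation between the powers that puts \<open>\<psi>\<close> on the unit circle.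
\<close>

lemma no_smaller_torsion:
  fixes A B D :: "real poly" and a b :: real
  assumes "hyperelliptic g (complexify D)"
    and pell: "A ^ 2 - D * B ^ 2 = [:0, 1:] ^ \<epsilon>"
    and band: "0 < a" "a < b" "poly D a = 0" "poly D b = 0" "\<And>x. a < x \<Longrightarrow> x < b \<Longrightarrow> poly D x < 0"
    and B: "\<And>x. a \<le> x \<Longrightarrow> x \<le> b \<Longrightarrow> poly B x > 0" and A: "poly A a > 0" "poly A b < 0"
    and f: "(complexify A, - complexify B, [:0, 1:] ^ d) \<in> nonzero_functions"
    and ord: "\<And>Q. Q \<in> curve_points (complexify D) \<Longrightarrow>
      order_at (complexify D) Q (complexify A, - complexify B, [:0, 1:] ^ d)
        = int n * ((if Q = Infinite c then 1 else 0) - (if Q = Affine 0 0 then 1 else 0))"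
    and k: "0 < k" "k < n"
  shows "\<not> hyperelliptic.torsion (complexify D) (Affine 0 0) (Infinite c) k"
proof
  interpret hyperelliptic g "complexify D" by fact
  let ?D = "complexify D" and ?f = "(complexify A, - complexify B, [:0, 1:] ^ d)"
  assume "torsion (Affine 0 0) (Infinite c) k"
  then obtain h where h: "h \<in> nonzero_functions" and hord: "\<And>Q. Q \<in> curve_points ?D \<Longrightarrow>
      order_at ?D Q h = int k * ((if Q = Infinite c then 1 else 0) - (if Q = Affine 0 0 then 1 else 0))"
    unfolding torsion_def by blast
  obtain A' B' H' where h': "h = (A', B', H')" by (metis prod_cases3)
  have "order_at ?D (Affine x y) (A', B', H') \<ge> 0" if "y ^ 2 = poly ?D x" "x \<noteq> 0" for x y
    using hord [of "Affine x y"] that h' by (auto simp: curve_points_def)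
  from regular_normal_form [OF h [unfolded h'] this]
  obtain Q A1 B1 N where Q: "Q \<noteq> 0" "A' = Q * A1" "B' = Q * B1" "H' = Q * [:-0, 1:] ^ N" by blast
  let ?h = "(A1, B1, [:-0, 1:] ^ N)"
  have h1: "?h \<in> nonzero_functions" using h h' Q by (auto simp: nonzero_functions_def)
  have h1ord: "order_at ?D P ?h = int k * ((if P = Infinite c then 1 else 0) - (if P = Affine 0 0 then 1 else 0))"
    if "P \<in> curve_points ?D" for P
    using order_cancel [OF that Q(1), of A1 B1 "[:-0, 1:] ^ N"] hord [OF that] h' Q by simp
  have "int k * order_at ?D P ?f = int n * order_at ?D P ?h" if "P \<in> curve_points ?D" for P
    unfolding ord [OF that] h1ord [OF that] by simp
  then obtain e where e: "e \<noteq> 0" "\<And>x y. y ^ 2 = poly ?D x \<Longrightarrow> value_at ?f x y \<noteq> 0 \<Longrightarrow> value_at ?h x y \<noteq> 0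
      \<Longrightarrow> value_at ?h x (- y) \<noteq> 0 \<Longrightarrow> value_at ?f x y ^ k = e * value_at ?h x y ^ n"
    using proportional_orders [OF f h1, of k n] by blast
  define s where "s = (\<lambda>x. sqrt (- poly D x))"
  define y where "y = (\<lambda>x. \<i> * complex_of_real (s x))"
  define q where "q = (\<lambda>x :: real. sqrt (x ^ \<epsilon>))"
  define \<theta> where "\<theta> = (\<lambda>x. arccos (poly A x / q x))"
  define \<psi> where "\<psi> = (\<lambda>x. (poly A1 (of_real x) + poly B1 (of_real x) * y x) / (poly A1 (of_real x) - poly B1 (of_real x) * y x))"
  define t where "t = real k / real n"
  define \<xi> where "\<xi> = (\<lambda>x. \<psi> x * cis (2 * t * \<theta> x))"
  have Dle: "poly D x \<le> 0" if "x \<in> {a..b}" for x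
    using band(3,4) band(5) [of x] that by (cases "x = a"; cases "x = b") (auto simp: less_imp_le)
  have x0: "x > 0" if "x \<in> {a..b}" for x using that band(1) by simp
  have s2: "s x ^ 2 = - poly D x" "s x \<ge> 0" if "x \<in> {a..b}" for x
    using Dle [OF that] by (simp_all add: s_def)
  have y2: "y x ^ 2 = poly ?D (of_real x)" "(- y x) ^ 2 = poly ?D (of_real x)" if "x \<in> {a..b}" for x
  proof -
    have "y x ^ 2 = - complex_of_real (s x ^ 2)" by (simp add: y_def power_mult_distrib)
    also have "\<dots> = poly ?D (of_real x)" unfolding s2(1) [OF that] by simp
    finally show "y x ^ 2 = poly ?D (of_real x)" "(- y x) ^ 2 = poly ?D (of_real x)" by simp_all
  qed
  have q0: "q x > 0" "q x ^ 2 = x ^ \<epsilon>" if "x \<in> {a..b}" for x using x0 [OF that] by (simp_all add: q_def)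
  have circle: "poly A x ^ 2 + (poly B x * s x) ^ 2 = q x ^ 2" if "x \<in> {a..b}" for x
  proof -
    have "poly A x ^ 2 - poly D x * poly B x ^ 2 = x ^ \<epsilon>"
      using arg_cong [OF pell, of "\<lambda>p. poly p x"] by simp
    then show ?thesis using q0(2) [OF that] s2(1) [OF that] by (simp add: power_mult_distrib mult.commute)
  qed
  have A_le: "\<bar>poly A x\<bar> \<le> q x" if "x \<in> {a..b}" for x
  proof -
    have "poly A x ^ 2 \<le> q x ^ 2" using circle [OF that] zero_le_power2 [of "poly B x * s x"] by linarith
    then show ?thesis using q0(1) [OF that] abs_le_square_iff [of "poly A x" "q x"] by simp
  qed
  have range: "- 1 \<le> poly A x / q x" "poly A x / q x \<le> 1" if "x \<in> {a..b}" for x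
    using A_le [OF that] q0(1) [OF that] by (simp_all add: le_divide_eq divide_le_eq abs_le_iff)
  have polar: "complex_of_real (poly A x) + of_real (poly B x) * y x = of_real (q x) * cis (\<theta> x)"
    if x: "x \<in> {a..b}" for x
  proof -
    have "cos (\<theta> x) = poly A x / q x" unfolding \<theta>_def by (rule cos_arccos [OF range [OF x]])
    moreover have "sin (\<theta> x) = poly B x * s x / q x"
    proof -
      have "(poly B x * s x / q x) ^ 2 = 1 - (poly A x / q x) ^ 2"
      proof -
        have "(poly B x * s x) ^ 2 = q x ^ 2 - poly A x ^ 2" using circle [OF x] by linarith
        then show ?thesis using q0(1) [OF x] by (simp add: power_divide diff_divide_distrib)
      qed
      moreover have "poly B x * s x / q x \<ge> 0" using B [of x] s2(2) [OF x] q0(1) [OF x] x by simp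
      ultimately have "sqrt (1 - (poly A x / q x) ^ 2) = poly B x * s x / q x"
        by (rule real_sqrt_unique)
      then show ?thesis unfolding \<theta>_def using sin_arccos [OF range [OF x]] by simp
    qed
    ultimately show ?thesis using q0(1) [OF x] by (simp add: complex_eq_iff y_def)
  qed
  have polar': "complex_of_real (poly A x) - of_real (poly B x) * y x = of_real (q x) * cis (- \<theta> x)"
    if x: "x \<in> {a..b}" for x
    using arg_cong [OF polar [OF x], of cnj] by (simp add: y_def cis_cnj)
  have vf: "value_at ?f (of_real x) (y x) = of_real (q x) * cis (- \<theta> x) / of_real x ^ d"
    "value_at ?f (of_real x) (- y x) = of_real (q x) * cis (\<theta> x) / of_real x ^ d" if x: "x \<in> {a..b}" for x
    unfolding value_at_def using polar [OF x] polar' [OF x] by simp_all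
  have vf0: "value_at ?f (of_real x) (y x) \<noteq> 0" "value_at ?f (of_real x) (- y x) \<noteq> 0" if x: "x \<in> {a..b}" for x
    unfolding vf [OF x] using q0(1) [OF x] x0 [OF x] by simp_all
  have vh0: "value_at ?h (of_real x) z \<noteq> 0" if x: "x \<in> {a..b}" and z: "z ^ 2 = poly ?D (of_real x)" for x z
  proof (rule order_zero_value [OF h1 z])
    show "poly ([:-0, 1:] ^ N) (complex_of_real x) \<noteq> 0" using x0 [OF x] by simp
    show "order_at ?D (Affine (of_real x) z) ?h = 0"
      using h1ord [of "Affine (of_real x) z"] z x0 [OF x] by (auto simp: curve_points_def)
  qed
  have \<psi>_pow: "\<psi> x ^ n = cis (- 2 * real k * \<theta> x)" if x: "x \<in> {a..b}" for x
  proof -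
    note p = vh0 [OF x y2(1) [OF x]] and m = vh0 [OF x y2(2) [OF x]]
    have 1: "value_at ?f (of_real x) (y x) ^ k = e * value_at ?h (of_real x) (y x) ^ n"
      by (rule e(2) [OF y2(1) [OF x] vf0(1) [OF x] p m])
    have 2: "value_at ?f (of_real x) (- y x) ^ k = e * value_at ?h (of_real x) (- y x) ^ n"
      by (rule e(2) [OF y2(2) [OF x] vf0(2) [OF x] m]) (use p in simp)
    have "\<psi> x = value_at ?h (of_real x) (y x) / value_at ?h (of_real x) (- y x)"
      unfolding \<psi>_def value_at_def using x0 [OF x] by simp
    then have "\<psi> x ^ n = value_at ?h (of_real x) (y x) ^ n / value_at ?h (of_real x) (- y x) ^ n"
      by (simp add: power_divide)
    also have "\<dots> = (value_at ?f (of_real x) (y x) / value_at ?f (of_real x) (- y x)) ^ k"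
      unfolding power_divide 1 2 using e(1) by simp
    also have "value_at ?f (of_real x) (y x) / value_at ?f (of_real x) (- y x) = cis (- \<theta> x) / cis (\<theta> x)"
      unfolding vf [OF x] using q0(1) [OF x] x0 [OF x] by simp
    also have "\<dots> = cis (- 2 * \<theta> x)" by (simp add: cis_divide)
    finally show ?thesis unfolding Complex.DeMoivre by (simp only: mult_ac)
  qed
  have \<xi>_pow: "\<xi> x ^ n = 1" if x: "x \<in> {a..b}" for x
  proof -
    have eq: "real n * (2 * t * \<theta> x) = 2 * real k * \<theta> x" using k by (simp add: t_def)
    have "\<xi> x ^ n = cis (- 2 * real k * \<theta> x) * cis (2 * real k * \<theta> x)"
      unfolding \<xi>_def power_mult_distrib \<psi>_pow [OF x] Complex.DeMoivre eq ..
    then show ?thesis by (simp add: cis_mult)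
  qed
  have denom: "poly A1 (of_real x) - poly B1 (of_real x) * y x \<noteq> 0" if x: "x \<in> {a..b}" for x
    using vh0 [OF x y2(2) [OF x]] unfolding value_nonzero_iff by simp
  have cy: "continuous_on {a..b} y" unfolding y_def s_def by (intro continuous_intros)
  have c\<psi>: "continuous_on {a..b} \<psi>"
    unfolding \<psi>_def using denom by (intro continuous_intros cy) auto
  have cq: "continuous_on {a..b} q" unfolding q_def by (intro continuous_intros)
  have qne: "q x \<noteq> 0" if "x \<in> {a..b}" for x using q0(1) [OF that] by simp
  have c\<theta>: "continuous_on {a..b} \<theta>"
    unfolding \<theta>_def
    by (intro continuous_on_arccos continuous_intros cq ballI conjI range qne)
  have "continuous_on {a..b} \<xi>"
    unfolding \<xi>_def cis_conv_exp by (intro continuous_intros c\<psi> c\<theta>)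
  moreover have "finite (\<xi> ` {a..b})"
  proof (rule finite_subset)
    show "\<xi> ` {a..b} \<subseteq> {z. z ^ n = 1}" using \<xi>_pow by auto
    show "finite {z :: complex. z ^ n = 1}" using k by (intro finite_roots_unity) auto
  qed
  ultimately have "\<xi> constant_on {a..b}" by (intro continuous_finite_range_constant) auto
  then have "\<xi> a = \<xi> b" using band(2) unfolding constant_on_def by force
  have ab: "a \<in> {a..b}" "b \<in> {a..b}" using band(2) by auto
  have ends: "\<psi> x = 1" "\<bar>poly A x\<bar> = q x" if x: "x \<in> {a..b}" and "poly D x = 0" for x
  proof -
    have "s x = 0" using that by (simp add: s_def)
    then show "\<psi> x = 1" using denom [OF x] by (simp add: \<psi>_def y_def)
    have "poly A x ^ 2 = q x ^ 2" using circle [OF x] \<open>s x = 0\<close> by simp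
    then have "sqrt (poly A x ^ 2) = sqrt (q x ^ 2)" by simp
    then show "\<bar>poly A x\<bar> = q x" using q0(1) [OF x] by simp
  qed
  have "poly A a = q a" using ends(2) [OF ab(1) band(3)] A(1) by simp
  then have "\<theta> a = 0" unfolding \<theta>_def using q0(1) [OF ab(1)] by simp
  then have \<xi>a: "\<xi> a = 1" using ends(1) [OF ab(1) band(3)] by (simp add: \<xi>_def)
  have "poly A b = - q b" using ends(2) [OF ab(2) band(4)] A(2) by simp
  then have "\<theta> b = pi" unfolding \<theta>_def using q0(1) [OF ab(2)] by simp
  then have "\<xi> b = cis (2 * t * pi)" using ends(1) [OF ab(2) band(4)] by (simp add: \<xi>_def)
  then have "cis (2 * t * pi) = 1" using \<open>\<xi> a = \<xi> b\<close> \<xi>a by simp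
  then have "cos (2 * t * pi) = 1" by (metis cis.sel(1) one_complex.sel(1))
  then obtain i :: int where "2 * t * pi = of_int i * 2 * pi"
    unfolding cos_one_2pi_int by blast
  then have "t = of_int i" by simp
  moreover have "0 < t" "t < 1" using k by (simp_all add: t_def)
  ultimately have "of_int 0 < real_of_int i" "real_of_int i < of_int 1" by simp_all
  then show False unfolding of_int_less_iff by simp
qed

theorem mainTheorem3:
  fixes g n :: nat
  assumes "g \<ge> 2" and "n > 2"
  shows "(\<exists>D W P. totally_real_hyperelliptic g D \<and> W \<in> weierstrass_points D \<and>
            P \<in> curve_points D \<and> primitive_torsion_point D W n P) \<longleftrightarrow> n > 2 * g"
proof
  assume "\<exists>D W P. totally_real_hyperelliptic g D \<and> W \<in> weierstrass_points D \<and>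
            P \<in> curve_points D \<and> primitive_torsion_point D W n P"
  then obtain D W P where D: "totally_real_hyperelliptic g D" and P: "W \<in> weierstrass_points D"
    "P \<in> curve_points D" "primitive_torsion_point D W n P" by blast
  interpret hyperelliptic g D
    using D by unfold_locales (auto simp: totally_real_hyperelliptic_def)
  show "n > 2 * g" by (rule primitive_torsion_lower_bound [OF P assms(2)])
next
  assume n: "n > 2 * g"
  define m where "m = n div 2"
  define \<epsilon> where "\<epsilon> = n mod 2"
  have nm: "n = 2 * m + \<epsilon>" and \<epsilon>: "\<epsilon> \<le> 1" by (simp_all add: m_def \<epsilon>_def)
  have "g \<ge> 1" using assms(1) by simp
  obtain A B D :: "real poly" and E :: "real set" and c a b :: real
    where E: "c \<noteq> 0" "finite E" "card E = 2 * g + 2" "0 \<in> E" "D = Polynomial.smult c (\<Prod>e\<in>E. [:-e, 1:])"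
      and pell: "A ^ 2 - D * B ^ 2 = [:0, 1:] ^ \<epsilon>" and dA: "Polynomial.degree A = m + \<epsilon>"
      and band: "0 < a" "a < b" "poly D a = 0" "poly D b = 0" "\<And>x. a < x \<Longrightarrow> x < b \<Longrightarrow> poly D x < 0"
        "\<And>x. a \<le> x \<Longrightarrow> x \<le> b \<Longrightarrow> poly B x > 0" "poly A a > 0" "poly A b < 0"
    by (rule totally_real_pell [OF \<open>g \<ge> 1\<close> n [unfolded nm] \<epsilon>], rule that)
  have tr: "totally_real_hyperelliptic g (complexify D)" by (rule totally_real_complexify [OF E(1-3,5)])
  interpret hyperelliptic g "complexify D"
    using tr by unfold_locales (auto simp: totally_real_hyperelliptic_def)
  have D0: "poly D 0 = 0" unfolding E(5) using E(2,4) by (auto simp: poly_prod)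
  then have D0': "poly (complexify D) 0 = 0" using poly_complexify [of D 0] by simp
  have pell': "complexify A ^ 2 - complexify D * complexify B ^ 2 = [:0, 1:] ^ \<epsilon>"
    using arg_cong [OF pell, of complexify] by simp
  have dA': "Polynomial.degree (complexify A) = m + \<epsilon>" using dA by simp
  have pos: "m + \<epsilon> > 0" using nm assms(2) by auto
  obtain v where v: "v ^ 2 = lead_coeff (complexify D)"
    and f: "(complexify A, - complexify B, [:0, 1:] ^ (m + \<epsilon>)) \<in> nonzero_functions"
    and ord: "\<And>Q. Q \<in> curve_points (complexify D) \<Longrightarrow>
      order_at (complexify D) Q (complexify A, - complexify B, [:0, 1:] ^ (m + \<epsilon>))
      = int (2 * m + \<epsilon>) * ((if Q = Infinite v then 1 else 0) - (if Q = Affine 0 0 then 1 else 0))"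
    by (rule pell_torsion [OF pell' \<epsilon> dA' pos D0'], rule that)
  let ?W = "Affine 0 0" and ?P = "Infinite v"
  have W: "?W \<in> weierstrass_points (complexify D)" "?W \<in> curve_points (complexify D)"
    using D0' by (auto simp: weierstrass_points_def curve_points_def)
  have P: "?P \<in> curve_points (complexify D)" using v by (auto simp: curve_points_def)
  have "torsion ?W ?P n" unfolding torsion_def nm using f ord by blast
  moreover have "\<not> torsion ?W ?P k" if "0 < k" "k < n" for k
    by (rule no_smaller_torsion [OF hyperelliptic_axioms pell band f ord that [unfolded nm]])
  ultimately have "primitive_torsion_point (complexify D) ?W n ?P"
    unfolding primitive_torsion_iff [OF W(2) P] by blast
  then show "\<exists>D W P. totally_real_hyperelliptic g D \<and> W \<in> weierstrass_points D \<and>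
            P \<in> curve_points D \<and> primitive_torsion_point D W n P"
    using tr W P by blast
qed

end
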